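(* Let $\nu>0$, $\alpha>0$. Suppose $u^0\in\dot H^{\frac{\log 3}{2\log 2}}_{\mathcal M}$ is odd, permutation symmetric, and $\sigma$-mirror symmetric, and can therefore be expressed in the form $$u^0(x)=-2\sum_{n=0}^{\infty}\psi_n(0)\sum_{k\in\mathcal M_n^+}v^k\sin(2\pi k\cdot x).$$ Then these symmetries are preserved by the dynamics of the Fourier-restricted hypodissipative Navier--Stokes equation: if $u\in C\big([0,T_{max});\dot H^{\frac{\log 3}{2\log 2}}_{\mathcal M}\big)$ is the unique solution with initial data $u^0$ ($T_{max}$ being the maximal time of existence), then for all $0\le t<T_{max}$, $$u(x,t)=-2\sum_{n=0}^{\infty}\psi_n(t)\sum_{k\in\mathcal M_n^+}v^k\sin(2\pi k\cdot x).$$ Furthermore, for all $0<t<T_{max}$ and all integers $n\ge0$, the Fourier coefficients satisfy the system of ODEs $$\partial_t\psi_n=-(12\pi^2)^\alpha\mu_n^\alpha\,\nu\,(\sqrt3)^{2\tilde\alpha n}\psi_n+\sqrt2\,\pi\,\beta_{n-1}(\sqrt3)^{n}\psi_{n-1}^2-\sqrt2\,\pi\,\beta_n(\sqrt3)^{n+1}\psi_n\psi_{n+1},$$ where $\tilde\alpha=\frac{2\log 2}{\log 3}\alpha$, and for all integers $n\ge0$ $$\beta_n=\frac1{\big(1+\frac12(\frac34)^n\big)^{1/2}},\qquad \mu_n=\frac1{\big(1+\frac23(\frac34)^n\big)^{1/2}},$$ and by convention $\psi_{-1}=\beta_{-1}:=0$. Further suppose that $\alpha<\frac{\log 3}{6\log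 2}$ and that for some $\tilde\alpha<s<\frac13$, $$H_s(0)=\sum_{n=0}^\infty(\sqrt3)^{-sn}\psi_n(0)>C_{\alpha,s}\,\nu,$$ where $$C_{\alpha,s}=\frac{\sqrt3\,(12\pi^2)^\alpha}{\pi\big(1-(\sqrt3)^{-(1+s-4\tilde\alpha)}\big)^{1/2}\big((\sqrt3)^{1-s}-(\sqrt3)^{\frac{1+s}2}\big)\big(1-(\sqrt3)^{-(1+s)}\big)^{1/2}}.$$ Then the solution blows up in finite time with $$T_{max}\le\frac1{\kappa_sH_s(0)},\qquad \kappa_s=\frac{\pi}{\sqrt3}\Big((\sqrt3)^{1-s}-(\sqrt3)^{\frac{1+s}2}\Big)\Big(1-(\sqrt3)^{-(1+s)}\Big).$$ This finite-time blowup is implied by a singular lower bound on the Lyapunov functional $H_s(t)=\sum_{n=0}^\infty(\sqrt3)^{-sn}\psi_n(t)$: for all $0<t<T_{max}$, $$H_s(t)>\frac{H_s(0)}{1-\kappa_sH_s(0)t}.$$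
   Context: Function spaces: $\mathbb T^3=\mathbb R^3/\mathbb Z^3$, $\hat u(k)=\int_{\mathbb T^3}u(x)e^{-2\pi i k\cdot x}\,dx$ for $k\in\mathbb Z^3$. For $s\ge0$, $\dot H^s=\dot H^s(\mathbb T^3;\mathbb R^3)$ is the space of mean-zero $L^2$ vector fields with $\|u\|_{\dot H^s}^2=\sum_{k\ne0}(4\pi^2|k|^2)^s|\hat u(k)|^2<\infty$. $(-\Delta)^\alpha$ is the Fourier multiplier $(4\pi^2|k|^2)^\alpha$. Frequencies: let $\sigma=(1,1,1)$. For integers $m\ge0$ let $k^m=2^{2m}\sigma+3^m(1,0,-1)$, $h^m=2^{2m+1}\sigma+3^m(1,1,-2)$, $j^m=2^{2m+1}\sigma+3^m(2,-1,-1)$. For $v\in\mathbb R^3$, $\mathcal P[v]$ is the set of all vectors obtained by permuting the entries of $v$. Let $\mathcal M^+_{2m}=\mathcal P[k^m]$, $\mathcal M^+_{2m+1}=\mathcal P[h^m]\cup\mathcal P[j^m]$, $\mathcal M^+=\bigcup_{n\ge0}\mathcal M_n^+$, $\mathcal M=\mathcal M^+\cup(-\mathcal M^+)$. For $k\in\mathcal M$ let $P_k^\perp(\sigma)=\sigma-\frac{k\cdot\sigma}{|k|^2}k$ and $v^k=P_k^\perp(\sigma)/|P_k^\perp(\sigma)|$. Constraint space: $\dot H^s_{\mathcal M}$ is the set of $u\in\dot H^s(\mathbb T^3;\mathbb R^3)$ with $\operatorname{supp}\hat u\subset\mathcal M$ and $\hat u(k)\in\operatorname{span}\{v^k\}$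 (complex multiples of $v^k$) for all $k\in\mathcal M$. The projection $\mathbb P_{\mathcal M}$ is given by $\widehat{\mathbb P_{\mathcal M}w}(k)=(v^k\cdot\hat w(k))v^k$ for $k\in\mathcal M$ and $0$ for $k\notin\mathcal M$; $(u\cdot\nabla)u=\nabla\cdot(u\otimes u)$ in the sense of distributions. Equation: the Fourier-restricted hypodissipative Navier--Stokes equation is $\partial_tu+\nu(-\Delta)^\alpha u+\mathbb P_{\mathcal M}((u\cdot\nabla)u)=0$. A solution $u\in C([0,T);\dot H^s_{\mathcal M})$ (with $s\ge0$, $s>\frac{\log3}{2\log2}-2\alpha$) is understood as a mild solution: for all $0<t<T$, $u(\cdot,t)=e^{-\nu t(-\Delta)^\alpha}u^0-\int_0^te^{-\nu(t-\tau)(-\Delta)^\alpha}\mathbb P_{\mathcal M}((u\cdot\nabla)u)(\cdot,\tau)\,d\tau$. Symmetries: $u$ is odd if $u(-x)=-u(x)$; permutation symmetric if $u(Px)=Pu(x)$ for every permutation $P$ of $\{1,2,3\}$ acting on vectors by $(Pv)_i=v_{P(i)}$; $\sigma$-mirror symmetric if $u(x)=M_\sigma u(M_\sigma x)$ for all $x$, where $M_\sigma=I_3-\frac23\sigma\otimes\sigma$ and $u$ is extended periodically to $\mathbb R^3$.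
   Formalization: In the ODE system the dissipation factor $\mu_n^\alpha$ is corrected to $\mu_n^{-2\alpha}$, because $4\pi^2|k|^2=12\pi^2 4^n\mu_n^{-2}$ on the $n$-th shell; as printed, the ODE would force every $\psi_n$ to vanish. *)

theory Defs
  imports "HOL-Analysis.Analysis"
begin

section \<open>Vector fields on the torus and their Fourier coefficients\<close>

text \<open>A field on the torus is a \<open>1\<close>-periodic function on \<open>real^3\<close>, standing for its class
  modulo almost everywhere equality. Frequencies live in \<open>int^3\<close>.\<close>

definition rvec :: "int^3 \<Rightarrow> real^3" where
  "rvec k = (\<chi> i. real_of_int (k $ i))"

definition cvec :: "real^3 \<Rightarrow> complex^3" where
  "cvec v = (\<chi> i. complex_of_real (v $ i))"

definition torus_L2 :: "(real^3 \<Rightarrow> real^3) \<Rightarrow> bool" where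
  "torus_L2 u \<longleftrightarrow>
     (\<forall>x k. u (x + rvec k) = u x) \<and>
     u \<in> borel_measurable lebesgue \<and>
     integrable (lebesgue_on (cbox 0 1)) (\<lambda>x. (norm (u x))\<^sup>2)"

definition fcoeff :: "(real^3 \<Rightarrow> real) \<Rightarrow> int^3 \<Rightarrow> complex" where
  "fcoeff f k =
     (LINT x|lebesgue_on (cbox 0 1).
        complex_of_real (f x) * exp (- 2 * complex_of_real pi * \<i> * complex_of_real (rvec k \<bullet> x)))"

definition fhat :: "(real^3 \<Rightarrow> real^3) \<Rightarrow> int^3 \<Rightarrow> complex^3" where
  "fhat u k = (\<chi> i. fcoeff (\<lambda>x. u x $ i) k)"

text \<open>The symbol of the fractional Laplacian \<open>(-\<Delta>)\<^sup>\<alpha>\<close>.\<close>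

definition lap_symbol :: "real \<Rightarrow> int^3 \<Rightarrow> real" where
  "lap_symbol \<alpha> k = (4 * pi\<^sup>2 * (norm (rvec k))\<^sup>2) powr \<alpha>"

definition Hdot :: "real \<Rightarrow> (real^3 \<Rightarrow> real^3) set" where
  "Hdot s = {u. torus_L2 u \<and> fhat u 0 = 0 \<and>
     (\<lambda>k. lap_symbol s k * (norm (fhat u k))\<^sup>2) summable_on - {0}}"

definition Hdot_norm :: "real \<Rightarrow> (real^3 \<Rightarrow> real^3) \<Rightarrow> real" where
  "Hdot_norm s u = sqrt (\<Sum>\<^sub>\<infinity>k\<in>- {0}. lap_symbol s k * (norm (fhat u k))\<^sup>2)"

section \<open>The restricted frequency set and the constraint space\<close>

definition perm_vec :: "(3 \<Rightarrow> 3) \<Rightarrow> 'a^3 \<Rightarrow> 'a^3" where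
  "perm_vec p v = (\<chi> i. v $ p i)"

definition perms :: "'a^3 \<Rightarrow> ('a^3) set" where
  "perms v = {perm_vec p v | p. p permutes UNIV}"

definition kfreq :: "nat \<Rightarrow> int^3" where
  "kfreq m = 2^(2*m) *s vector [1, 1, 1] + 3^m *s vector [1, 0, -1]"

definition hfreq :: "nat \<Rightarrow> int^3" where
  "hfreq m = 2^(2*m+1) *s vector [1, 1, 1] + 3^m *s vector [1, 1, -2]"

definition jfreq :: "nat \<Rightarrow> int^3" where
  "jfreq m = 2^(2*m+1) *s vector [1, 1, 1] + 3^m *s vector [2, -1, -1]"

definition Mshell :: "nat \<Rightarrow> (int^3) set" where
  "Mshell n = (if even n then perms (kfreq (n div 2))
               else perms (hfreq (n div 2)) \<union> perms (jfreq (n div 2)))"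

definition Mplus :: "(int^3) set" where
  "Mplus = (\<Union>n. Mshell n)"

definition Mset :: "(int^3) set" where
  "Mset = Mplus \<union> uminus ` Mplus"

definition sigma :: "real^3" where
  "sigma = vector [1, 1, 1]"

definition Pperp_sigma :: "int^3 \<Rightarrow> real^3" where
  "Pperp_sigma k = sigma - ((rvec k \<bullet> sigma) / (norm (rvec k))\<^sup>2) *\<^sub>R rvec k"

definition vdir :: "int^3 \<Rightarrow> real^3" where
  "vdir k = (1 / norm (Pperp_sigma k)) *\<^sub>R Pperp_sigma k"

definition HdotM :: "real \<Rightarrow> (real^3 \<Rightarrow> real^3) set" where
  "HdotM s = {u \<in> Hdot s.
     (\<forall>k. k \<notin> Mset \<longrightarrow> fhat u k = 0) \<and>
     (\<forall>k\<in>Mset. \<exists>c::complex. fhat u k = c *s cvec (vdir k))}"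

section \<open>Mild solutions of the Fourier-restricted equation\<close>

text \<open>Distributions on the torus are represented by their families of Fourier coefficients;
  the operators below act on such families, and the time integral in the mild formulation is
  the integral of a distribution-valued function, taken coefficient by coefficient.\<close>

definition proj_M :: "(int^3 \<Rightarrow> complex^3) \<Rightarrow> (int^3 \<Rightarrow> complex^3)" where
  "proj_M w k = (if k \<in> Mset
     then (\<Sum>i\<in>UNIV. complex_of_real (vdir k $ i) * w k $ i) *s cvec (vdir k) else 0)"

text \<open>The distribution \<open>(u \<cdot> \<nabla>) u = \<nabla> \<cdot> (u \<otimes> u)\<close>; for \<open>u\<close> in \<open>L\<^sup>2\<close> the products \<open>u\<^sub>j u\<^sub>i\<close> are
  in \<open>L\<^sup>1\<close>, and the distributional derivative \<open>\<partial>\<^sub>j\<close> multiplies the coefficient at \<open>k\<close>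
  by \<open>2 \<pi> \<i> k\<^sub>j\<close>.\<close>

definition convection :: "(real^3 \<Rightarrow> real^3) \<Rightarrow> (int^3 \<Rightarrow> complex^3)" where
  "convection u k =
     (\<chi> i. \<Sum>j\<in>UNIV. 2 * complex_of_real pi * \<i> * complex_of_int (k $ j) *
              fcoeff (\<lambda>x. u x $ j * u x $ i) k)"

definition heat :: "real \<Rightarrow> real \<Rightarrow> real \<Rightarrow> (int^3 \<Rightarrow> complex^3) \<Rightarrow> (int^3 \<Rightarrow> complex^3)" where
  "heat \<nu> \<alpha> t w k = exp (- \<nu> * t * lap_symbol \<alpha> k) *\<^sub>R w k"

definition mild_solution ::
  "real \<Rightarrow> real \<Rightarrow> real \<Rightarrow> (real^3 \<Rightarrow> real^3) \<Rightarrow> (real \<Rightarrow> real^3 \<Rightarrow> real^3) \<Rightarrow> ereal \<Rightarrow> bool" where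
  "mild_solution \<nu> \<alpha> s u0 u T \<longleftrightarrow>
     0 < T \<and>
     (\<forall>t. 0 \<le> t \<and> ereal t < T \<longrightarrow> u t \<in> HdotM s) \<and>
     (\<forall>t0. 0 \<le> t0 \<and> ereal t0 < T \<longrightarrow>
        ((\<lambda>t. Hdot_norm s (\<lambda>x. u t x - u t0 x)) \<longlongrightarrow> 0) (at t0 within {t. 0 \<le> t \<and> ereal t < T})) \<and>
     (AE x in lebesgue. u 0 x = u0 x) \<and>
     (\<forall>t. 0 < t \<and> ereal t < T \<longrightarrow> (\<forall>k.
        fhat (u t) k = heat \<nu> \<alpha> t (fhat u0) k
          - integral {0..t} (\<lambda>\<tau>. heat \<nu> \<alpha> (t - \<tau>) (proj_M (convection (u \<tau>))) k)))"

definition maximal_solution ::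
  "real \<Rightarrow> real \<Rightarrow> real \<Rightarrow> (real^3 \<Rightarrow> real^3) \<Rightarrow> (real \<Rightarrow> real^3 \<Rightarrow> real^3) \<Rightarrow> ereal \<Rightarrow> bool" where
  "maximal_solution \<nu> \<alpha> s u0 u Tmax \<longleftrightarrow>
     mild_solution \<nu> \<alpha> s u0 u Tmax \<and>
     (\<forall>u' T'. mild_solution \<nu> \<alpha> s u0 u' T' \<longrightarrow> T' \<le> Tmax)"

section \<open>Symmetries and the shell expansion\<close>

definition odd_field :: "(real^3 \<Rightarrow> real^3) \<Rightarrow> bool" where
  "odd_field u \<longleftrightarrow> (AE x in lebesgue. u (- x) = - u x)"

definition perm_symmetric :: "(real^3 \<Rightarrow> real^3) \<Rightarrow> bool" where
  "perm_symmetric u \<longleftrightarrow>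
     (\<forall>p. p permutes UNIV \<longrightarrow> (AE x in lebesgue. u (perm_vec p x) = perm_vec p (u x)))"

definition mirror :: "real^3 \<Rightarrow> real^3" where
  "mirror x = x - (2/3 * (sigma \<bullet> x)) *\<^sub>R sigma"

definition mirror_symmetric :: "(real^3 \<Rightarrow> real^3) \<Rightarrow> bool" where
  "mirror_symmetric u \<longleftrightarrow> (AE x in lebesgue. u x = mirror (u (mirror x)))"

definition shell_field :: "nat \<Rightarrow> real^3 \<Rightarrow> real^3" where
  "shell_field n x = (\<Sum>k\<in>Mshell n. sin (2 * pi * (rvec k \<bullet> x)) *\<^sub>R vdir k)"

definition shell_expansion :: "(nat \<Rightarrow> real) \<Rightarrow> (real^3 \<Rightarrow> real^3) \<Rightarrow> bool" where
  "shell_expansion a u \<longleftrightarrow>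
     (AE x in lebesgue. summable (\<lambda>n. a n *\<^sub>R shell_field n x) \<and>
        u x = - 2 *\<^sub>R (\<Sum>n. a n *\<^sub>R shell_field n x))"

section \<open>Constants of the shell system\<close>

definition s_crit :: real where
  "s_crit = ln 3 / (2 * ln 2)"

definition alpha_t :: "real \<Rightarrow> real" where
  "alpha_t \<alpha> = 2 * ln 2 / ln 3 * \<alpha>"

definition beta :: "nat \<Rightarrow> real" where
  "beta n = 1 / sqrt (1 + 1/2 * (3/4)^n)"

text \<open>For \<open>k\<close> in the \<open>n\<close>-th shell, \<open>|k|\<^sup>2 = 3 \<cdot> 4^n \<cdot> (1 + 2/3 \<cdot> (3/4)^n) = 3 \<cdot> 4^n / \<mu>\<^sub>n\<^sup>2\<close>, so the
  symbol of \<open>(-\<Delta>)\<^sup>\<alpha>\<close> there is \<open>(12 \<pi>\<^sup>2)\<^sup>\<alpha> \<mu>\<^sub>n powr (-2 \<alpha>) (\<surd>3) powr (2 \<alpha>\<^sub>t n)\<close>, where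
  \<open>\<alpha>\<^sub>t\<close> is \<open>alpha_t \<alpha>\<close>. The source writes \<open>\<mu>\<^sub>n powr \<alpha>\<close> with this \<open>\<mu>\<^sub>n\<close>, which contradicts that
  identity; the exponent \<open>-2 \<alpha>\<close> in \<open>shell_rhs\<close> is the correct one.\<close>

definition mu :: "nat \<Rightarrow> real" where
  "mu n = 1 / sqrt (1 + 2/3 * (3/4)^n)"

definition shell_rhs :: "real \<Rightarrow> real \<Rightarrow> (nat \<Rightarrow> real) \<Rightarrow> nat \<Rightarrow> real" where
  "shell_rhs \<nu> \<alpha> a n =
     - ((12 * pi\<^sup>2) powr \<alpha> * mu n powr (- 2 * \<alpha>) * \<nu> * sqrt 3 powr (2 * alpha_t \<alpha> * real n) * a n)
     + (if n = 0 then 0 else sqrt 2 * pi * beta (n - 1) * sqrt 3 ^ n * (a (n - 1))\<^sup>2)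
     - sqrt 2 * pi * beta n * sqrt 3 ^ (n + 1) * a n * a (n + 1)"

definition lyap_term :: "real \<Rightarrow> (nat \<Rightarrow> real) \<Rightarrow> nat \<Rightarrow> real" where
  "lyap_term s a n = sqrt 3 powr (- s * real n) * a n"

definition lyap :: "real \<Rightarrow> (nat \<Rightarrow> real) \<Rightarrow> real" where
  "lyap s a = (\<Sum>n. lyap_term s a n)"

definition C_const :: "real \<Rightarrow> real \<Rightarrow> real" where
  "C_const \<alpha> s =
     sqrt 3 * (12 * pi\<^sup>2) powr \<alpha> /
     (pi * sqrt (1 - sqrt 3 powr (- (1 + s - 4 * alpha_t \<alpha>)))
         * (sqrt 3 powr (1 - s) - sqrt 3 powr ((1 + s) / 2))
         * sqrt (1 - sqrt 3 powr (- (1 + s))))"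

definition kappa :: "real \<Rightarrow> real" where
  "kappa s = pi / sqrt 3 * (sqrt 3 powr (1 - s) - sqrt 3 powr ((1 + s) / 2))
               * (1 - sqrt 3 powr (- (1 + s)))"

end

(*
  A frequency k of the n-th shell is 2^n sigma + w with w orthogonal to sigma and |w|^2 = 2 3^n, the
  vectors w forming a hexagon. Comparing components along sigma, a triad a + b = k inside the frequency
  set consists of two frequencies of one shell and one of the next; every frequency takes part in the
  same number of triads, always with the same coefficient. A field of the critical space has an
  absolutely convergent Fourier series, so the equation becomes an infinite system of ODEs for its
  coefficients c, locally Lipschitz in sup |c_k| 3^(n/2). If c solves this system then so does -cnj c,
  and the system does not distinguish frequencies of one shell; hence, by uniqueness, coefficients that
  are initially imaginary and constant on shells remain so, which yields the symmetries and the shell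
  system. There the Lyapunov functional satisfies H' > kappa H^2 as long as H > C nu, by Cauchy-Schwarz.
*)
theory Submission
  imports Defs
begin

section \<open>The frequency shells and their triads\<close>

text \<open>The weight 3^(n/2) fits the nonlinearity exactly: at a frequency of shell n every
  product has a coefficient of size 3^(n/2), while each of its two factors is bounded by a multiple
  of 3^(-n/2). The bilinear term is therefore bounded on the weighted sup space itself, and Picard
  iteration needs no smoothing from the dissipation. Uniqueness is proved in a form that compares
  one solution at k with another at any k' of the same shell, so no symmetry has to be transported
  through the equation. The symmetries at time t are read off from the expansion afterwards. In the
  Lyapunov estimate the quadratic part is at least 2 (pi / sqrt 3) G Q, where Q is a weighted square
  sum of the amplitudes and G the difference of powers in \<open>kappa\<close>. The threshold makes
  one half of it absorb the viscosity; the other half is at least kappa H^2. The delicate point is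
  that the dissipation carries the factor mu_n powr (-2 \<alpha>) > 1, of which the threshold shows
  no trace; the gap between beta_n and beta_0 pays for it.\<close>

lemma exhaust_perm3:
  fixes p :: "3 \<Rightarrow> 3"
  assumes "p permutes UNIV"
  shows "(p 1, p 2, p 3) \<in> {(1,2,3),(1,3,2),(2,1,3),(2,3,1),(3,1,2),(3,2,1)}"
proof -
  have "inj p" using assms permutes_inj by blast
  then have "p 1 \<noteq> p 2" "p 1 \<noteq> p 3" "p 2 \<noteq> p 3" by (simp_all add: inj_eq)
  then show ?thesis
    using exhaust_3[of "p 1"] exhaust_3[of "p 2"] exhaust_3[of "p 3"] by (elim disjE) simp_all
qed

lemma vec3_eq_iff: "v = (w :: 'a^3) \<longleftrightarrow> v $ 1 = w $ 1 \<and> v $ 2 = w $ 2 \<and> v $ 3 = w $ 3"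
  by (auto simp: vec_eq_iff forall_3)

lemma ex_perm3:
  assumes "(a, b, c) \<in> {(1,2,3),(1,3,2),(2,1,3),(2,3,1),(3,1,2),(3,2,1::3)}"
  shows "\<exists>p. p permutes (UNIV :: 3 set) \<and> p 1 = a \<and> p 2 = b \<and> p 3 = c"
proof -
  define p :: "3 \<Rightarrow> 3" where "p i = (if i = 1 then a else if i = 2 then b else c)" for i
  have v: "p 1 = a" "p 2 = b" "p 3 = c" by (auto simp: p_def)
  have "inj p"
    using assms v by (auto simp: inj_on_def forall_3)
  then have "bij p"
    by (simp add: bij_def finite_UNIV_inj_surj)
  then have "p permutes UNIV" by (simp add: permutes_def bij_iff)
  with v show ?thesis by blast
qed

lemma perms_eq:
  "perms v = {vector [v $ 1, v $ 2, v $ 3], vector [v $ 1, v $ 3, v $ 2], vector [v $ 2, v $ 1, v $ 3],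
     vector [v $ 2, v $ 3, v $ 1], vector [v $ 3, v $ 1, v $ 2], vector [v $ 3, v $ 2, v $ 1]}"
    (is "_ = ?R")
proof
  show "perms v \<subseteq> ?R"
  proof
    fix w assume "w \<in> perms v"
    then obtain p where p: "p permutes UNIV" "w = perm_vec p v" by (auto simp: perms_def)
    have "w = vector [v $ p 1, v $ p 2, v $ p 3]"
      by (simp add: p perm_vec_def vec3_eq_iff)
    then show "w \<in> ?R" using exhaust_perm3[OF p(1)] by auto
  qed
  have "vector [v $ a, v $ b, v $ c] \<in> perms v"
    if abc: "(a, b, c) \<in> {(1,2,3),(1,3,2),(2,1,3),(2,3,1),(3,1,2),(3,2,1::3)}" for a b c
  proof -
    obtain p where p: "p permutes (UNIV :: 3 set)" "p 1 = a" "p 2 = b" "p 3 = c"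
      using ex_perm3[OF abc] by blast
    then have "vector [v $ a, v $ b, v $ c] = perm_vec p v"
      by (simp add: perm_vec_def vec3_eq_iff)
    then show ?thesis using p(1) by (auto simp: perms_def)
  qed
  from this[of 1 2 3] this[of 1 3 2] this[of 2 1 3] this[of 2 3 1] this[of 3 1 2] this[of 3 2 1]
  show "?R \<subseteq> perms v" by simp
qed

lemma self_in_perms: "v \<in> perms (v :: int^3)"
  unfolding perms_eq by (simp add: vec3_eq_iff)

text \<open>The part of a frequency orthogonal to sigma, divided by 3^(n div 2): the short roots of
  the root system G2 for even n, the long roots for odd n. With integer triples, membership and
  addition are settled by simplification.\<close>

definition hex :: "nat \<Rightarrow> (int \<times> int \<times> int) set" where
  "hex n = (if even n then {(1,0,-1),(1,-1,0),(0,1,-1),(0,-1,1),(-1,1,0),(-1,0,1)}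
            else {(1,1,-2),(1,-2,1),(-2,1,1),(2,-1,-1),(-1,2,-1),(-1,-1,2)})"

definition emb :: "nat \<Rightarrow> int \<times> int \<times> int \<Rightarrow> int^3" where
  "emb n w = (case w of (a, b, c) \<Rightarrow>
     vector [2^n + 3^(n div 2) * a, 2^n + 3^(n div 2) * b, 2^n + 3^(n div 2) * c])"

lemma Mshell_eq: "Mshell n = emb n ` hex n"
proof (cases "even n")
  case True
  then obtain m where m: "n = 2 * m" by blast
  have *: "perms (kfreq m) = emb n ` {(1,0,-1),(1,-1,0),(0,1,-1),(0,-1,1),(-1,1,0),(-1,0,1)}"
    unfolding perms_eq by (simp add: m kfreq_def emb_def insert_commute)
  show ?thesis
    using True * by (simp add: m Mshell_def hex_def)
next
  case False
  then obtain m where m: "n = 2 * m + 1" by (blast elim: oddE)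
  have d: "n div 2 = m" by (simp add: m)
  have 1: "perms (hfreq m) = emb n ` {(1,1,-2),(1,-2,1),(-2,1,1)}"
    unfolding perms_eq emb_def d by (simp add: hfreq_def m insert_commute)
  have 2: "perms (jfreq m) = emb n ` {(2,-1,-1),(-1,2,-1),(-1,-1,2)}"
    unfolding perms_eq emb_def d by (simp add: jfreq_def m insert_commute)
  show ?thesis
    using False unfolding Mshell_def hex_def d 1 2 by (simp add: insert_commute)
qed


lemma finite_hex [simp]: "finite (hex n)"
  by (simp add: hex_def)

lemma card_hex: "card (hex n) = 6"
  by (simp add: hex_def)

lemma emb_nth: "emb n (a, b, c) $ 1 = 2^n + 3^(n div 2) * a" "emb n (a, b, c) $ 2 = 2^n + 3^(n div 2) * b"
  "emb n (a, b, c) $ 3 = 2^n + 3^(n div 2) * c"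
  by (simp_all add: emb_def)

lemma inj_emb: "inj (emb n)"
  by (auto simp: inj_on_def vec3_eq_iff emb_nth)

lemma finite_Mshell [simp]: "finite (Mshell n)"
  by (simp add: Mshell_eq)

lemma card_Mshell: "card (Mshell n) = 6"
  unfolding Mshell_eq using card_image[OF inj_on_subset[OF inj_emb subset_UNIV]] card_hex by metis

text \<open>The integer k . sigma. It equals 3 * 2^n on shell n, so a relation a + b = k becomes one
  between signed powers of two.\<close>

definition csum :: "int^3 \<Rightarrow> int" where
  "csum k = k $ 1 + k $ 2 + k $ 3"

lemma csum_add: "csum (a + b) = csum a + csum b" and csum_minus: "csum (- a) = - csum a"
  by (simp_all add: csum_def)

lemma hex_sum: "(a, b, c) \<in> hex n \<Longrightarrow> a + b + c = 0"
  by (auto simp: hex_def split: if_splits)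

lemma hex_square: "(a, b, c) \<in> hex n \<Longrightarrow> a\<^sup>2 + b\<^sup>2 + c\<^sup>2 = (if even n then 2 else 6)"
  by (auto simp: hex_def split: if_splits)

lemma csum_Mshell: "k \<in> Mshell n \<Longrightarrow> csum k = 3 * 2^n"
proof -
  assume "k \<in> Mshell n"
  then obtain a b c where k: "k = emb n (a, b, c)" and w: "(a, b, c) \<in> hex n"
    by (auto simp: Mshell_eq)
  have "csum k = 3 * 2^n + 3^(n div 2) * (a + b + c)"
    unfolding k csum_def emb_nth by (simp add: algebra_simps)
  then show ?thesis by (simp add: hex_sum[OF w])
qed

text \<open>The hexagon is orthogonal to sigma, so the cross term vanishes. The rounding in n div 2
  is made up for by the squared length 6 instead of 2 for odd n.\<close>

lemma square_Mshell: "k \<in> Mshell n \<Longrightarrow> (k $ 1)\<^sup>2 + (k $ 2)\<^sup>2 + (k $ 3)\<^sup>2 = 3 * 4^n + 2 * 3^n"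
proof -
  assume "k \<in> Mshell n"
  then obtain a b c where k: "k = emb n (a, b, c)" and w: "(a, b, c) \<in> hex n"
    by (auto simp: Mshell_eq)
  let ?t = "(3::int)^(n div 2)"
  have "(k $ 1)\<^sup>2 + (k $ 2)\<^sup>2 + (k $ 3)\<^sup>2
      = 3 * (2^n)\<^sup>2 + 2 * 2^n * ?t * (a + b + c) + ?t\<^sup>2 * (a\<^sup>2 + b\<^sup>2 + c\<^sup>2)"
    unfolding k emb_nth by (simp add: power2_eq_square algebra_simps)
  also have "\<dots> = 3 * (2^n)\<^sup>2 + ?t\<^sup>2 * (if even n then 2 else 6)"
    unfolding hex_sum[OF w] hex_square[OF w] by simp
  also have "(2^n)\<^sup>2 = (4::int)^n" by (simp add: power_mult[symmetric] power_even_eq[symmetric] mult.commute[of n] power_mult)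
  also have "?t\<^sup>2 * (if even n then 2 else 6) = 2 * 3^n"
  proof (cases "even n")
    case True
    then show ?thesis by (auto elim!: evenE simp: power_mult[symmetric] power_even_eq)
  next
    case False
    then obtain m where "n = 2 * m + 1" by (blast elim: oddE)
    then show ?thesis by (simp add: power_mult[symmetric] mult.commute)
  qed
  finally show ?thesis .
qed


text \<open>The factor 3 appears because n div 2 increases by one exactly when n is odd, so that
  only then do the two shells have different scaling factors.\<close>

definition hex_add :: "nat \<Rightarrow> int \<times> int \<times> int \<Rightarrow> int \<times> int \<times> int \<Rightarrow> int \<times> int \<times> int \<Rightarrow> bool" where
  "hex_add n x y z \<longleftrightarrow> x + y = (if even n then z else z + z + z)"

lemma emb_add: "emb n x + emb n y = emb (Suc n) z \<longleftrightarrow> hex_add n x y z"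
proof (cases "even n")
  case True
  then have "Suc n div 2 = n div 2" by simp
  moreover have "2 ^ n + T * a + (2 ^ n + T * b) = 2 ^ Suc n + T * c \<longleftrightarrow> a + b = c"
    if "T = 3 ^ (n div 2)" for a b c T :: int
  proof -
    have "2 ^ n + T * a + (2 ^ n + T * b) = 2 ^ Suc n + T * c \<longleftrightarrow> T * (a + b) = T * c"
      by (simp add: algebra_simps)
    also have "\<dots> \<longleftrightarrow> a + b = c" using that by simp
    finally show ?thesis .
  qed
  ultimately show ?thesis
    using True by (cases x; cases y; cases z) (simp add: hex_add_def vec3_eq_iff emb_nth)
next
  case False
  then have "Suc n div 2 = Suc (n div 2)" by simp
  moreover have "2 ^ n + T * a + (2 ^ n + T * b) = 2 ^ Suc n + 3 * T * c \<longleftrightarrow> a + b = 3 * c"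
    if "T = 3 ^ (n div 2)" for a b c T :: int
  proof -
    have "2 ^ n + T * a + (2 ^ n + T * b) = 2 ^ Suc n + 3 * T * c \<longleftrightarrow> T * (a + b) = T * (3 * c)"
      by (simp add: algebra_simps)
    also have "\<dots> \<longleftrightarrow> a + b = 3 * c" using that by simp
    finally show ?thesis .
  qed
  ultimately show ?thesis
    using False by (cases x; cases y; cases z) (simp add: hex_add_def vec3_eq_iff emb_nth)
qed

text \<open>Turns a count of pairs into a double sum of zeros and ones, which simplification
  evaluates on the explicit hexagons.\<close>

lemma card_pairs:
  assumes "finite A" "finite B"
  shows "card {(a, b). a \<in> A \<and> b \<in> B \<and> P a b} = (\<Sum>a\<in>A. \<Sum>b\<in>B. if P a b then 1 else 0)"
proof -
  have "{(a, b). a \<in> A \<and> b \<in> B \<and> P a b} = (SIGMA a:A. {b\<in>B. P a b})" by auto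
  then have "card {(a, b). a \<in> A \<and> b \<in> B \<and> P a b} = (\<Sum>a\<in>A. card {b\<in>B. P a b})"
    using assms by simp
  also have "\<dots> = (\<Sum>a\<in>A. \<Sum>b\<in>B. if P a b then 1 else 0)"
    using assms by (intro sum.cong refl) (simp add: sum.If_cases Int_def)
  finally show ?thesis .
qed

text \<open>The sum has squared length three times that of x and y, so x and y enclose an angle of
  60 degrees and lie on either side of z. This leaves one unordered pair, hence two ordered
  ones.\<close>

lemma card_hex_sums:
  assumes "z \<in> hex (Suc n)"
  shows "card {(x, y). x \<in> hex n \<and> y \<in> hex n \<and> hex_add n x y z} = 2"
proof (cases "even n")
  case True
  then show ?thesis
    using assms unfolding card_pairs[OF finite_hex finite_hex]
    apply (simp only: hex_def hex_add_def even_Suc if_True if_False simp_thms insert_iff empty_iff)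
    by (elim disjE; simp split del: if_split)
next
  case False
  then show ?thesis
    using assms unfolding card_pairs[OF finite_hex finite_hex]
    apply (simp only: hex_def hex_add_def even_Suc if_True if_False simp_thms insert_iff empty_iff)
    by (elim disjE; simp split del: if_split)
qed

text \<open>The partner y must be one of the two neighbours of x in its hexagon, and it determines
  z.\<close>

lemma card_hex_diffs:
  assumes "x \<in> hex n"
  shows "card {(z, y). z \<in> hex (Suc n) \<and> y \<in> hex n \<and> hex_add n x y z} = 2"
proof (cases "even n")
  case True
  then show ?thesis
    using assms unfolding card_pairs[OF finite_hex finite_hex]
    apply (simp only: hex_def hex_add_def even_Suc if_True if_False simp_thms insert_iff empty_iff)
    by (elim disjE; simp split del: if_split)
next
  case False
  then show ?thesis
    using assms unfolding card_pairs[OF finite_hex finite_hex]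
    apply (simp only: hex_def hex_add_def even_Suc if_True if_False simp_thms insert_iff empty_iff)
    by (elim disjE; simp split del: if_split)
qed

abbreviation sum_pairs :: "nat \<Rightarrow> int^3 \<Rightarrow> ((int^3) \<times> (int^3)) set" where
  "sum_pairs m k \<equiv> {(a, b). a \<in> Mshell m \<and> b \<in> Mshell m \<and> a + b = k}"

abbreviation diff_pairs :: "nat \<Rightarrow> int^3 \<Rightarrow> ((int^3) \<times> (int^3)) set" where
  "diff_pairs n k \<equiv> {(a, b). a \<in> Mshell (Suc n) \<and> b \<in> Mshell n \<and> k + b = a}"

lemma card_shell_sums:
  assumes "k \<in> Mshell (Suc n)"
  shows "card (sum_pairs n k) = 2"
proof -
  obtain z where z: "z \<in> hex (Suc n)" "k = emb (Suc n) z" using assms by (auto simp: Mshell_eq)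
  have "sum_pairs n k
      = map_prod (emb n) (emb n) ` {(x, y). x \<in> hex n \<and> y \<in> hex n \<and> hex_add n x y z}"
    by (auto simp: z Mshell_eq emb_add image_iff)
  moreover have "inj (map_prod (emb n) (emb n))" by (intro prod.inj_map inj_emb)
  ultimately show ?thesis
    using card_hex_sums[OF z(1)] by (simp add: card_image inj_on_subset)
qed

lemma card_shell_diffs:
  assumes "k \<in> Mshell n"
  shows "card (diff_pairs n k) = 2"
proof -
  obtain x where x: "x \<in> hex n" "k = emb n x" using assms by (auto simp: Mshell_eq)
  have "diff_pairs n k
      = map_prod (emb (Suc n)) (emb n) ` {(z, y). z \<in> hex (Suc n) \<and> y \<in> hex n \<and> hex_add n x y z}"
    by (auto simp: x Mshell_eq emb_add image_iff)
  moreover have "inj (map_prod (emb (Suc n)) (emb n))" by (intro prod.inj_map inj_emb)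
  ultimately show ?thesis
    using card_hex_diffs[OF x(1)] by (simp add: card_image inj_on_subset)
qed

section \<open>Permutations and point reflection act on a shell\<close>

lemma perm_vec_Mshell:
  assumes "p permutes UNIV" "k \<in> Mshell n"
  shows "perm_vec p k \<in> Mshell n"
proof -
  have c: "perm_vec p w \<in> perms v" if w: "w \<in> perms v" for v w :: "int^3"
  proof -
    obtain q where q: "q permutes UNIV" "w = perm_vec q v" using w by (auto simp: perms_def)
    then have "perm_vec p w = perm_vec (q \<circ> p) v" by (simp add: perm_vec_def)
    then show ?thesis using permutes_compose[OF assms(1) q(1)] by (auto simp: perms_def)
  qed
  show ?thesis using assms(2) c by (auto simp: Mshell_def split: if_splits)
qed

text \<open>The reflection of a shell at its centre 2^n sigma. On the shell it is the negative of
  the mirror at sigma, so it expresses oddness and mirror symmetry together without leaving the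
  positive frequencies.\<close>

definition flip_shell :: "nat \<Rightarrow> int^3 \<Rightarrow> int^3" where
  "flip_shell n k = (\<chi> i. 2 * 2^n - k $ i)"

lemma flip_shell_Mshell: "k \<in> Mshell n \<Longrightarrow> flip_shell n k \<in> Mshell n"
proof -
  assume "k \<in> Mshell n"
  then obtain a b c where k: "k = emb n (a, b, c)" and w: "(a, b, c) \<in> hex n"
    by (auto simp: Mshell_eq)
  have "flip_shell n k = emb n (- a, - b, - c)"
    by (simp add: k flip_shell_def vec3_eq_iff emb_nth)
  moreover have "(- a, - b, - c) \<in> hex n" using w by (auto simp: hex_def split: if_splits)
  ultimately show ?thesis by (auto simp: Mshell_eq)
qed

text \<open>By permutations and the flip alone any frequency of a shell is reached from any other.\<close>

lemma Mshell_invariant: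
  assumes "k \<in> Mshell n" "k' \<in> Mshell n"
    and p: "\<And>p k. p permutes UNIV \<Longrightarrow> k \<in> Mshell n \<Longrightarrow> f (perm_vec p k) = f k"
    and fl: "\<And>k. k \<in> Mshell n \<Longrightarrow> f (flip_shell n k) = f k"
  shows "f k = f k'"
proof -
  have base: "\<exists>b. \<forall>k \<in> Mshell n. f k = f b"
  proof (cases "even n")
    case True
    have b: "kfreq (n div 2) \<in> Mshell n"
      using True self_in_perms by (simp add: Mshell_def)
    have "f k = f (kfreq (n div 2))" if k: "k \<in> Mshell n" for k
    proof -
      obtain q where "q permutes UNIV" "k = perm_vec q (kfreq (n div 2))"
        using k True unfolding Mshell_def perms_def by auto
      then show ?thesis using p b by simp
    qed
    then show ?thesis by blast
  next
    case False
    \<comment> \<open>In an odd shell the permutations have two orbits, and the reflection exchanges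
      them.\<close>
    let ?h = "hfreq (n div 2)" and ?j = "jfreq (n div 2)"
    have h: "?h \<in> Mshell n" and j: "?j \<in> Mshell n"
      using False self_in_perms by (simp_all add: Mshell_def)
    have eq: "f k = f ?h \<or> f k = f ?j" if k: "k \<in> Mshell n" for k
    proof -
      obtain q where "q permutes UNIV" "k = perm_vec q ?h \<or> k = perm_vec q ?j"
        using k False unfolding Mshell_def perms_def by auto
      then show ?thesis using p h j by auto
    qed
    have "n = Suc (2 * (n div 2))" using False by (simp add: odd_two_times_div_two_succ)
    then have "(2::int) * 2 ^ (2 * (n div 2)) = 2 ^ n" by (metis power_Suc)
    then have "flip_shell n ?h = perm_vec (Transposition.transpose 1 3) ?j"
      by (simp add: flip_shell_def vec3_eq_iff hfreq_def jfreq_def perm_vec_def transpose_def)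
    moreover have "Transposition.transpose 1 3 permutes (UNIV :: 3 set)" by (simp add: permutes_swap_id)
    ultimately have "f ?h = f ?j" using fl[OF h] p[OF _ j] by simp
    then show ?thesis using eq by auto
  qed
  then obtain b where "\<forall>k \<in> Mshell n. f k = f b" ..
  then show ?thesis using assms(1,2) by simp
qed

section \<open>Triads in the frequency set\<close>

lemma pow2_sum:
  assumes "(2::int)^p + 2^q = 2^n"
  shows "p = q \<and> n = Suc p"
proof -
  \<comment> \<open>If 2^q is the larger summand, then 2^q < 2^n \<le> 2^(q+1), which forces n = q +
    1 and hence equal summands.\<close>
  have aux: "p = q \<and> n = Suc p" if le: "p \<le> q" and e: "(2::int)^p + 2^q = 2^n" for p q
  proof -
    have "(2::int)^p \<le> 2^q" using le by (simp add: power_increasing)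
    then have "(2::int)^n \<le> 2^(Suc q)" "(2::int)^q < 2^n" using e by (auto simp flip: e)
    then have "n \<le> Suc q" "q < n"
      using power_increasing_iff[of "2::int" n "Suc q"] power_strict_increasing_iff[of "2::int" q n] by auto
    then have "n = Suc q" by simp
    then have "(2::int)^p = 2^q" using e by simp
    then have "p = q" by simp
    with \<open>n = Suc q\<close> show ?thesis by simp
  qed
  show ?thesis
    using aux[of p q] aux[of q p] assms by (cases "p \<le> q") (auto simp: add.commute)
qed

lemma Mset_cases:
  assumes "k \<in> Mset"
  obtains n where "k \<in> Mshell n" | n where "- k \<in> Mshell n"
  using assms by (auto simp: Mset_def Mplus_def)

lemma Mset_iff: "k \<in> Mset \<longleftrightarrow> (\<exists>n. k \<in> Mshell n \<or> - k \<in> Mshell n)"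
  by (auto simp: Mset_def Mplus_def image_iff) (metis minus_minus)

lemma Mshell_disjoint:
  assumes "k \<in> Mshell n"
  shows "k \<in> Mshell m \<longleftrightarrow> m = n" and "- k \<notin> Mshell m"
proof -
  show "k \<in> Mshell m \<longleftrightarrow> m = n" using assms csum_Mshell[of k n] csum_Mshell[of k m] by auto
  have "csum k > 0" using csum_Mshell[OF assms] by simp
  then show "- k \<notin> Mshell m"
    using csum_Mshell[of "- k" m] zero_less_power[of "2::int" m] by (auto simp: csum_minus simp del: zero_less_power)
qed

text \<open>The three parts are the possible sign patterns of the components of a and b along sigma:
  both positive, or one negative in either order. In the mixed cases \<open>pow2_sum\<close> places
  the positive frequency in the next shell and the negated other one in the shell of k.\<close>

lemma triads:
  assumes "k \<in> Mshell n"
  shows "{(a, b). a \<in> Mset \<and> b \<in> Mset \<and> a + b = k} =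
    (case n of 0 \<Rightarrow> {} | Suc m \<Rightarrow> sum_pairs m k) \<union>
    ((\<lambda>(a, b). (a, - b)) ` (diff_pairs n k) \<union>
     (\<lambda>(a, b). (- b, a)) ` (diff_pairs n k))"
    (is "?L = ?U \<union> (?D1 \<union> ?D2)")
proof
  note s = csum_Mshell csum_Mshell[of "- _", unfolded csum_minus]
  show "?L \<subseteq> ?U \<union> (?D1 \<union> ?D2)"
  proof
    fix z assume "z \<in> ?L"
    then obtain a b where z: "z = (a, b)" and ab: "a \<in> Mset" "b \<in> Mset" "k = a + b" by auto
    have c: "csum a + csum b = 3 * 2^n" using csum_Mshell[OF assms] by (simp add: ab csum_add)
    from ab(1) consider p where "a \<in> Mshell p" | p where "- a \<in> Mshell p" by (blast elim: Mset_cases)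
    then show "z \<in> ?U \<union> (?D1 \<union> ?D2)"
    proof cases
      case (1 p)
      from ab(2) consider q where "b \<in> Mshell q" | q where "- b \<in> Mshell q" by (blast elim: Mset_cases)
      then show ?thesis
      proof cases
        case (1 q)
        have "(2::int)^p + 2^q = 2^n" using c s(1)[OF \<open>a \<in> Mshell p\<close>] s(1)[OF 1] by simp
        then show ?thesis using pow2_sum[of p q n] 1 \<open>a \<in> Mshell p\<close> ab z by auto
      next
        case (2 q)
        have "(2::int)^n + 2^q = 2^p" using c s(1)[OF \<open>a \<in> Mshell p\<close>] s(2)[OF 2] by simp
        then have "q = n" "p = Suc n" using pow2_sum by auto
        then have "(a, b) \<in> ?D1" using 2 \<open>a \<in> Mshell p\<close> ab
          by (auto intro!: image_eqI[of _ _ "(a, - b)"])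
        then show ?thesis using z by blast
      qed
    next
      case (2 p)
      from ab(2) consider q where "b \<in> Mshell q" | q where "- b \<in> Mshell q" by (blast elim: Mset_cases)
      then show ?thesis
      proof cases
        case (1 q)
        have "(2::int)^n + 2^p = 2^q" using c s(2)[OF 2] s(1)[OF 1] by simp
        then have "p = n" "q = Suc n" using pow2_sum by auto
        then have "(a, b) \<in> ?D2" using 1 2 ab
          by (auto intro!: image_eqI[of _ _ "(b, - a)"])
        then show ?thesis using z by blast
      next
        case (2 q)
        have "(0::int) < 2 ^ p" "(0::int) < 2 ^ q" "(0::int) < 2 ^ n" by simp_all
        then have False using c s(2)[OF 2] s(2)[OF \<open>- a \<in> Mshell p\<close>] by linarith
        then show ?thesis ..
      qed
    qed
  qed
  show "?U \<union> (?D1 \<union> ?D2) \<subseteq> ?L"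
    by (auto simp: Mset_iff split: nat.splits)
qed

text \<open>The signs of \<open>csum\<close> make the three parts of \<open>triads\<close> disjoint;
  the two mixed parts have the same index set and are merged into one sum.\<close>

lemma sum_triads:
  fixes F :: "int^3 \<Rightarrow> int^3 \<Rightarrow> 'b::comm_monoid_add"
  assumes k: "k \<in> Mshell n"
  shows "(\<Sum>(a, b) | a \<in> Mset \<and> b \<in> Mset \<and> a + b = k. F a b) =
    (case n of 0 \<Rightarrow> 0 | Suc m \<Rightarrow> (\<Sum>(a, b)\<in>sum_pairs m k. F a b)) +
    (\<Sum>(a, b)\<in>diff_pairs n k. F a (- b) + F (- b) a)"
proof -
  let ?D = "diff_pairs n k"
  let ?D1 = "(\<lambda>(a, b). (a, - b)) ` ?D" and ?D2 = "(\<lambda>(a, b). (- b, a)) ` ?D"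
  let ?U = "case n of 0 \<Rightarrow> {} | Suc m \<Rightarrow> sum_pairs m k"
  have fD: "finite ?D"
    by (rule finite_subset[of _ "Mshell (Suc n) \<times> Mshell n"]) auto
  have fU: "finite ?U"
    by (auto split: nat.splits intro: finite_subset[of _ "Mshell (n - 1) \<times> Mshell (n - 1)"])
  have pos: "csum x > 0" if "x \<in> Mshell m" for x m using csum_Mshell[OF that] by simp
  have d1: "csum (fst z) > 0 \<and> csum (snd z) < 0" if "z \<in> ?D1" for z
    using that pos by (auto simp: csum_minus)
  have d2: "csum (fst z) < 0 \<and> csum (snd z) > 0" if "z \<in> ?D2" for z
    using that pos by (auto simp: csum_minus)
  have u: "csum (fst z) > 0 \<and> csum (snd z) > 0" if "z \<in> ?U" for z
    using that pos by (auto split: nat.splits)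
  have "?D1 \<inter> ?D2 = {}" "?U \<inter> (?D1 \<union> ?D2) = {}"
    using d1 d2 u by (meson disjoint_iff UnE less_asym)+
  moreover have "(\<Sum>z\<in>?D1. case z of (a, b) \<Rightarrow> F a b) = (\<Sum>(a, b)\<in>?D. F a (- b))"
    by (subst sum.reindex) (auto simp: inj_on_def intro!: sum.cong)
  moreover have "(\<Sum>z\<in>?D2. case z of (a, b) \<Rightarrow> F a b) = (\<Sum>(a, b)\<in>?D. F (- b) a)"
    by (subst sum.reindex) (auto simp: inj_on_def intro!: sum.cong)
  ultimately show ?thesis
    unfolding triads[OF k] using fD fU
    by (simp add: sum.union_disjoint sum.distrib[symmetric] case_prod_unfold split: nat.splits)
qed


section \<open>Geometry of a triad and its interaction coefficient\<close>

lemma inner3: "x \<bullet> y = x $ 1 * y $ 1 + x $ 2 * y $ 2 + x $ 3 * y $ 3" for x y :: "real^3"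
  by (simp add: inner_vec_def sum_3)

lemma rvec_add: "rvec (a + b) = rvec a + rvec b" and rvec_minus: "rvec (- a) = - rvec a"
  and rvec_0: "rvec 0 = 0"
  by (simp_all add: rvec_def vec_eq_iff)

text \<open>The common value of |k|^2 on the n-th shell.\<close>

definition qn :: "nat \<Rightarrow> real" where
  "qn n = 3 * 4^n + 2 * 3^n"

lemma qn_pos [simp]: "qn n > 0"
  by (simp add: qn_def add_pos_pos)

lemma qn_nz [simp]: "qn n \<noteq> 0"
  by (rule less_imp_neq[OF qn_pos, symmetric])

lemma rvec_sq_Mshell: "k \<in> Mshell n \<Longrightarrow> rvec k \<bullet> rvec k = qn n"
proof -
  assume "k \<in> Mshell n"
  from square_Mshell[OF this] have "real_of_int ((k $ 1)\<^sup>2 + (k $ 2)\<^sup>2 + (k $ 3)\<^sup>2) = 3 * 4^n + 2 * 3^n" by simp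
  then show ?thesis by (simp add: inner3 rvec_def qn_def power2_eq_square)
qed

lemma norm_rvec_Mshell: "k \<in> Mshell n \<Longrightarrow> (norm (rvec k))\<^sup>2 = qn n"
  by (simp add: rvec_sq_Mshell power2_norm_eq_inner)

lemma rvec_sigma_Mshell: "k \<in> Mshell n \<Longrightarrow> rvec k \<bullet> sigma = 3 * 2^n"
proof -
  assume "k \<in> Mshell n"
  from csum_Mshell[OF this] have "real_of_int (csum k) = 3 * 2^n" by simp
  then show ?thesis by (simp add: inner3 rvec_def sigma_def csum_def)
qed

lemma sigma_sq: "sigma \<bullet> sigma = 3"
  by (simp add: inner3 sigma_def)

lemma four_eq: "(4::real)^n = 2^n * 2^n"
  by (simp flip: power_mult_distrib)

lemma Pperp_eq: "k \<in> Mshell n \<Longrightarrow> Pperp_sigma k = sigma - (3 * 2^n / qn n) *\<^sub>R rvec k"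
  by (simp add: Pperp_sigma_def norm_rvec_Mshell rvec_sigma_Mshell)

lemma Pperp_sq:
  assumes "k \<in> Mshell n"
  shows "Pperp_sigma k \<bullet> Pperp_sigma k = 6 * 3^n / qn n"
proof -
  have "Pperp_sigma k \<bullet> Pperp_sigma k = 3 - 2 * (3 * 2^n / qn n) * (3 * 2^n) + (3 * 2^n / qn n)\<^sup>2 * qn n"
    unfolding Pperp_eq[OF assms]
    by (simp add: inner_diff_left inner_diff_right inner_commute[of sigma "rvec k"] sigma_sq rvec_sigma_Mshell[OF assms]
        rvec_sq_Mshell[OF assms] power2_eq_square algebra_simps)
  also have "\<dots> = (3 * qn n - 9 * 4^n) / qn n"
    by (simp add: field_simps power2_eq_square four_eq)
  also have "3 * qn n - 9 * 4^n = 6 * 3^n" by (simp add: qn_def)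
  finally show ?thesis .
qed

text \<open>The common length of P_k^\<bottom>(sigma) on the n-th shell, that is, the normalising
  factor of v^k.\<close>

definition Nn :: "nat \<Rightarrow> real" where
  "Nn n = sqrt (6 * 3^n / qn n)"

lemma Nn_pos [simp]: "Nn n > 0" and Nn_sq: "Nn n * Nn n = 6 * 3^n / qn n"
  using qn_pos[of n] by (auto simp: Nn_def less_imp_le)

lemma Nn_nz [simp]: "Nn n \<noteq> 0"
  by (rule less_imp_neq[OF Nn_pos, symmetric])

lemma vdir_eq: "k \<in> Mshell n \<Longrightarrow> vdir k = (1 / Nn n) *\<^sub>R (sigma - (3 * 2^n / qn n) *\<^sub>R rvec k)"
  by (simp add: vdir_def norm_eq_sqrt_inner[of "Pperp_sigma k"] Pperp_sq Nn_def flip: Pperp_eq)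

lemma vdir_unit: "k \<in> Mshell n \<Longrightarrow> vdir k \<bullet> vdir k = 1"
  using Nn_pos[of n] Nn_sq[of n] 
  by (simp add: vdir_eq flip: Pperp_eq) (simp add: Pperp_sq field_simps)

lemma vdir_minus: "vdir (- k) = vdir k"
  by (simp add: vdir_def Pperp_sigma_def rvec_minus)

lemma vdir_orth: "k \<in> Mshell n \<Longrightarrow> rvec k \<bullet> vdir k = 0"
  using qn_pos[of n]
  by (simp add: vdir_eq inner_diff rvec_sigma_Mshell rvec_sq_Mshell)

text \<open>The interaction coefficient shared by all triads between the shells n and n + 1; see
  \<open>triad_up\<close> and \<open>triad_down2\<close>.\<close>

definition Kn :: "nat \<Rightarrow> real" where
  "Kn n = sqrt 6 / 4 * sqrt 3 ^ n * beta n"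

text \<open>Both sides are nonnegative, so it is enough to compare squares, where the roots inside
  \<open>beta\<close> and \<open>Nn\<close> disappear.\<close>

lemma Kn_eq: "Kn n = 9 * 6^n / (qn (Suc n) * Nn (Suc n))"
proof -
  have x: "(3/4::real)^n = 3^n / 4^n" by (rule power_divide)
  have pos: "(0::real) < 4^n" "(0::real) < 3^n" "(0::real) < 2^n" by simp_all
  have b: "(beta n)\<^sup>2 = 12 * 4^n / qn (Suc n)"
  proof -
    have "(beta n)\<^sup>2 = 1 / (1 + 1/2 * (3^n/4^n))"
      by (simp add: beta_def power_divide x add_nonneg_nonneg)
    also have "1 + 1/2 * (3^n/4^n) = qn (Suc n) / (12 * 4^n)"
      using pos by (simp add: qn_def field_simps)
    finally show ?thesis by simp
  qed
  have "(Kn n)\<^sup>2 = 6 / 16 * 3^n * (12 * 4^n / qn (Suc n))"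
    by (simp add: Kn_def power_mult_distrib b power_divide power_mult[symmetric] mult.commute[of n])
      (simp add: power_mult)
  moreover have "(9 * 6^n / (qn (Suc n) * Nn (Suc n)))\<^sup>2 = (9 * 6^n)\<^sup>2 / (qn (Suc n) * qn (Suc n) * (Nn (Suc n) * Nn (Suc n)))"
    by (simp add: power2_eq_square)
  moreover have "\<dots> = 6 / 16 * 3^n * (12 * 4^n / qn (Suc n))"
  proof -
    have "(6::real)^n = 2^n * 3^n" by (simp flip: power_mult_distrib)
    then show ?thesis
    unfolding Nn_sq using pos qn_pos[of "Suc n"] by (simp add: four_eq power2_eq_square field_simps)
  qed
  ultimately have "(Kn n)\<^sup>2 = (9 * 6^n / (qn (Suc n) * Nn (Suc n)))\<^sup>2" by simp
  moreover have "Kn n \<ge> 0" by (simp add: Kn_def beta_def)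
  moreover have "9 * 6^n / (qn (Suc n) * Nn (Suc n)) \<ge> 0"
    using qn_pos[of "Suc n"] Nn_pos[of "Suc n"] by (simp add: less_imp_le)
  ultimately show ?thesis by (simp add: power2_eq_iff_nonneg)
qed

context
  fixes a b :: "int^3" and n :: nat
  assumes a: "a \<in> Mshell n" and b: "b \<in> Mshell n" and ab: "a + b \<in> Mshell (Suc n)"
begin

text \<open>As a and b have the same length, each of them projects onto half of a + b.\<close>

lemma triad_inner: "rvec (a + b) \<bullet> rvec b = qn (Suc n) / 2" "rvec (a + b) \<bullet> rvec a = qn (Suc n) / 2"
proof -
  have "rvec (a + b) \<bullet> rvec (a + b) = rvec a \<bullet> rvec a + 2 * (rvec a \<bullet> rvec b) + rvec b \<bullet> rvec b"
    by (simp add: rvec_add inner_add inner_commute)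
  then have "qn (Suc n) = 2 * qn n + 2 * (rvec a \<bullet> rvec b)"
    using a b ab by (simp only: rvec_sq_Mshell)
  moreover have "rvec (a + b) \<bullet> rvec b = rvec a \<bullet> rvec b + qn n" "rvec (a + b) \<bullet> rvec a = rvec a \<bullet> rvec b + qn n"
    using a b by (simp_all add: rvec_add inner_add inner_commute rvec_sq_Mshell)
  ultimately show "rvec (a + b) \<bullet> rvec b = qn (Suc n) / 2" "rvec (a + b) \<bullet> rvec a = qn (Suc n) / 2"
    by simp_all
qed

lemma triad_vdir: "vdir (a + b) \<bullet> vdir b = 18 * 3^n / (qn (Suc n) * Nn n * Nn (Suc n))"
proof -
  have "vdir (a + b) \<bullet> vdir b = 1 / Nn n * (1 / Nn (Suc n)) *
     (3 - (3 * 2^n / qn n) * (3 * 2^n) - (3 * 2^Suc n / qn (Suc n)) * (3 * 2^Suc n)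
       + (3 * 2^Suc n / qn (Suc n)) * (3 * 2^n / qn n) * (qn (Suc n) / 2))"
    unfolding vdir_eq[OF b] vdir_eq[OF ab] using rvec_sigma_Mshell[OF b] rvec_sigma_Mshell[OF ab]
    by (simp add: inner_diff_left inner_diff_right sigma_sq inner_commute[of sigma "rvec _"] triad_inner algebra_simps)
  also have "(3 - (3 * 2^n / qn n) * (3 * 2^n) - (3 * 2^Suc n / qn (Suc n)) * (3 * 2^Suc n)
       + (3 * 2^Suc n / qn (Suc n)) * (3 * 2^n / qn n) * (qn (Suc n) / 2)) = (3 * qn (Suc n) - 36 * 4^n) / qn (Suc n)"
    by (simp add: field_simps four_eq)
  also have "3 * qn (Suc n) - 36 * 4^n = 18 * 3^n" by (simp add: qn_def)
  finally show ?thesis by (simp add: field_simps)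
qed

lemma triad_up1: "rvec (a + b) \<bullet> vdir a = 3 * 6^n / (qn n * Nn n)"
proof -
  have "rvec (a + b) \<bullet> vdir a = 1 / Nn n * (3 * 2^Suc n - 3 * 2^n / qn n * (qn (Suc n) / 2))"
    unfolding vdir_eq[OF a] using rvec_sigma_Mshell[OF ab]
    by (simp add: inner_diff_right triad_inner)
  also have "(3 * 2^Suc n - 3 * 2^n / qn n * (qn (Suc n) / 2)) = 3 * 2^n * (4 * qn n - qn (Suc n)) / (2 * qn n)"
    by (simp add: field_simps)
  also have "4 * qn n - qn (Suc n) = 2 * 3^n" by (simp add: qn_def)
  also have "3 * 2^n * (2 * 3^n) / (2 * qn n) = 3 * 6^n / qn n"
    by (simp flip: power_mult_distrib)
  finally show ?thesis by simp
qed

text \<open>For a sum frequency k = a + b the factor k . v^a stems from the derivative and v^k . v^b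
  from the projection onto v^k.\<close>

lemma triad_up: "(rvec (a + b) \<bullet> vdir a) * (vdir (a + b) \<bullet> vdir b) = Kn n"
proof -
  have "(rvec (a + b) \<bullet> vdir a) * (vdir (a + b) \<bullet> vdir b) =
     54 * (6^n * 3^n) / (qn n * (Nn n * Nn n) * (qn (Suc n) * Nn (Suc n)))"
    unfolding triad_up1 triad_vdir by simp
  also have "qn n * (Nn n * Nn n) = 6 * 3^n" unfolding Nn_sq by simp
  also have "54 * (6^n * 3^n) / (6 * 3^n * (qn (Suc n) * Nn (Suc n))) = Kn n"
    unfolding Kn_eq by simp
  finally show ?thesis .
qed

text \<open>Along both sigma and a + b the vector a has half the component of a + b, and v^(a+b) is
  a combination of these two directions orthogonal to a + b. Hence one of the two orders of a mixed
  pair contributes nothing.\<close>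

lemma triad_down1: "rvec a \<bullet> vdir (a + b) = 0"
proof -
  have h: "rvec a \<bullet> rvec (a + b) = qn (Suc n) / 2" using triad_inner(2) by (simp add: inner_commute)
  show ?thesis
    unfolding vdir_eq[OF ab] by (simp add: inner_diff_right rvec_sigma_Mshell[OF a] h)
qed

end

text \<open>Since v^b is orthogonal to b, the vector a may be replaced by a + b, which leads back to
  \<open>triad_up\<close> with a and b exchanged. That both directions carry the same constant is
  the energy balance of the triad.\<close>

lemma triad_down2:
  assumes "a \<in> Mshell n" "b \<in> Mshell n" "a + b \<in> Mshell (Suc n)"
  shows "(rvec a \<bullet> vdir b) * (vdir a \<bullet> vdir (a + b)) = Kn n"
proof -
  have "rvec a \<bullet> vdir b = rvec (b + a) \<bullet> vdir b"
    by (simp add: rvec_add inner_add_left vdir_orth[OF assms(2)])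
  then show ?thesis
    using triad_up[OF assms(2,1)] assms(3) by (simp add: add.commute inner_commute)
qed

section \<open>The symbol of the fractional Laplacian on a shell\<close>

lemma lap_symbol_minus: "lap_symbol \<alpha> (- k) = lap_symbol \<alpha> k"
  by (simp add: lap_symbol_def rvec_minus)

text \<open>The purpose of \<open>alpha_t\<close>: it rewrites the growth 4^n of |k|^2 in base sqrt
  3, the base of the interaction coefficients.\<close>

lemma four_powr: "(4::real) powr \<alpha> = sqrt 3 powr (2 * alpha_t \<alpha>)"
proof -
  have "ln (4::real) = 2 * ln 2" using ln_realpow[of 2 2] by simp
  then show ?thesis
    by (simp add: powr_def alpha_t_def ln_sqrt)
qed

lemma lap_symbol_Mshell:
  assumes "k \<in> Mshell n"
  shows "lap_symbol \<alpha> k = (12 * pi\<^sup>2) powr \<alpha> * mu n powr (- 2 * \<alpha>) * sqrt 3 powr (2 * alpha_t \<alpha> * real n)"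
proof -
  have x: "(3/4::real)^n = 3^n / 4^n" by (rule power_divide)
  let ?y = "1 + 2/3 * (3/4::real)^n"
  have y: "?y > 0" by (simp add: add_pos_nonneg)
  have "4 * pi\<^sup>2 * (norm (rvec k))\<^sup>2 = 12 * pi\<^sup>2 * (4^n * ?y)"
    unfolding norm_rvec_Mshell[OF assms] qn_def x by (simp add: field_simps)
  then have "lap_symbol \<alpha> k = (12 * pi\<^sup>2) powr \<alpha> * ((4^n) powr \<alpha> * ?y powr \<alpha>)"
    unfolding lap_symbol_def using y by (simp add: powr_mult)
  also have "(4^n) powr \<alpha> = sqrt 3 powr (2 * alpha_t \<alpha> * real n)"
  proof -
    have "((4::real)^n) powr \<alpha> = ((4::real) powr \<alpha>) powr real n"
      by (simp add: powr_realpow[symmetric] powr_powr mult.commute)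
    then show ?thesis by (simp add: four_powr powr_powr)
  qed
  also have "?y powr \<alpha> = mu n powr (- 2 * \<alpha>)"
    unfolding mu_def using y by (simp add: powr_def ln_div ln_sqrt)
  finally show ?thesis by simp
qed

text \<open>\<open>s_crit\<close> is the exponent with 4 powr \<open>s_crit\<close> = 3. The
  critical norm thus controls |c_k| 3^(n/2), the weight of all later estimates.\<close>

lemma lap_symbol_crit:
  assumes "k \<in> Mshell n"
  shows "lap_symbol s_crit k \<ge> 3 ^ n"
proof -
  have "4 ^ n \<le> 4 * pi\<^sup>2 * qn n"
  proof -
    have "1 * 1 \<le> pi * pi" using pi_gt3 by (intro mult_mono) auto
    then have "1 * 4^n \<le> (4 * pi\<^sup>2) * qn n"
      by (intro mult_mono) (auto simp: qn_def power2_eq_square)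
    then show ?thesis by simp
  qed
  then have "(4^n) powr s_crit \<le> lap_symbol s_crit k"
    unfolding lap_symbol_def norm_rvec_Mshell[OF assms]
    by (intro powr_mono2) (auto simp: s_crit_def)
  moreover have "(4::real) powr s_crit = 3"
  proof -
    have "ln (4::real) = 2 * ln 2" using ln_realpow[of 2 2] by simp
    then show ?thesis by (simp add: powr_def s_crit_def)
  qed
  then have "((4::real) powr s_crit) powr real n = 3 ^ n"
    by (simp add: powr_realpow)
  then have "((4::real)^n) powr s_crit = 3^n"
    by (simp add: powr_realpow[symmetric] powr_powr mult.commute)
  ultimately show ?thesis by simp
qed

section \<open>Uniqueness of Fourier coefficients on the cube\<close>

definition echar :: "int^3 \<Rightarrow> real^3 \<Rightarrow> complex" where
  "echar k x = exp (2 * complex_of_real pi * \<i> * complex_of_real (rvec k \<bullet> x))"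

lemma echar_add: "echar (k + l) x = echar k x * echar l x"
  by (simp add: echar_def rvec_add inner_add_left distrib_left exp_add)

lemma echar_0 [simp]: "echar 0 x = 1"
  by (simp add: echar_def rvec_0)

lemma norm_echar [simp]: "norm (echar k x) = 1"
  by (simp add: echar_def)

lemma echar_minus: "echar (- k) x = exp (- 2 * complex_of_real pi * \<i> * complex_of_real (rvec k \<bullet> x))"
  by (simp add: echar_def rvec_minus)

lemma continuous_on_echar [continuous_intros]: "continuous_on S (echar k)"
  unfolding echar_def by (intro continuous_intros)

lemma borel_measurable_echar [measurable]: "echar k \<in> borel_measurable borel"
  by (intro borel_measurable_continuous_onI continuous_intros)

abbreviation unit_cube :: "(real^3) measure" where
  "unit_cube \<equiv> lebesgue_on (cbox 0 1)"

lemma continuous_measurable_unit_cube: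
  fixes h :: "real^3 \<Rightarrow> 'b::{second_countable_topology, t2_space, real_normed_vector}"
  shows "continuous_on UNIV h \<Longrightarrow> h \<in> borel_measurable unit_cube"
  by (intro measurable_restrict_space1 measurable_completion) 
     (simp add: borel_measurable_continuous_onI)

text \<open>Integrable functions all of whose Fourier coefficients vanish; since k runs over all
  frequencies, the sign in the exponent is immaterial.\<close>

definition fzero :: "(real^3 \<Rightarrow> complex) \<Rightarrow> bool" where
  "fzero f \<longleftrightarrow> integrable unit_cube f \<and> (\<forall>k. (LINT x|unit_cube. f x * echar k x) = 0)"

text \<open>The multipliers that preserve the vanishing of all coefficients. They form an algebra
  containing the characters, hence all trigonometric polynomials.\<close>

definition fmult :: "(real^3 \<Rightarrow> complex) \<Rightarrow> bool" where
  "fmult h \<longleftrightarrow> (\<forall>f. fzero f \<longrightarrow> fzero (\<lambda>x. h x * f x))"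

lemma integrable_bounded_mult:
  fixes f h :: "real^3 \<Rightarrow> complex"
  assumes "integrable unit_cube f" "h \<in> borel_measurable unit_cube" "\<And>x. norm (h x) \<le> B"
  shows "integrable unit_cube (\<lambda>x. h x * f x)"
proof (rule Bochner_Integration.integrable_bound)
  show "integrable unit_cube (\<lambda>x. of_real B * f x)" using assms(1) by simp
  show "(\<lambda>x. h x * f x) \<in> borel_measurable unit_cube"
    using assms(1,2) by (intro borel_measurable_times) auto
  have "norm (h x * f x) \<le> norm (of_real B * f x)" for x
  proof -
    have "norm (h x) \<le> \<bar>B\<bar>" using assms(3)[of x] by linarith
    then show ?thesis by (simp add: norm_mult mult_right_mono)
  qed
  then show "AE x in unit_cube. norm (h x * f x) \<le> norm (of_real B * f x)" by simp
qed

lemma integrable_echar_mult: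
  assumes "integrable unit_cube f"
  shows "integrable unit_cube (\<lambda>x. f x * echar k x)"
proof -
  have "integrable unit_cube (\<lambda>x. echar k x * f x)"
    using assms by (rule integrable_bounded_mult[of _ _ 1])
      (auto intro: continuous_measurable_unit_cube continuous_intros)
  then show ?thesis by (simp add: mult.commute)
qed

lemma fmult_const: "fmult (\<lambda>x. c)"
  by (auto simp: fmult_def fzero_def mult.assoc)

lemma fmult_add: "fmult g \<Longrightarrow> fmult h \<Longrightarrow> fmult (\<lambda>x. g x + h x)"
  by (auto simp: fmult_def fzero_def distrib_right integrable_echar_mult)

lemma fmult_mult: "fmult g \<Longrightarrow> fmult h \<Longrightarrow> fmult (\<lambda>x. g x * h x)"
  by (auto simp: fmult_def mult.assoc)

lemma fmult_echar: "fmult (echar k)"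
  unfolding fmult_def fzero_def
proof safe
  fix f l assume f: "integrable unit_cube f" and z: "\<forall>k. (LINT x|unit_cube. f x * echar k x) = 0"
  show "integrable unit_cube (\<lambda>x. echar k x * f x)"
    using integrable_echar_mult[OF f, of k] by (simp add: mult.commute)
  have "(LINT x|unit_cube. echar k x * f x * echar l x) = (LINT x|unit_cube. f x * echar (k + l) x)"
    by (simp add: echar_add mult_ac)
  then show "(LINT x|unit_cube. echar k x * f x * echar l x) = 0" using z by simp
qed

lemma fmult_sum: "finite A \<Longrightarrow> (\<And>i. i \<in> A \<Longrightarrow> fmult (h i)) \<Longrightarrow> fmult (\<lambda>x. \<Sum>i\<in>A. h i x)"
  by (induction A rule: finite_induct) (auto intro: fmult_add fmult_const)

lemma fmult_cos: "fmult (\<lambda>x. of_real (cos (2 * pi * (x $ i - c))))"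
proof -
  have e: "echar (axis i 1) x = exp (\<i> * of_real (2 * pi * x $ i))"
    "echar (- axis i 1) x = exp (- (\<i> * of_real (2 * pi * x $ i)))" for x
  proof -
    have "rvec (axis i 1) = axis i 1" by (simp add: rvec_def vec_eq_iff axis_def)
    then show "echar (axis i 1) x = exp (\<i> * of_real (2 * pi * x $ i))"
      by (simp add: echar_def inner_axis' mult_ac)
    with \<open>rvec (axis i 1) = axis i 1\<close> show "echar (- axis i 1) x = exp (- (\<i> * of_real (2 * pi * x $ i)))"
      by (simp add: echar_def rvec_minus inner_axis' mult_ac)
  qed
  have "of_real (cos (2 * pi * (x $ i - c))) =
     exp (- (\<i> * of_real (2 * pi * c))) / 2 * echar (axis i 1) x +
     exp (\<i> * of_real (2 * pi * c)) / 2 * echar (- axis i 1) x" for x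
  proof -
    have "of_real (cos (2 * pi * (x $ i - c))) = cos (of_real (2 * pi * (x $ i - c)) :: complex)"
      by (rule cos_of_real[symmetric])
    also have "\<dots> = (exp (\<i> * of_real (2 * pi * (x $ i - c))) + exp (- (\<i> * of_real (2 * pi * (x $ i - c))))) / 2"
      by (rule cos_exp_eq)
    also have "\<dots> = exp (- (\<i> * of_real (2 * pi * c))) / 2 * echar (axis i 1) x +
     exp (\<i> * of_real (2 * pi * c)) / 2 * echar (- axis i 1) x"
    proof -
      have "exp (\<i> * of_real (2 * pi * (x $ i - c))) = exp (- (\<i> * of_real (2 * pi * c))) * exp (\<i> * of_real (2 * pi * x $ i))"
        "exp (- (\<i> * of_real (2 * pi * (x $ i - c)))) = exp (\<i> * of_real (2 * pi * c)) * exp (- (\<i> * of_real (2 * pi * x $ i)))"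
        unfolding exp_add[symmetric] by (simp_all add: algebra_simps)
      then show ?thesis unfolding e by (simp only: add_divide_distrib times_divide_eq_left)
    qed
    finally show ?thesis .
  qed
  then show ?thesis
    by (simp only:) (intro fmult_add fmult_mult fmult_const fmult_echar)
qed

text \<open>A polynomial in shifted cosines is a trigonometric polynomial. The induction goes over
  constants, linear functionals, sums and products; only the linear case needs an expansion into
  coordinates.\<close>

lemma fmult_polynomial:
  fixes P :: "real^3 \<Rightarrow> real"
  assumes "real_polynomial_function P"
  shows "fmult (\<lambda>x. of_real (P (\<chi> i. cos (2 * pi * (x $ i - c $ i)))))"
  using assms
proof induction
  case (linear f)
  have f: "f y = (\<Sum>i\<in>UNIV. f (axis i 1) * y $ i)" for y
  proof -
    interpret f: bounded_linear f by fact
    have "y = (\<Sum>i\<in>UNIV. y $ i *\<^sub>R axis i 1)"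
      by (simp add: vec_eq_iff axis_def if_distrib cong: if_cong)
    then have "f y = f (\<Sum>i\<in>UNIV. y $ i *\<^sub>R axis i 1)" by simp
    also have "\<dots> = (\<Sum>i\<in>UNIV. f (axis i 1) * y $ i)" by (simp add: f.sum f.scaleR mult.commute)
    finally show ?thesis .
  qed
  have "(\<lambda>x. of_real (f (\<chi> i. cos (2 * pi * (x $ i - c $ i)))))
     = (\<lambda>x. \<Sum>i\<in>UNIV. of_real (f (axis i 1)) * (of_real (cos (2 * pi * (x $ i - c $ i))) :: complex))"
    by (subst f) simp
  then show ?case by (simp only:) (intro fmult_sum fmult_mult fmult_const fmult_cos finite)
qed (simp_all add: fmult_const fmult_add fmult_mult)


lemma continuous_on_cos_vec: "continuous_on UNIV (\<lambda>x::real^3. (\<chi> i. cos (2 * pi * (x $ i - c $ i))) :: real^3)"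
  by (intro continuous_intros)

text \<open>The cosines take values in the cube [-1,1]^3, where \<Phi> is within e of a polynomial
  P. The integral with P in place of \<Phi> vanishes by \<open>fmult_polynomial\<close>, and the
  error is at most e times the L1 norm of f.\<close>

lemma fzero_continuous:
  fixes \<Phi> :: "real^3 \<Rightarrow> real"
  assumes f: "fzero f" and \<Phi>: "continuous_on UNIV \<Phi>"
  shows "(LINT x|unit_cube. of_real (\<Phi> (\<chi> i. cos (2 * pi * (x $ i - c $ i)))) * f x) = 0"
proof -
  define Y where "Y x = (\<chi> i. cos (2 * pi * (x $ i - c $ i)))" for x :: "real^3"
  have Ycont: "continuous_on UNIV Y" unfolding Y_def by (rule continuous_on_cos_vec)
  have Y: "Y x \<in> cbox (- 1) 1" for x by (simp add: Y_def mem_box_cart)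
  have fi: "integrable unit_cube f" using f by (simp add: fzero_def)
  define I where "I = (LINT x|unit_cube. norm (f x))"
  have I: "I \<ge> 0" by (simp add: I_def)
  let ?J = "LINT x|unit_cube. of_real (\<Phi> (Y x)) * f x"
  have contbd: "\<exists>B. \<forall>x. norm (complex_of_real (g (Y x))) \<le> B" if g: "continuous_on UNIV g" for g :: "real^3 \<Rightarrow> real"
  proof -
    have "compact (g ` cbox (- 1) 1)"
      using g by (intro compact_continuous_image) (auto intro: continuous_on_subset)
    then obtain B where "\<forall>y\<in>g ` cbox (- 1) 1. norm y \<le> B" using compact_imp_bounded bounded_iff by metis
    then show ?thesis using Y by (intro exI[of _ B]) auto
  qed
  have int: "integrable unit_cube (\<lambda>x. of_real (g (Y x)) * f x)" if g: "continuous_on UNIV g" for g :: "real^3 \<Rightarrow> real"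
  proof -
    obtain B where B: "\<And>x. norm (complex_of_real (g (Y x))) \<le> B" using contbd[OF g] by blast
    have "continuous_on UNIV (\<lambda>x. complex_of_real (g (Y x)))"
      by (intro continuous_intros continuous_on_compose2[OF g Ycont]) auto
    then show ?thesis
      by (intro integrable_bounded_mult[OF fi _ B] continuous_measurable_unit_cube)
  qed
  have "norm ?J \<le> e * I" if e: "e > 0" for e
  proof -
    obtain P where P: "real_polynomial_function P" "\<And>y. y \<in> cbox (- 1) 1 \<Longrightarrow> \<bar>\<Phi> y - P y\<bar> < e"
      using Stone_Weierstrass_real_polynomial_function[of "cbox (- 1) (1::real^3)" \<Phi> e] e \<Phi>
      by (auto intro: continuous_on_subset)
    have Pc: "continuous_on UNIV P" using P(1) by (simp add: continuous_on_polymonial_function real_polynomial_function_eq)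
    have "fzero (\<lambda>x. of_real (P (Y x)) * f x)"
      using fmult_polynomial[OF P(1), of c] f by (simp add: fmult_def Y_def)
    then have "(LINT x|unit_cube. of_real (P (Y x)) * f x * echar 0 x) = 0" unfolding fzero_def by blast
    then have z: "(LINT x|unit_cube. of_real (P (Y x)) * f x) = 0" by simp
    have "?J = (LINT x|unit_cube. of_real (\<Phi> (Y x)) * f x - of_real (P (Y x)) * f x)"
      using z by (simp add: int[OF \<Phi>] int[OF Pc])
    also have "norm \<dots> \<le> (LINT x|unit_cube. norm (of_real (\<Phi> (Y x)) * f x - of_real (P (Y x)) * f x))"
      by (rule integral_norm_bound)
    also have "\<dots> \<le> (LINT x|unit_cube. e * norm (f x))"
    proof (rule integral_mono)
      fix x
      have "norm (of_real (\<Phi> (Y x)) * f x - of_real (P (Y x)) * f x) = \<bar>\<Phi> (Y x) - P (Y x)\<bar> * norm (f x)"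
        by (simp add: norm_mult flip: left_diff_distrib of_real_diff)
      also have "\<dots> \<le> e * norm (f x)" using P(2)[OF Y[of x]] by (intro mult_right_mono) auto
      finally show "norm (of_real (\<Phi> (Y x)) * f x - of_real (P (Y x)) * f x) \<le> e * norm (f x)" .
    qed (use fi int[OF \<Phi>] int[OF Pc] in auto)
    also have "\<dots> = e * I" by (simp add: I_def)
    finally show ?thesis .
  qed
  then have *: "norm ?J \<le> e * I" if "e > 0" for e using that by blast
  have "norm ?J \<le> 0"
  proof (rule field_le_epsilon)
    fix e :: real assume "e > 0"
    \<comment> \<open>I may be zero, hence the denominator I + 1.\<close>
    then have "norm ?J \<le> e / (I + 1) * I" using I by (intro *) auto
    also have "\<dots> \<le> 0 + e" using I \<open>e > 0\<close> by (simp add: field_simps)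
    finally show "norm ?J \<le> 0 + e" .
  qed
  then show ?thesis by (simp add: Y_def)
qed

text \<open>Intervals are superlevel sets of trigonometric polynomials; this makes indicator functions of
  boxes limits of trigonometric polynomials.\<close>

lemma interval_iff_cos:
  fixes a b t :: real
  assumes "0 \<le> a" "a < b" "b \<le> 1" "0 \<le> t" "t \<le> 1"
  shows "cos (2 * pi * (t - (a + b) / 2)) > cos (pi * (b - a)) \<longleftrightarrow> a < t \<and> t < b"
proof -
  define s where "s = 2 * pi * \<bar>t - (a + b) / 2\<bar>"
  have cs: "cos (2 * pi * (t - (a + b) / 2)) = cos s"
    by (simp add: s_def abs_if) (metis cos_minus minus_mult_right minus_diff_eq)
  have s0: "0 \<le> s" by (simp add: s_def)
  have iff: "a < t \<and> t < b \<longleftrightarrow> s < pi * (b - a)"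
  proof -
    have "s < pi * (b - a) \<longleftrightarrow> pi * (2 * \<bar>t - (a + b) / 2\<bar>) < pi * (b - a)" by (simp add: s_def mult_ac)
    also have "\<dots> \<longleftrightarrow> 2 * \<bar>t - (a + b) / 2\<bar> < b - a" by (simp add: mult_less_cancel_left_pos)
    also have "\<dots> \<longleftrightarrow> a < t \<and> t < b" by (auto simp: abs_if field_simps)
    finally show ?thesis by blast
  qed
  \<comment> \<open>For s > pi the cosine increases again; this bound keeps 2 pi - s, which has the
    same cosine, above pi (b - a).\<close>
  have ub: "s \<le> 2 * pi - pi * (b - a)"
  proof -
    have "2 * \<bar>t - (a + b) / 2\<bar> \<le> 2 - (b - a)" using assms by (auto simp: abs_if field_simps)
    then have "pi * (2 * \<bar>t - (a + b) / 2\<bar>) \<le> pi * (2 - (b - a))" by (intro mult_left_mono) auto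
    then show ?thesis by (simp add: s_def algebra_simps)
  qed
  have w: "0 < pi * (b - a)" "pi * (b - a) \<le> pi" using assms by (auto simp: mult_le_cancel_left1)
  have "cos s > cos (pi * (b - a)) \<longleftrightarrow> s < pi * (b - a)"
  proof
    assume "s < pi * (b - a)"
    then show "cos s > cos (pi * (b - a))" using s0 w by (intro cos_monotone_0_pi) auto
  next
    assume c: "cos s > cos (pi * (b - a))"
    show "s < pi * (b - a)"
    proof (rule ccontr)
      assume n: "\<not> s < pi * (b - a)"
      have "cos s \<le> cos (pi * (b - a))"
      proof (cases "s \<le> pi")
        case True
        then show ?thesis using n w by (intro cos_monotone_0_pi_le) auto
      next
        case False
        have "cos s = cos (2 * pi - s)" by (simp add: cos_diff)
        also have "\<dots> \<le> cos (pi * (b - a))" using False ub w by (intro cos_monotone_0_pi_le) auto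
        finally show ?thesis .
      qed
      with c show False by simp
    qed
  qed
  then show ?thesis using iff cs by simp
qed

text \<open>The functions min 1 (N max 0 r) tend to the indicator of r > 0. With
  \<open>interval_iff_cos\<close> their product over the coordinates tends to the indicator of the
  box on the unit cube, and it stays between 0 and 1, so dominated convergence applies.\<close>

lemma fzero_box:
  assumes f: "fzero f" and ab: "\<And>i. 0 \<le> a $ i \<and> a $ i < b $ i \<and> b $ i \<le> 1"
  shows "(LINT x|unit_cube. indicator (box a b) x * f x) = 0"
proof -
  define c where "c = (\<chi> i. (a $ i + b $ i) / 2)"
  define d where "d i = cos (pi * (b $ i - a $ i))" for i :: 3
  define Y where "Y x = (\<chi> i. cos (2 * pi * (x $ i - c $ i)))" for x :: "real^3"
  define \<Phi> where "\<Phi> N y = (\<Prod>i\<in>UNIV. min 1 (real N * max 0 (y $ i - d i)))" for N :: nat and y :: "real^3"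
  have \<Phi>c: "continuous_on UNIV (\<Phi> N)" for N unfolding \<Phi>_def by (intro continuous_intros)
  have fi: "integrable unit_cube f" using f by (simp add: fzero_def)
  have z: "(LINT x|unit_cube. of_real (\<Phi> N (Y x)) * f x) = 0" for N
    using fzero_continuous[OF f \<Phi>c, of N c] by (simp add: Y_def)
  have \<Phi>1: "\<bar>\<Phi> N y\<bar> \<le> 1" for N y
    unfolding \<Phi>_def abs_prod by (intro prod_le_1) auto
  have lim: "(\<lambda>N. min 1 (real N * max 0 r)) \<longlonglongrightarrow> (if r > 0 then 1 else 0)" for r
  proof (cases "r > 0")
    case True
    obtain M :: nat where M: "1 / r < real M" using reals_Archimedean2 by blast
    have "eventually (\<lambda>N. min 1 (real N * max 0 r) = 1) sequentially"
      using eventually_ge_at_top[of M]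
    proof eventually_elim
      case (elim N)
      have "1 / r < real N" using M elim by linarith
      then have "1 < real N * r" using True by (simp add: field_simps)
      then show ?case using True by simp
    qed
    then show ?thesis using True by (simp add: tendsto_eventually)
  qed simp
  have ind: "(\<lambda>N. \<Phi> N (Y x)) \<longlonglongrightarrow> indicator (box a b) x" if x: "x \<in> cbox 0 1" for x
  proof -
    have "(\<lambda>N. \<Phi> N (Y x)) \<longlonglongrightarrow> (\<Prod>i\<in>UNIV. if Y x $ i - d i > 0 then 1 else 0)"
      unfolding \<Phi>_def by (intro tendsto_prod lim)
    also have "(\<Prod>i\<in>UNIV. if Y x $ i - d i > 0 then 1 else 0) = (\<Prod>i\<in>UNIV. if a $ i < x $ i \<and> x $ i < b $ i then 1 else (0::real))"
    proof (rule prod.cong)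
      fix i
      have "Y x $ i - d i > 0 \<longleftrightarrow> a $ i < x $ i \<and> x $ i < b $ i"
        using interval_iff_cos[of "a $ i" "b $ i" "x $ i"] ab[of i] x
        by (simp add: Y_def d_def c_def mem_box_cart)
      then show "(if Y x $ i - d i > 0 then 1 else 0) = (if a $ i < x $ i \<and> x $ i < b $ i then 1 else (0::real))" by simp
    qed simp
    also have "\<dots> = indicator (box a b) x"
      by (auto simp: indicator_def mem_box_cart)
    finally show ?thesis .
  qed
  have "(\<lambda>N. LINT x|unit_cube. of_real (\<Phi> N (Y x)) * f x) \<longlonglongrightarrow> (LINT x|unit_cube. indicator (box a b) x * f x)"
  proof (rule integral_dominated_convergence)
    show "integrable unit_cube (\<lambda>x. norm (f x))" using fi by simp
    show "(\<lambda>x. of_real (\<Phi> N (Y x)) * f x) \<in> borel_measurable unit_cube" for N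
    proof (rule borel_measurable_times[OF continuous_measurable_unit_cube])
      show "continuous_on UNIV (\<lambda>x. complex_of_real (\<Phi> N (Y x)))"
        unfolding Y_def by (intro continuous_intros continuous_on_compose2[OF \<Phi>c continuous_on_cos_vec]) auto
    qed (use fi in auto)
    have "box a b \<in> sets (lebesgue :: (real^3) measure)" by simp
    then have "(indicator (box a b) :: real^3 \<Rightarrow> complex) \<in> borel_measurable unit_cube"
      by (intro measurable_restrict_space1 borel_measurable_indicator)
    then show "(\<lambda>x. indicator (box a b) x * f x) \<in> borel_measurable unit_cube"
      using fi by (intro borel_measurable_times) auto
    have "(\<lambda>N. of_real (\<Phi> N (Y x)) * f x) \<longlonglongrightarrow> indicator (box a b) x * f x" if "x \<in> cbox 0 1" for x
      using tendsto_mult[OF tendsto_of_real[OF ind[OF that]] tendsto_const[of "f x"]]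
      by (cases "x \<in> box a b") simp_all
    then show "AE x in unit_cube. (\<lambda>N. of_real (\<Phi> N (Y x)) * f x) \<longlonglongrightarrow> indicator (box a b) x * f x"
      by (intro AE_I2) simp
    show "AE x in unit_cube. norm (of_real (\<Phi> N (Y x)) * f x) \<le> norm (f x)" for N
      using \<Phi>1 by (intro AE_I2) (simp add: norm_mult mult_left_le_one_le)
  qed
  then show ?thesis unfolding z by (simp add: LIMSEQ_const_iff)
qed


text \<open>Lebesgue differentiation: almost everywhere f is the limit of its averages over small
  cubes with corner x, and all these averages vanish by \<open>fzero_box\<close>.\<close>

theorem fzero_AE:
  assumes f: "fzero f"
  shows "AE x in unit_cube. f x = 0"
proof -
  have fi: "integrable unit_cube f" using f by (simp add: fzero_def)
  \<comment> \<open>Extension by zero makes the function integrable over every box, as the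
    differentiation theorem demands.\<close>
  define F where "F x = (if x \<in> cbox 0 1 then f x else 0)" for x
  have "f absolutely_integrable_on cbox 0 1"
    using fi by (simp add: set_integrable_def integrable_restrict_space)
  then have "F absolutely_integrable_on UNIV"
    unfolding F_def by (simp add: absolutely_integrable_restrict_UNIV)
  then have Fi: "F integrable_on cbox a b" for a b
    by (meson absolutely_integrable_on_def integrable_on_subcbox subset_UNIV)
  obtain N where N: "negligible N" and lim: "\<And>x e. x \<notin> N \<Longrightarrow> 0 < e \<Longrightarrow>
      \<exists>d>0. \<forall>h. 0 < h \<and> h < d \<longrightarrow> norm (integral (cbox x (x + h *\<^sub>R One)) F /\<^sub>R h ^ DIM(real^3) - F x) < e"
    using integrable_ccontinuous_explicit[of F] Fi by blast
  have zero: "integral (cbox a b) F = 0" if ab: "\<And>i. 0 \<le> a $ i \<and> a $ i < b $ i \<and> b $ i \<le> 1" for a b :: "real^3"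
  proof -
    have sub: "box a b \<subseteq> cbox 0 1"
    proof
      fix x assume x: "x \<in> box a b"
      have "0 \<le> x $ i \<and> x $ i \<le> 1" for i
        using x ab[of i] unfolding mem_box_cart by (smt (verit))
      then show "x \<in> cbox 0 1" by (simp add: mem_box_cart)
    qed
    have "integral (cbox a b) F = integral (box a b) F" by (rule integral_open_interval[symmetric])
    also have "\<dots> = integral (box a b) f"
      using sub by (intro integral_cong) (auto simp: F_def)
    also have "\<dots> = integral (cbox 0 1) (\<lambda>x. if x \<in> box a b then f x else 0)"
      using sub by (simp add: integral_restrict_Int Int_absorb2)
    also have "\<dots> = (LINT x|unit_cube. (if x \<in> box a b then f x else 0))"
    proof (rule lebesgue_integral_eq_integral[symmetric])
      have "box a b \<in> sets (lebesgue :: (real^3) measure)" by simp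
      then have "(indicator (box a b) :: real^3 \<Rightarrow> complex) \<in> borel_measurable unit_cube"
        by (intro measurable_restrict_space1 borel_measurable_indicator)
      then have "integrable unit_cube (\<lambda>x. indicator (box a b) x * f x)"
        by (rule integrable_bounded_mult[OF fi, of _ 1]) (simp add: indicator_def)
      then show "integrable unit_cube (\<lambda>x. if x \<in> box a b then f x else 0)"
        by (rule back_subst[of "integrable unit_cube"]) (auto simp: indicator_def)
    qed simp
    also have "\<dots> = (LINT x|unit_cube. indicator (box a b) x * f x)"
      by (intro Bochner_Integration.integral_cong) (auto simp: indicator_def)
    finally show ?thesis using fzero_box[OF f ab] by simp
  qed
  have "f x = 0" if x: "x \<in> box 0 1" "x \<notin> N" for x
  proof (rule ccontr)
    assume nz: "f x \<noteq> 0"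
    have Fx: "F x = f x" using x(1) box_subset_cbox by (auto simp: F_def)
    obtain d where d: "d > 0" and dl: "\<And>h. 0 < h \<Longrightarrow> h < d \<Longrightarrow>
        norm (integral (cbox x (x + h *\<^sub>R One)) F /\<^sub>R h ^ DIM(real^3) - F x) < norm (f x)"
      using lim[OF x(2), of "norm (f x)"] nz by auto
    \<comment> \<open>Small enough for the differentiation estimate, and such that the cube at x
      stays inside the unit cube.\<close>
    define h where "h = Min {d / 2, 1 - x $ 1, 1 - x $ 2, 1 - x $ 3}"
    have x1: "x $ i < 1 \<and> 0 < x $ i" for i using x(1) by (simp add: mem_box_cart)
    have h: "0 < h" "h < d" "h \<le> 1 - x $ 1" "h \<le> 1 - x $ 2" "h \<le> 1 - x $ 3"
      using d x1[of 1] x1[of 2] x1[of 3] unfolding h_def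
      by (auto simp: min_less_iff_disj min_le_iff_disj)
    then have "h \<le> 1 - x $ i" for i using exhaust_3[of i] by auto
    then have "integral (cbox x (x + h *\<^sub>R One)) F = 0"
    proof (intro zero)
      fix i 
      have "(One :: real^3) $ i = 1"
        using inner_sum_left_Basis[of "axis i 1 :: real^3" "\<lambda>_. 1"]
        by (simp add: cart_eq_inner_axis axis_in_Basis_iff)
      then show "0 \<le> x $ i \<and> x $ i < (x + h *\<^sub>R One) $ i \<and> (x + h *\<^sub>R One) $ i \<le> 1"
        using x1[of i] h(1) \<open>\<And>i. h \<le> 1 - x $ i\<close>[of i] by (simp add: less_imp_le)
    qed
    then show False using dl[OF h(1,2)] Fx by simp
  qed
  moreover have "negligible (N \<union> (cbox 0 1 - box 0 1 :: (real^3) set))"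
    using N negligible_frontier_interval[of "0::real^3" 1] by (intro negligible_Un) auto
  then have "AE x in lebesgue. x \<notin> N \<union> (cbox 0 1 - box 0 1 :: (real^3) set)"
    unfolding negligible_iff_null_sets by (rule AE_not_in)
  ultimately have "AE x in lebesgue. x \<in> cbox 0 1 \<longrightarrow> f x = 0"
    by (auto elim!: AE_mp)
  then show ?thesis by (simp add: AE_restrict_space_iff)
qed

section \<open>Shell series\<close>

lemma lborel_integral_prod:
  fixes f :: "'a::euclidean_space \<Rightarrow> real \<Rightarrow> complex"
  assumes f: "\<And>b. b \<in> Basis \<Longrightarrow> integrable lborel (f b)"
  shows "(LINT x|lborel. (\<Prod>b\<in>Basis. f b (x \<bullet> b))) = (\<Prod>b\<in>Basis. LINT t|lborel. f b t)"
proof -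
  interpret product_sigma_finite "\<lambda>_::'a. lborel :: real measure"
    by standard
  have m: "(\<lambda>x. \<Prod>b\<in>Basis. f b (x \<bullet> b)) \<in> borel_measurable borel"
  proof (intro borel_measurable_prod)
    fix b :: 'a assume "b \<in> Basis"
    then have [measurable]: "f b \<in> borel_measurable borel" using f[of b] by auto
    show "(\<lambda>x. f b (x \<bullet> b)) \<in> borel_measurable borel" by measurable
  qed
  have "(LINT x|lborel. (\<Prod>b\<in>Basis. f b (x \<bullet> b)))
      = (LINT g|(\<Pi>\<^sub>M b\<in>Basis. lborel). (\<Prod>b\<in>Basis. f b ((\<Sum>b\<in>Basis. g b *\<^sub>R b) \<bullet> b)))"
    by (subst lborel_eq, subst integral_distr) (use m in auto)
  also have "\<dots> = (LINT g|(\<Pi>\<^sub>M b\<in>Basis. lborel). (\<Prod>b\<in>Basis. f b (g b)))"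
    by (intro Bochner_Integration.integral_cong prod.cong) auto
  also have "\<dots> = (\<Prod>b\<in>Basis. LINT t|lborel. f b t)"
    by (rule product_integral_prod) (auto intro: f)
  finally show ?thesis .
qed

lemma integral_exp_period:
  assumes "m \<noteq> (0::int)"
  shows "(LINT t|lborel. indicator {0..1} t *\<^sub>R exp (2 * complex_of_real pi * \<i> * of_int m * of_real t)) = 0"
proof -
  let ?a = "2 * complex_of_real pi * \<i> * of_int m"
  have a: "?a \<noteq> 0" using assms by simp
  have "(LINT t|lborel. indicator {0..1} t *\<^sub>R exp (?a * of_real t)) = exp (?a * of_real 1) / ?a - exp (?a * of_real 0) / ?a"
  proof (rule integral_FTC_Icc)
    fix t :: real
    have "((\<lambda>z. exp (?a * z) / ?a) has_field_derivative exp (?a * of_real t)) (at (of_real t))"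
      using a by (auto intro!: derivative_eq_intros)
    then show "((\<lambda>t. exp (?a * of_real t) / ?a) has_vector_derivative exp (?a * of_real t)) (at t within {0..1})"
      by (rule has_vector_derivative_real_field)
  qed (auto intro!: continuous_intros)
  also have "exp (?a * of_real 1) = 1"
    using exp_integer_2pi[of "of_int m"] by (simp add: mult_ac)
  finally show ?thesis by simp
qed

section \<open>Orthogonality of the characters\<close>

lemma integrable_const_unit_cube [simp]: "integrable unit_cube (\<lambda>x. c)"
  using finite_measure_lebesgue_on[of "cbox 0 (1 :: real^3)"] by (intro finite_measure.integrable_const) auto

lemma integrable_echar: "integrable unit_cube (echar k)"
proof -
  have "integrable unit_cube (\<lambda>x. 1 :: complex)" by simp
  from integrable_echar_mult[OF this] show ?thesis by simp
qed

text \<open>The integral factors over the coordinates, and any coordinate with nonzero frequency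
  contributes a full period, hence the factor 0.\<close>

lemma integral_echar: "(LINT x|unit_cube. echar k x) = (if k = 0 then 1 else 0)"
proof (cases "k = 0")
  case True
  have "measure unit_cube (space unit_cube) = 1"
    using content_cbox_if_cart[of "0::real^3" 1]
    by (simp add: measure_restrict_space space_restrict_space) (simp add: interval_eq_empty_cart)
  then show ?thesis using True by simp
next
  case False
  then obtain i where i: "k $ i \<noteq> 0" by (auto simp: vec_eq_iff)
  define f where "f b t = indicator {0..1} t *\<^sub>R exp (2 * complex_of_real pi * \<i> * of_real (rvec k \<bullet> b) * of_real t)" for b :: "real^3" and t :: real
  have fi: "integrable lborel (f b)" for b
    unfolding f_def by (rule borel_integrable_compact) (auto intro!: continuous_intros)
  have eq: "indicator (cbox 0 1) x *\<^sub>R echar k x = (\<Prod>b\<in>Basis. f b (x \<bullet> b))" for x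
  proof -
    have "rvec k \<bullet> x = (\<Sum>b\<in>Basis. (rvec k \<bullet> b) * (x \<bullet> b))" by (rule euclidean_inner)
    then have "echar k x = (\<Prod>b\<in>Basis. exp (2 * complex_of_real pi * \<i> * of_real (rvec k \<bullet> b) * of_real (x \<bullet> b)))"
      by (simp add: echar_def sum_distrib_left exp_sum mult_ac)
    moreover have "indicator (cbox 0 1) x = (\<Prod>b\<in>Basis. indicator {0..1} (x \<bullet> b) :: real)"
    proof -
      have one: "(1 :: real^3) \<bullet> b = 1" if "b \<in> Basis" for b
        using that by (auto simp: Basis_vec_def inner_axis)
      have "x \<in> cbox 0 1 \<longleftrightarrow> (\<forall>b\<in>Basis. x \<bullet> b \<in> {0..1})" by (simp add: mem_box one)
      then show ?thesis by (auto simp: indicator_def)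
    qed
    ultimately show ?thesis by (simp add: f_def prod.distrib scaleR_conv_of_real)
  qed
  have "(LINT x|unit_cube. echar k x) = (LINT x|lebesgue. indicator (cbox 0 1) x *\<^sub>R echar k x)"
    by (simp add: integral_restrict_space)
  also have "\<dots> = (LINT x|lborel. indicator (cbox 0 1) x *\<^sub>R echar k x)"
    by (rule integral_completion) auto
  also have "\<dots> = (\<Prod>b\<in>Basis. LINT t|lborel. f b t)"
    unfolding eq by (rule lborel_integral_prod) (rule fi)
  also have "\<dots> = 0"
  proof (rule prod_zero)
    have "rvec k \<bullet> axis i 1 = of_int (k $ i)" by (simp add: inner_axis rvec_def)
    then have "(LINT t|lborel. f (axis i 1) t) = 0"
      using integral_exp_period[OF i] by (simp add: f_def)
    moreover have "axis i 1 \<in> (Basis :: (real^3) set)" by (simp add: axis_in_Basis_iff)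
    ultimately show "\<exists>b\<in>Basis. (LINT t|lborel. f b t) = 0" by blast
  qed simp
  finally show ?thesis using False by simp
qed

section \<open>Absolutely convergent series over the shells\<close>

definition shellpm :: "nat \<Rightarrow> (int^3) set" where
  "shellpm n = Mshell n \<union> uminus ` Mshell n"

definition Sset :: "nat \<Rightarrow> (int^3) set" where
  "Sset N = (\<Union>n<N. shellpm n)"

lemma finite_shellpm [simp]: "finite (shellpm n)" and finite_Sset [simp]: "finite (Sset N)"
  by (simp_all add: shellpm_def Sset_def)

lemma mem_shellpm: "k \<in> shellpm n \<longleftrightarrow> k \<in> Mshell n \<or> - k \<in> Mshell n"
  by (force simp: shellpm_def)

lemma card_shellpm: "card (shellpm n) \<le> 12"
proof -
  have "card (shellpm n) \<le> card (Mshell n) + card (uminus ` Mshell n)"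
    unfolding shellpm_def by (rule card_Un_le)
  also have "card (uminus ` Mshell n) = card (Mshell n)"
    by (rule card_image) simp
  finally show ?thesis by (simp add: card_Mshell)
qed

lemma shellpm_disjoint: "n \<noteq> m \<Longrightarrow> shellpm n \<inter> shellpm m = {}"
  using Mshell_disjoint by (fastforce simp: mem_shellpm)

lemma Mset_shellpm: "k \<in> Mset \<longleftrightarrow> (\<exists>n. k \<in> shellpm n)"
  by (simp add: Mset_iff mem_shellpm)

definition psum :: "(int^3 \<Rightarrow> complex) \<Rightarrow> nat \<Rightarrow> real^3 \<Rightarrow> complex" where
  "psum c N x = (\<Sum>k\<in>Sset N. c k * echar k x)"

text \<open>Grouping by shells leaves finite inner sums, so an ordinary series over n is
  enough.\<close>

definition ser :: "(int^3 \<Rightarrow> complex) \<Rightarrow> real^3 \<Rightarrow> complex" where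
  "ser c x = (\<Sum>n. \<Sum>k\<in>shellpm n. c k * echar k x)"

text \<open>Boundedness of |c_k| 3^(n/2). At most twelve frequencies per shell and the geometric
  decay of 3^(-n/2) make the series converge uniformly, with uniformly bounded partial sums.\<close>

definition decaying :: "(int^3 \<Rightarrow> complex) \<Rightarrow> bool" where
  "decaying c \<longleftrightarrow> (\<forall>k. k \<notin> Mset \<longrightarrow> c k = 0) \<and> (\<exists>B. \<forall>n. \<forall>k\<in>shellpm n. norm (c k) * sqrt 3 ^ n \<le> B)"

lemma psum_eq: "psum c N x = (\<Sum>n<N. \<Sum>k\<in>shellpm n. c k * echar k x)"
  unfolding psum_def Sset_def
  by (rule sum.UNION_disjoint) (auto dest: shellpm_disjoint)

lemma shell_sum_bound:
  assumes "\<forall>n. \<forall>k\<in>shellpm n. norm (c k) * sqrt 3 ^ n \<le> B"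
  shows "norm (\<Sum>k\<in>shellpm n. c k * echar k x) \<le> 12 * B * (1 / sqrt 3) ^ n"
proof -
  have b: "norm (c k) \<le> B * (1 / sqrt 3) ^ n" if "k \<in> shellpm n" for k
    using assms that by (simp add: field_simps)
  have "Mshell n \<noteq> {}" using card_Mshell[of n] by auto
  then obtain k0 where k0: "k0 \<in> shellpm n" by (auto simp: shellpm_def)
  have B: "0 \<le> B * (1 / sqrt 3) ^ n" using b[OF k0] norm_ge_zero order_trans by blast
  have "norm (\<Sum>k\<in>shellpm n. c k * echar k x) \<le> (\<Sum>k\<in>shellpm n. B * (1 / sqrt 3) ^ n)"
    by (rule sum_norm_le) (simp add: norm_mult b)
  also have "\<dots> \<le> 12 * (B * (1 / sqrt 3) ^ n)"
    using B card_shellpm[of n] by (simp only: sum_constant) (intro mult_right_mono, simp_all)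
  finally show ?thesis by simp
qed

lemma summable_inv_sqrt3: "summable (\<lambda>n. C * (1 / sqrt 3) ^ n :: real)"
  by (intro summable_mult summable_geometric) simp

lemma decaying_sums:
  assumes "decaying c"
  shows "(\<lambda>N. psum c N x) \<longlonglongrightarrow> ser c x"
proof -
  obtain B where B: "\<forall>n. \<forall>k\<in>shellpm n. norm (c k) * sqrt 3 ^ n \<le> B" using assms by (auto simp: decaying_def)
  have "summable (\<lambda>n. \<Sum>k\<in>shellpm n. c k * echar k x)"
    by (rule summable_comparison_test'[OF summable_inv_sqrt3 shell_sum_bound[OF B]])
  then show ?thesis unfolding psum_eq ser_def by (rule summable_LIMSEQ)
qed

lemma decaying_bound:
  assumes "decaying c"
  shows "\<exists>C. \<forall>N x. norm (psum c N x) \<le> C"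
proof -
  obtain B where B: "\<forall>n. \<forall>k\<in>shellpm n. norm (c k) * sqrt 3 ^ n \<le> B" using assms by (auto simp: decaying_def)
  have B0: "0 \<le> 12 * B * (1 / sqrt 3) ^ n" for n using shell_sum_bound[OF B] norm_ge_zero order_trans by blast
  have "norm (psum c N x) \<le> (\<Sum>n. 12 * B * (1 / sqrt 3) ^ n)" for N x
  proof -
    have "norm (psum c N x) \<le> (\<Sum>n<N. 12 * B * (1 / sqrt 3) ^ n)"
      unfolding psum_eq by (intro sum_norm_le shell_sum_bound B)
    also have "\<dots> \<le> (\<Sum>n. 12 * B * (1 / sqrt 3) ^ n)"
      by (intro sum_le_suminf summable_inv_sqrt3) (use B0 in auto)
    finally show ?thesis .
  qed
  then show ?thesis by blast
qed

lemma continuous_on_psum: "continuous_on UNIV (psum c N)"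
  unfolding psum_def by (intro continuous_intros)

lemma continuous_on_ser:
  assumes "decaying c"
  shows "continuous_on UNIV (ser c)"
proof -
  obtain B where B: "\<forall>n. \<forall>k\<in>shellpm n. norm (c k) * sqrt 3 ^ n \<le> B" using assms by (auto simp: decaying_def)
  have "uniform_limit UNIV (\<lambda>N x. \<Sum>n<N. \<Sum>k\<in>shellpm n. c k * echar k x) (ser c) sequentially"
    unfolding ser_def by (rule Weierstrass_m_test[OF shell_sum_bound[OF B] summable_inv_sqrt3])
  then show ?thesis
    by (rule uniform_limit_theorem[rotated]) (auto intro!: always_eventually continuous_intros)
qed

lemma integrable_bounded_continuous:
  fixes h :: "real^3 \<Rightarrow> complex"
  assumes "continuous_on UNIV h"
  shows "integrable unit_cube h"
proof -
  have "compact (h ` cbox 0 1)" using assms by (intro compact_continuous_image) (auto intro: continuous_on_subset)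
  then obtain B where B: "\<And>x. x \<in> cbox 0 1 \<Longrightarrow> norm (h x) \<le> B" using compact_imp_bounded bounded_iff by (metis imageI)
  show ?thesis
  proof (rule Bochner_Integration.integrable_bound)
    show "integrable unit_cube (\<lambda>x. B)" by simp
    show "h \<in> borel_measurable unit_cube" using assms by (rule continuous_measurable_unit_cube)
    have "norm (h x) \<le> norm B" if "x \<in> cbox 0 1" for x using B[OF that] by simp
    then show "AE x in unit_cube. norm (h x) \<le> norm B" by (intro AE_I2) (simp add: space_restrict_space)
  qed
qed

lemma integral_psum_echar:
  "(LINT x|unit_cube. psum c N x * echar (- k) x) = (if k \<in> Sset N then c k else 0)"
proof -
  have "(LINT x|unit_cube. psum c N x * echar (- k) x) = (LINT x|unit_cube. (\<Sum>l\<in>Sset N. c l * echar (l - k) x))"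
    by (simp add: psum_def sum_distrib_right mult.assoc flip: echar_add)
  also have "\<dots> = (\<Sum>l\<in>Sset N. c l * (if l - k = 0 then 1 else 0))"
    by (simp add: integrable_echar integral_echar)
  also have "\<dots> = (if k \<in> Sset N then c k else 0)"
    by (simp add: if_distrib sum.delta' cong: if_cong)
  finally show ?thesis .
qed

lemma eventually_Sset: "k \<in> Mset \<Longrightarrow> eventually (\<lambda>N. k \<in> Sset N) sequentially"
proof -
  assume "k \<in> Mset"
  then obtain n where "k \<in> shellpm n" by (auto simp: Mset_shellpm)
  then show ?thesis by (intro eventually_sequentiallyI[of "Suc n"]) (force simp: Sset_def)
qed

lemma Sset_Mset: "Sset N \<subseteq> Mset"
  by (auto simp: Sset_def Mset_shellpm)

lemma integral_ser_echar:
  assumes c: "decaying c"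
  shows "(LINT x|unit_cube. ser c x * echar (- k) x) = c k"
proof -
  obtain C where C: "\<And>N x. norm (psum c N x) \<le> C" using decaying_bound[OF c] by blast
  have "(\<lambda>N. LINT x|unit_cube. psum c N x * echar (- k) x) \<longlonglongrightarrow> (LINT x|unit_cube. ser c x * echar (- k) x)"
  proof (rule integral_dominated_convergence)
    show "integrable unit_cube (\<lambda>x. C)" by simp
    show "AE x in unit_cube. (\<lambda>N. psum c N x * echar (- k) x) \<longlonglongrightarrow> ser c x * echar (- k) x"
      by (intro AE_I2 tendsto_intros decaying_sums c)
    show "AE x in unit_cube. norm (psum c N x * echar (- k) x) \<le> C" for N
      using C by (intro AE_I2) (simp add: norm_mult)
  qed (intro continuous_measurable_unit_cube continuous_intros continuous_on_psum continuous_on_ser c)+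
  moreover have "(\<lambda>N. LINT x|unit_cube. psum c N x * echar (- k) x) \<longlonglongrightarrow> c k"
  proof (cases "k \<in> Mset")
    case True
    then show ?thesis
      unfolding integral_psum_echar by (intro tendsto_eventually eventually_mono[OF eventually_Sset]) auto
  next
    case False
    then have "k \<notin> Sset N" "c k = 0" for N using Sset_Mset c by (auto simp: decaying_def)
    then show ?thesis unfolding integral_psum_echar by simp
  qed
  ultimately show ?thesis by (rule LIMSEQ_unique)
qed

text \<open>A frequency k belongs to finitely many triads only. The coefficient of the product of
  partial sums is therefore constant once these triads are included, and dominated convergence
  carries it to the limit.\<close>

lemma integral_ser_mult:
  assumes c: "decaying c" and d: "decaying d" and k: "k \<in> Mshell n"
  shows "(LINT x|unit_cube. ser c x * ser d x * echar (- k) x) = (\<Sum>(a, b) | a \<in> Mset \<and> b \<in> Mset \<and> a + b = k. c a * d b)"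
proof -
  let ?T = "{(a, b). a \<in> Mset \<and> b \<in> Mset \<and> a + b = k}"
  have fin: "finite ?T"
  proof -
    have "finite (case n of 0 \<Rightarrow> {} | Suc m \<Rightarrow> sum_pairs m k)"
      by (auto split: nat.splits intro: finite_subset[of _ "Mshell (n - 1) \<times> Mshell (n - 1)"])
    moreover have "finite (diff_pairs n k)"
      by (rule finite_subset[of _ "Mshell (Suc n) \<times> Mshell n"]) auto
    ultimately show ?thesis unfolding triads[OF k] by simp
  qed
  obtain C where C: "\<And>N x. norm (psum c N x) \<le> C" using decaying_bound[OF c] by blast
  obtain D where D: "\<And>N x. norm (psum d N x) \<le> D" using decaying_bound[OF d] by blast
  have C0: "C \<ge> 0" using C[of 0 0] norm_ge_zero order_trans by blast
  have "(\<lambda>N. LINT x|unit_cube. psum c N x * psum d N x * echar (- k) x) \<longlonglongrightarrow> (LINT x|unit_cube. ser c x * ser d x * echar (- k) x)"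
  proof (rule integral_dominated_convergence)
    show "integrable unit_cube (\<lambda>x. C * D)" by simp
    show "AE x in unit_cube. (\<lambda>N. psum c N x * psum d N x * echar (- k) x) \<longlonglongrightarrow> ser c x * ser d x * echar (- k) x"
      by (intro AE_I2 tendsto_intros decaying_sums c d)
    show "AE x in unit_cube. norm (psum c N x * psum d N x * echar (- k) x) \<le> C * D" for N
      using C D C0 by (intro AE_I2) (simp add: norm_mult mult_mono)
  qed (intro continuous_measurable_unit_cube continuous_intros continuous_on_psum continuous_on_ser c d)+
  moreover have "(\<lambda>N. LINT x|unit_cube. psum c N x * psum d N x * echar (- k) x) \<longlonglongrightarrow> (\<Sum>(a, b)\<in>?T. c a * d b)"
  proof (intro tendsto_eventually)
    have "eventually (\<lambda>N. \<forall>z\<in>?T. fst z \<in> Sset N \<and> snd z \<in> Sset N) sequentially"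
      using fin by (subst eventually_ball_finite_distrib) (auto intro!: eventually_conj eventually_Sset)
    then show "eventually (\<lambda>N. (LINT x|unit_cube. psum c N x * psum d N x * echar (- k) x) = (\<Sum>(a, b)\<in>?T. c a * d b)) sequentially"
    proof eventually_elim
      case (elim N)
      have "(LINT x|unit_cube. psum c N x * psum d N x * echar (- k) x)
         = (LINT x|unit_cube. (\<Sum>a\<in>Sset N. \<Sum>b\<in>Sset N. (c a * d b) * echar (a + b - k) x))"
      proof (rule Bochner_Integration.integral_cong[OF refl])
        fix x
        have "psum c N x * psum d N x = (\<Sum>a\<in>Sset N. \<Sum>b\<in>Sset N. (c a * d b) * echar (a + b) x)"
          unfolding psum_def sum_product by (intro sum.cong refl) (simp add: echar_add)
        then show "psum c N x * psum d N x * echar (- k) x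
            = (\<Sum>a\<in>Sset N. \<Sum>b\<in>Sset N. (c a * d b) * echar (a + b - k) x)"
          by (simp only: diff_conv_add_uminus echar_add[of "_ + _"] sum_distrib_right mult.assoc)
      qed
      also have "\<dots> = (\<Sum>a\<in>Sset N. \<Sum>b\<in>Sset N. (c a * d b) * (if a + b - k = 0 then 1 else 0))"
        by (simp add: integrable_echar integral_echar)
      also have "\<dots> = (\<Sum>(a, b)\<in>Sset N \<times> Sset N. if a + b = k then c a * d b else 0)"
        by (subst sum.cartesian_product) (auto intro!: sum.cong)
      also have "\<dots> = (\<Sum>(a, b)\<in>?T. c a * d b)"
        using elim Sset_Mset by (intro sum.mono_neutral_cong_right) (auto split: if_splits)
      finally show ?case .
    qed
  qed
  ultimately show ?thesis by (rule LIMSEQ_unique)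
qed

section \<open>Fields in the constraint space\<close>

lemma torus_L2_measurable:
  assumes "torus_L2 u"
  shows "(\<lambda>x. u x $ i) \<in> borel_measurable lebesgue"
proof -
  have "(\<lambda>x. u x \<bullet> axis i 1) \<in> borel_measurable lebesgue"
    using assms by (intro borel_measurable_inner) (auto simp: torus_L2_def)
  then show ?thesis by (simp add: inner_axis)
qed

lemma torus_L2_integrable:
  assumes "torus_L2 u"
  shows "integrable unit_cube (\<lambda>x. u x $ i)"
proof (rule Bochner_Integration.integrable_bound)
  show "integrable unit_cube (\<lambda>x. 1 + (norm (u x))\<^sup>2)" using assms by (simp add: torus_L2_def)
  show "(\<lambda>x. u x $ i) \<in> borel_measurable unit_cube"
    by (intro measurable_restrict_space1 torus_L2_measurable assms)
  have "norm (u x $ i) \<le> norm (1 + (norm (u x))\<^sup>2)" for x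
  proof -
    have "norm (u x $ i) \<le> norm (u x)" by (rule Finite_Cartesian_Product.norm_nth_le)
    also have "2 * norm (u x) \<le> 1 + (norm (u x))\<^sup>2" using sum_squares_bound[of 1 "norm (u x)"] by simp
    then have "norm (u x) \<le> 1 + (norm (u x))\<^sup>2" using norm_ge_zero[of "u x"] by linarith
    finally show ?thesis by simp
  qed
  then show "AE x in unit_cube. norm (u x $ i) \<le> norm (1 + (norm (u x))\<^sup>2)" by simp
qed

lemma fcoeff_echar: "fcoeff f k = (LINT x|unit_cube. complex_of_real (f x) * echar (- k) x)"
  by (simp add: fcoeff_def echar_minus)

lemma cnj_echar: "cnj (echar k x) = echar (- k) x"
  by (simp add: echar_def exp_cnj rvec_minus)

lemma fcoeff_minus: "fcoeff f (- k) = cnj (fcoeff f k)"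
  
proof -
  have "cnj (LINT x|unit_cube. complex_of_real (f x) * echar (- k) x)
      = (LINT x|unit_cube. cnj (complex_of_real (f x) * echar (- k) x))"
    by (rule Bochner_Integration.integral_cnj[symmetric])
  then show ?thesis by (simp add: fcoeff_echar cnj_echar)
qed

lemma integrable_fcoeff:
  assumes "integrable unit_cube f"
  shows "integrable unit_cube (\<lambda>x. complex_of_real (f x) * echar k x)"
  by (intro integrable_echar_mult) (use assms in simp)

lemma fhat_diff:
  assumes "torus_L2 u" "torus_L2 w"
  shows "fhat (\<lambda>x. u x - w x) k = fhat u k - fhat w k"
  using assms
  by (simp add: fhat_def vec_eq_iff fcoeff_echar left_diff_distrib integrable_fcoeff torus_L2_integrable)

lemma torus_L2_diff:
  assumes u: "torus_L2 u" and w: "torus_L2 w"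
  shows "torus_L2 (\<lambda>x. u x - w x)"
  unfolding torus_L2_def
proof (intro conjI allI)
  show m: "(\<lambda>x. u x - w x) \<in> borel_measurable lebesgue" using u w by (auto simp: torus_L2_def)
  show "integrable unit_cube (\<lambda>x. (norm (u x - w x))\<^sup>2)"
  proof (rule Bochner_Integration.integrable_bound)
    show "integrable unit_cube (\<lambda>x. 2 * (norm (u x))\<^sup>2 + 2 * (norm (w x))\<^sup>2)" using u w by (simp add: torus_L2_def)
    show "(\<lambda>x. (norm (u x - w x))\<^sup>2) \<in> borel_measurable unit_cube"
      using measurable_restrict_space1[OF m, of "cbox 0 1"] by measurable
    have "(norm (u x - w x))\<^sup>2 \<le> 2 * (norm (u x))\<^sup>2 + 2 * (norm (w x))\<^sup>2" for x
    proof -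
      have "(norm (u x - w x))\<^sup>2 \<le> (norm (u x) + norm (w x))\<^sup>2" by (intro power_mono norm_triangle_ineq4) auto
      also have "\<dots> \<le> 2 * (norm (u x))\<^sup>2 + 2 * (norm (w x))\<^sup>2"
        using sum_squares_bound[of "norm (u x)" "norm (w x)"] by (simp add: power2_sum)
      finally show ?thesis .
    qed
    then show "AE x in unit_cube. norm ((norm (u x - w x))\<^sup>2) \<le> norm (2 * (norm (u x))\<^sup>2 + 2 * (norm (w x))\<^sup>2)"
      by simp
  qed
qed (use u w in \<open>simp add: torus_L2_def\<close>)

lemma HdotM_diff:
  assumes u: "u \<in> HdotM s" and w: "w \<in> HdotM s"
  shows "(\<lambda>x. u x - w x) \<in> HdotM s"
proof -
  have L: "torus_L2 u" "torus_L2 w" using u w by (auto simp: HdotM_def Hdot_def)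
  note fd = fhat_diff[OF L]
  have "(\<lambda>k. lap_symbol s k * (norm (fhat u k - fhat w k))\<^sup>2) summable_on - {0}"
  proof (rule summable_on_comparison_test)
    show "(\<lambda>k. 2 * (lap_symbol s k * (norm (fhat u k))\<^sup>2) + 2 * (lap_symbol s k * (norm (fhat w k))\<^sup>2)) summable_on - {0}"
      using u w by (intro summable_on_add summable_on_cmult_right) (auto simp: HdotM_def Hdot_def)
    show "lap_symbol s k * (norm (fhat u k - fhat w k))\<^sup>2 \<le>
      2 * (lap_symbol s k * (norm (fhat u k))\<^sup>2) + 2 * (lap_symbol s k * (norm (fhat w k))\<^sup>2)" for k
    proof -
      have "(norm (fhat u k - fhat w k))\<^sup>2 \<le> (norm (fhat u k) + norm (fhat w k))\<^sup>2" by (intro power_mono norm_triangle_ineq4) auto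
      also have "\<dots> \<le> 2 * (norm (fhat u k))\<^sup>2 + 2 * (norm (fhat w k))\<^sup>2"
        using sum_squares_bound[of "norm (fhat u k)" "norm (fhat w k)"] by (simp add: power2_sum)
      finally have "lap_symbol s k * (norm (fhat u k - fhat w k))\<^sup>2 \<le> lap_symbol s k * (2 * (norm (fhat u k))\<^sup>2 + 2 * (norm (fhat w k))\<^sup>2)"
        by (intro mult_left_mono) (auto simp: lap_symbol_def)
      then show ?thesis by (simp add: algebra_simps)
    qed
  qed (auto simp: lap_symbol_def)
  moreover have "\<exists>c. fhat u k - fhat w k = c *s cvec (vdir k)" if "k \<in> Mset" for k
  proof -
    obtain a b where "fhat u k = a *s cvec (vdir k)" "fhat w k = b *s cvec (vdir k)"
      using u w that by (fastforce simp: HdotM_def)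
    then show ?thesis by (intro exI[of _ "a - b"]) (simp add: vec_eq_iff algebra_simps)
  qed
  ultimately show ?thesis
    using u w torus_L2_diff[OF L] by (auto simp: HdotM_def Hdot_def fd)
qed

text \<open>The scalar coordinate of the Fourier coefficient along the real unit vector v^k. All
  dynamics take place in these scalars.\<close>

definition coef :: "(real^3 \<Rightarrow> real^3) \<Rightarrow> int^3 \<Rightarrow> complex" where
  "coef u k = (if k \<in> Mset then \<Sum>i\<in>UNIV. complex_of_real (vdir k $ i) * fhat u k $ i else 0)"

lemma vdir_sq_Mset:
  assumes "k \<in> Mset"
  shows "vdir k \<bullet> vdir k = 1"
  using assms
proof (cases rule: Mset_cases)
  case (2 n)
  then show ?thesis using vdir_unit[OF 2] by (simp add: vdir_minus)
qed (rule vdir_unit)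

lemma cvec_dot:
  "(\<Sum>i\<in>UNIV. complex_of_real (v $ i) * complex_of_real (w $ i)) = complex_of_real (v \<bullet> w)"
  by (simp add: inner_vec_def)

lemma fhat_coef:
  assumes u: "u \<in> HdotM s"
  shows "fhat u k = coef u k *s cvec (vdir k)"
proof (cases "k \<in> Mset")
  case True
  then obtain c where c: "fhat u k = c *s cvec (vdir k)" using u by (auto simp: HdotM_def)
  have "coef u k = (\<Sum>i\<in>UNIV. complex_of_real (vdir k $ i) * complex_of_real (vdir k $ i)) * c"
    using True unfolding coef_def c sum_distrib_right by (simp add: cvec_def mult_ac)
  then have "coef u k = c" unfolding cvec_dot using vdir_sq_Mset[OF True] by simp
  then show ?thesis using c by simp
next
  case False
  then show ?thesis using u by (simp add: HdotM_def coef_def)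
qed

lemma fcoeff_coef: "u \<in> HdotM s \<Longrightarrow> fcoeff (\<lambda>x. u x $ i) k = coef u k * vdir k $ i"
  using fhat_coef[of u s k] by (simp add: fhat_def vec_eq_iff cvec_def)

lemma norm_fhat:
  assumes u: "u \<in> HdotM s" and k: "k \<in> Mset"
  shows "norm (fhat u k) = norm (coef u k)"
proof -
  have "(norm (fhat u k))\<^sup>2 = (\<Sum>i\<in>UNIV. (norm (coef u k) * \<bar>vdir k $ i\<bar>)\<^sup>2)"
    unfolding fhat_coef[OF u] by (simp add: norm_vec_def L2_set_def sum_nonneg cvec_def norm_mult)
  also have "\<dots> = (norm (coef u k))\<^sup>2 * (vdir k \<bullet> vdir k)"
  proof -
    have "(norm (coef u k) * \<bar>v\<bar>)\<^sup>2 = (norm (coef u k))\<^sup>2 * (v * v)" for v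
      by (metis power_mult_distrib power2_abs power2_eq_square)
    then show ?thesis by (simp only: inner_vec_def sum_distrib_left inner_real_def)
  qed
  finally show ?thesis using vdir_sq_Mset[OF k] by simp
qed

text \<open>A single term of the sum that defines the critical norm, combined with
  \<open>lap_symbol_crit\<close>.\<close>

lemma coef_bound:
  assumes u: "u \<in> HdotM s_crit" and k: "k \<in> shellpm n"
  shows "norm (coef u k) * sqrt 3 ^ n \<le> Hdot_norm s_crit u"
proof -
  have kM: "k \<in> Mset" using k Mset_shellpm by blast
  \<comment> \<open>The frequency 0 equals its own negative, whereas no shell contains a frequency
    whose negative also lies in a shell.\<close>
  have k0: "k \<in> - {0}" using k Mshell_disjoint[of 0 n 0] Mshell_disjoint[of 0 n n] by (auto simp: mem_shellpm)
  have "3 ^ n \<le> lap_symbol s_crit k"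
    using k lap_symbol_crit[of k n] lap_symbol_crit[of "- k" n] by (auto simp: mem_shellpm lap_symbol_minus)
  then have "3 ^ n * (norm (coef u k))\<^sup>2 \<le> lap_symbol s_crit k * (norm (fhat u k))\<^sup>2"
    unfolding norm_fhat[OF u kM] by (intro mult_right_mono) auto
  also have "\<dots> \<le> (\<Sum>\<^sub>\<infinity>k\<in>- {0}. lap_symbol s_crit k * (norm (fhat u k))\<^sup>2)"
  proof -
    have s: "(\<lambda>k. lap_symbol s_crit k * (norm (fhat u k))\<^sup>2) summable_on - {0}"
      using u by (auto simp: HdotM_def Hdot_def)
    have "(\<Sum>k\<in>{k}. lap_symbol s_crit k * (norm (fhat u k))\<^sup>2) \<le> (\<Sum>\<^sub>\<infinity>k\<in>- {0}. lap_symbol s_crit k * (norm (fhat u k))\<^sup>2)"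
      by (intro finite_sum_le_infsum[OF s]) (use k0 in \<open>auto simp: lap_symbol_def\<close>)
    then show ?thesis by simp
  qed
  finally have "sqrt (3 ^ n * (norm (coef u k))\<^sup>2) \<le> Hdot_norm s_crit u"
    unfolding Hdot_norm_def by (rule real_sqrt_le_mono)
  then show ?thesis by (simp add: real_sqrt_mult real_sqrt_power mult.commute)
qed

definition ccoef :: "(real^3 \<Rightarrow> real^3) \<Rightarrow> 3 \<Rightarrow> int^3 \<Rightarrow> complex" where
  "ccoef u i k = coef u k * vdir k $ i"

lemma decaying_ccoef:
  assumes u: "u \<in> HdotM s_crit"
  shows "decaying (ccoef u i)"
  unfolding decaying_def
proof (intro conjI allI impI exI[of _ "Hdot_norm s_crit u"] ballI)
  fix n k assume k: "k \<in> shellpm n"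
  have kM: "k \<in> Mset" using k Mset_shellpm by blast
  have "\<bar>vdir k $ i\<bar> \<le> 1"
    using component_le_norm_cart[of "vdir k" i] vdir_sq_Mset[OF kM] by (simp add: norm_eq_sqrt_inner)
  then have "norm (ccoef u i k) \<le> norm (coef u k)" by (simp add: ccoef_def norm_mult mult_left_le)
  then have "norm (ccoef u i k) * sqrt 3 ^ n \<le> norm (coef u k) * sqrt 3 ^ n" by (intro mult_right_mono) auto
  then show "norm (ccoef u i k) * sqrt 3 ^ n \<le> Hdot_norm s_crit u" using coef_bound[OF u k] by linarith
qed (simp add: ccoef_def coef_def)

text \<open>The component and its series have the same Fourier coefficients. This replaces u, known
  only as an L2 class, by a continuous function, so that the coefficients of the products u_j u_i
  become finite sums over triads.\<close>

lemma AE_unit_cube_ser: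
  assumes u: "u \<in> HdotM s_crit"
  shows "AE x in unit_cube. complex_of_real (u x $ i) = ser (ccoef u i) x"
proof -
  have L: "torus_L2 u" using u by (auto simp: HdotM_def Hdot_def)
  note d = decaying_ccoef[OF u, of i]
  have si: "integrable unit_cube (ser (ccoef u i))" by (intro integrable_bounded_continuous continuous_on_ser d)
  have "fzero (\<lambda>x. complex_of_real (u x $ i) - ser (ccoef u i) x)"
    unfolding fzero_def
  proof (intro conjI allI)
    show "integrable unit_cube (\<lambda>x. complex_of_real (u x $ i) - ser (ccoef u i) x)"
      using si torus_L2_integrable[OF L] by simp
    fix k
    have "(LINT x|unit_cube. (complex_of_real (u x $ i) - ser (ccoef u i) x) * echar k x)
      = fcoeff (\<lambda>x. u x $ i) (- k) - ccoef u i (- k)"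
      using integral_ser_echar[OF d, of "- k"]
      by (simp add: left_diff_distrib fcoeff_echar integrable_fcoeff torus_L2_integrable[OF L] integrable_echar_mult[OF si])
    then show "(LINT x|unit_cube. (complex_of_real (u x $ i) - ser (ccoef u i) x) * echar k x) = 0"
      using fcoeff_coef[OF u] by (simp add: ccoef_def)
  qed
  from fzero_AE[OF this] show ?thesis by simp
qed

section \<open>From the unit cube to the whole space\<close>

lemma rvec_inner_rvec: "rvec k \<bullet> rvec l \<in> \<int>"
  by (simp add: inner3 rvec_def)

lemma echar_periodic: "echar k (x + rvec l) = echar k x"
proof -
  obtain m where m: "rvec k \<bullet> rvec l = of_int m" using rvec_inner_rvec[of k l] by (auto elim: Ints_cases)
  have "echar k (x + rvec l) = echar k x * exp (2 * of_real pi * \<i> * of_int m)"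
    by (simp add: echar_def inner_add_right m distrib_left exp_add)
  moreover have "exp (2 * complex_of_real pi * \<i> * of_int m) = 1"
    using exp_integer_2pi[of "of_int m"] by (simp add: mult_ac)
  ultimately show ?thesis by simp
qed

lemma ser_periodic: "ser c (x + rvec l) = ser c x"
  by (simp add: ser_def echar_periodic)

text \<open>The exceptional set is covered by countably many integer translates of its null part in
  the unit cube.\<close>

lemma AE_periodic:
  assumes per: "\<And>x k. P (x + rvec k) \<longleftrightarrow> P x" and ae: "AE x in unit_cube. P x"
  shows "AE x in lebesgue. P x"
proof -
  have "AE x in lebesgue. x \<in> cbox 0 (1::real^3) \<longrightarrow> P x" using ae by (simp add: AE_restrict_space_iff)
  then obtain M where "{x \<in> space lebesgue. \<not> (x \<in> cbox 0 (1::real^3) \<longrightarrow> P x)} \<subseteq> M"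
    "emeasure lebesgue M = 0" "M \<in> sets lebesgue" by (rule AE_E)
  then have "negligible M" "{x \<in> cbox 0 1. \<not> P x} \<subseteq> M"
    unfolding negligible_iff_null_sets by auto
  then have N: "negligible {x \<in> cbox 0 1. \<not> P x}" by (rule negligible_subset)
  have "{x. \<not> P x} \<subseteq> (\<Union>k. (\<lambda>x. rvec k + x) ` {x \<in> cbox 0 1. \<not> P x})"
  proof
    fix x assume x: "x \<in> {x. \<not> P x}"
    define k :: "int^3" where "k = (\<chi> i. \<lfloor>x $ i\<rfloor>)"
    have "0 \<le> x $ i - of_int \<lfloor>x $ i\<rfloor> \<and> x $ i - of_int \<lfloor>x $ i\<rfloor> \<le> 1" for i by linarith
    then have "x - rvec k \<in> cbox 0 1"
      by (simp add: mem_box_cart k_def rvec_def)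
    moreover have "\<not> P (x - rvec k)" using x per[of "x - rvec k" k] by simp
    ultimately show "x \<in> (\<Union>k. (\<lambda>x. rvec k + x) ` {x \<in> cbox 0 1. \<not> P x})"
      by (intro UN_I[of k] image_eqI[of _ _ "x - rvec k"]) auto
  qed
  moreover have "negligible (\<Union>k. (\<lambda>x. rvec k + x) ` {x \<in> cbox 0 1. \<not> P x})"
    by (intro negligible_countable_Union) (auto intro: negligible_translation N)
  ultimately have "negligible {x. \<not> P x}" using negligible_subset by blast
  then show ?thesis
    unfolding negligible_iff_null_sets using AE_not_in by fastforce
qed

lemma AE_ser:
  assumes u: "u \<in> HdotM s_crit"
  shows "AE x in lebesgue. \<forall>i. complex_of_real (u x $ i) = ser (ccoef u i) x"
proof (rule AE_periodic)
  show "(\<forall>i. complex_of_real (u (x + rvec k) $ i) = ser (ccoef u i) (x + rvec k)) \<longleftrightarrow>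
     (\<forall>i. complex_of_real (u x $ i) = ser (ccoef u i) x)" for x k
    using u by (simp add: HdotM_def Hdot_def torus_L2_def ser_periodic)
  show "AE x in unit_cube. \<forall>i. complex_of_real (u x $ i) = ser (ccoef u i) x"
    by (intro eventually_all_finite AE_unit_cube_ser u)
qed

lemma coef_minus: "coef u (- k) = cnj (coef u k)"
proof -
  have "- k \<in> Mset \<longleftrightarrow> k \<in> Mset" by (auto simp: Mset_iff)
  then show ?thesis by (simp add: coef_def vdir_minus fhat_def fcoeff_minus)
qed

lemma fcoeff_product:
  assumes u: "u \<in> HdotM s_crit" and k: "k \<in> Mshell n"
  shows "fcoeff (\<lambda>x. u x $ j * u x $ i) k =
    (\<Sum>(a, b) | a \<in> Mset \<and> b \<in> Mset \<and> a + b = k. ccoef u j a * ccoef u i b)"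
proof -
  have L: "torus_L2 u" using u by (auto simp: HdotM_def Hdot_def)
  have m: "(\<lambda>x. u x $ i) \<in> borel_measurable unit_cube" for i
    by (intro measurable_restrict_space1 torus_L2_measurable L)
  have "fcoeff (\<lambda>x. u x $ j * u x $ i) k = (LINT x|unit_cube. ser (ccoef u j) x * ser (ccoef u i) x * echar (- k) x)"
    unfolding fcoeff_echar
  proof (rule integral_cong_AE)
    show "(\<lambda>x. complex_of_real (u x $ j * u x $ i) * echar (- k) x) \<in> borel_measurable unit_cube"
      using m[of i] m[of j]
      by (intro borel_measurable_times continuous_measurable_unit_cube[OF continuous_on_echar] borel_measurable_of_real)
        auto
    show "(\<lambda>x. ser (ccoef u j) x * ser (ccoef u i) x * echar (- k) x) \<in> borel_measurable unit_cube"
      by (intro continuous_measurable_unit_cube continuous_intros continuous_on_ser decaying_ccoef u)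
    show "AE x in unit_cube. complex_of_real (u x $ j * u x $ i) * echar (- k) x =
       ser (ccoef u j) x * ser (ccoef u i) x * echar (- k) x"
      using AE_unit_cube_ser[OF u, of i] AE_unit_cube_ser[OF u, of j] by eventually_elim simp
  qed
  also have "\<dots> = (\<Sum>(a, b) | a \<in> Mset \<and> b \<in> Mset \<and> a + b = k. ccoef u j a * ccoef u i b)"
    by (rule integral_ser_mult[OF decaying_ccoef[OF u] decaying_ccoef[OF u] k])
  finally show ?thesis .
qed

text \<open>The coordinate of the convection term along v^k, see \<open>convection_coef\<close>. The
  conjugates stand for the coefficients at negative frequencies; only positive shells then occur, so
  the system closes on them. Shell 0 receives nothing from below.\<close>

definition shell_nonlin :: "(int^3 \<Rightarrow> complex) \<Rightarrow> nat \<Rightarrow> int^3 \<Rightarrow> complex" where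
  "shell_nonlin c n k = 2 * of_real pi * \<i> *
    ((case n of 0 \<Rightarrow> 0 | Suc m \<Rightarrow> of_real (Kn m) * (\<Sum>(a, b)\<in>sum_pairs m k. c a * c b))
     + of_real (Kn n) * (\<Sum>(a, b)\<in>diff_pairs n k. c a * cnj (c b)))"

lemma sum_swap3:
  "(\<Sum>i\<in>A. \<Sum>j\<in>B. \<Sum>p\<in>C. g i j p) = (\<Sum>p\<in>C. \<Sum>i\<in>A. \<Sum>j\<in>B. g i j p)"
proof -
  have "(\<Sum>i\<in>A. \<Sum>j\<in>B. \<Sum>p\<in>C. g i j p) = (\<Sum>i\<in>A. \<Sum>p\<in>C. \<Sum>j\<in>B. g i j p)"
    by (intro sum.cong refl sum.swap)
  also have "\<dots> = (\<Sum>p\<in>C. \<Sum>i\<in>A. \<Sum>j\<in>B. g i j p)" by (rule sum.swap)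
  finally show ?thesis .
qed

text \<open>The sum over j produces k . v^a and the sum over i produces v^k . v^b. Of the two orders
  of a mixed pair one vanishes by \<open>triad_down1\<close>, the other has coefficient
  \<open>Kn n\<close> by \<open>triad_down2\<close>.\<close>

lemma convection_coef:
  assumes u: "u \<in> HdotM s_crit" and k: "k \<in> Mshell n"
  shows "(\<Sum>i\<in>UNIV. complex_of_real (vdir k $ i) * convection u k $ i) = shell_nonlin (coef u) n k"
proof -
  let ?T = "{(a, b). a \<in> Mset \<and> b \<in> Mset \<and> a + b = k}"
  let ?F = "\<lambda>a b. coef u a * coef u b * of_real ((rvec k \<bullet> vdir a) * (vdir k \<bullet> vdir b))"
  have "(\<Sum>i\<in>UNIV. complex_of_real (vdir k $ i) * convection u k $ i) =
    2 * of_real pi * \<i> * (\<Sum>i\<in>UNIV. \<Sum>j\<in>UNIV. \<Sum>(a, b)\<in>?T.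
      complex_of_real (vdir k $ i) * complex_of_int (k $ j) * (ccoef u j a * ccoef u i b))"
    unfolding convection_def fcoeff_product[OF u k]
    by (simp add: sum_distrib_left case_prod_unfold mult_ac)
  also have "(\<Sum>i\<in>UNIV. \<Sum>j\<in>UNIV. \<Sum>(a, b)\<in>?T.
      complex_of_real (vdir k $ i) * complex_of_int (k $ j) * (ccoef u j a * ccoef u i b))
    = (\<Sum>(a, b)\<in>?T. ?F a b)"
  proof -
    have "(\<Sum>i\<in>UNIV. \<Sum>j\<in>UNIV. \<Sum>(a, b)\<in>?T.
      complex_of_real (vdir k $ i) * complex_of_int (k $ j) * (ccoef u j a * ccoef u i b))
      = (\<Sum>(a, b)\<in>?T. \<Sum>i\<in>UNIV. \<Sum>j\<in>UNIV.
      complex_of_real (vdir k $ i) * complex_of_int (k $ j) * (ccoef u j a * ccoef u i b))"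
      unfolding case_prod_unfold by (rule sum_swap3)
    also have "\<dots> = (\<Sum>(a, b)\<in>?T. ?F a b)"
    proof -
      have "(\<Sum>i\<in>UNIV. \<Sum>j\<in>UNIV. complex_of_real (vdir k $ i) * complex_of_int (k $ j) * (ccoef u j a * ccoef u i b))
        = coef u a * coef u b * ((\<Sum>j\<in>UNIV. of_real (rvec k $ j) * of_real (vdir a $ j)) *
          (\<Sum>i\<in>UNIV. of_real (vdir k $ i) * of_real (vdir b $ i)))" for a b
        unfolding ccoef_def sum_product unfolding sum_distrib_left
        by (subst sum.swap) (intro sum.cong refl, simp add: rvec_def)
      then show ?thesis
        unfolding cvec_dot by (simp only: of_real_mult)
    qed
    finally show ?thesis .
  qed
  also have "(\<Sum>(a, b)\<in>?T. ?F a b) = (case n of 0 \<Rightarrow> 0 | Suc m \<Rightarrow> (\<Sum>(a, b)\<in>sum_pairs m k. ?F a b)) +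
    (\<Sum>(a, b)\<in>diff_pairs n k. ?F a (- b) + ?F (- b) a)"
    by (rule sum_triads[OF k])
  also have "(case n of 0 \<Rightarrow> 0 | Suc m \<Rightarrow> (\<Sum>(a, b)\<in>sum_pairs m k. ?F a b)) =
    (case n of 0 \<Rightarrow> 0 | Suc m \<Rightarrow> of_real (Kn m) * (\<Sum>(a, b)\<in>sum_pairs m k. coef u a * coef u b))"
  proof (cases n)
    case (Suc m)
    have "?F a b = of_real (Kn m) * (coef u a * coef u b)" if "a \<in> Mshell m" "b \<in> Mshell m" "a + b = k" for a b
      using triad_up[of a m b] that k Suc by (simp add: mult_ac)
    then show ?thesis unfolding Suc by (auto simp: sum_distrib_left intro!: sum.cong)
  qed simp
  also have "(\<Sum>(a, b)\<in>diff_pairs n k. ?F a (- b) + ?F (- b) a) =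
    of_real (Kn n) * (\<Sum>(a, b)\<in>diff_pairs n k. coef u a * coef u (- b))"
  proof -
    have "?F a (- b) + ?F (- b) a = of_real (Kn n) * (coef u a * coef u (- b))"
      if "a \<in> Mshell (Suc n)" "b \<in> Mshell n" "k + b = a" for a b
    proof -
      have "rvec k \<bullet> vdir a = 0" using triad_down1[of k n b] that k by simp
      moreover have "(rvec k \<bullet> vdir (- b)) * (vdir k \<bullet> vdir a) = Kn n"
        using triad_down2[of k n b] that k by (simp add: vdir_minus)
      ultimately show ?thesis by (simp only:) simp
    qed
    then show ?thesis by (auto simp: sum_distrib_left intro!: sum.cong)
  qed
  finally show ?thesis by (simp add: shell_nonlin_def coef_minus)
qed

section \<open>Symmetries\<close>

text \<open>The preimage of a null set under T is contained in its image under S, and linear maps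
  send null sets to null sets.\<close>

lemma AE_linear_inverse:
  fixes T S :: "real^3 \<Rightarrow> real^3"
  assumes ae: "AE x in lebesgue. P x" and S: "linear S" and ST: "\<And>x. S (T x) = x"
  shows "AE x in lebesgue. P (T x)"
proof -
  obtain M where "{x \<in> space lebesgue. \<not> P x} \<subseteq> M" "emeasure lebesgue M = 0" "M \<in> sets lebesgue"
    using ae by (rule AE_E)
  then have M: "negligible M" "{x. \<not> P x} \<subseteq> M"
    unfolding negligible_iff_null_sets by auto
  then have "negligible (S ` M)" 
    using S by (intro negligible_differentiable_image_negligible) (auto simp: linear_imp_differentiable_on)
  moreover have "{x. \<not> P (T x)} \<subseteq> S ` M"
    using M(2) ST by (metis (mono_tags, lifting) image_eqI mem_Collect_eq subset_iff)
  ultimately have "negligible {x. \<not> P (T x)}" by (rule negligible_subset)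
  then show ?thesis
    unfolding negligible_iff_null_sets using AE_not_in by fastforce
qed

section \<open>Permutations and the mirror acting on frequencies and directions\<close>

lemma linear_perm_vec: "linear (perm_vec p :: real^3 \<Rightarrow> real^3)"
  by (intro linearI) (simp_all add: perm_vec_def vec_eq_iff)

lemma perm_vec_inv:
  assumes "p permutes UNIV"
  shows "perm_vec (inv p) (perm_vec p x) = x"
  by (simp add: perm_vec_def vec_eq_iff permutes_inverses[OF assms])

lemma perm_vec_inner:
  fixes x y :: "real^3"
  assumes "p permutes UNIV"
  shows "perm_vec p x \<bullet> perm_vec p y = x \<bullet> y"
  using sum.permute[OF assms, of "\<lambda>i. x $ i * y $ i"] by (simp add: inner_vec_def perm_vec_def o_def)

lemma rvec_perm_vec: "rvec (perm_vec p k) = perm_vec p (rvec k)"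
  by (simp add: rvec_def perm_vec_def)

lemma perm_vec_sigma: "perm_vec p sigma = sigma"
proof -
  have "sigma $ i = 1" for i using exhaust_3[of i] by (auto simp: sigma_def)
  then show ?thesis by (simp add: perm_vec_def vec_eq_iff)
qed

text \<open>An isometry that maps sigma to e sigma, with e = 1 or e = -1, commutes with the
  construction of v^k up to the sign e. Permutations have e = 1, the mirror has e = -1.\<close>

lemma vdir_isometry:
  assumes L: "linear L" "\<And>x y. L x \<bullet> L y = x \<bullet> y" and s: "L sigma = e *\<^sub>R sigma" and e: "e\<^sup>2 = (1::real)"
    and k: "rvec k' = L (rvec k)"
  shows "vdir k' = e *\<^sub>R L (vdir k)"
proof -
  have n: "norm (L x) = norm x" for x by (simp add: norm_eq_sqrt_inner L(2))
  have ee: "e * e = 1" using e by (simp add: power2_eq_square)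
  have "L (rvec k) \<bullet> L sigma = rvec k \<bullet> sigma" by (rule L(2))
  then have "e * (L (rvec k) \<bullet> sigma) = rvec k \<bullet> sigma" by (simp add: s)
  then have "e * e * (L (rvec k) \<bullet> sigma) = e * (rvec k \<bullet> sigma)" by simp
  then have ks: "L (rvec k) \<bullet> sigma = e * (rvec k \<bullet> sigma)" by (simp add: ee)
  have "e *\<^sub>R L (Pperp_sigma k) = (e * e) *\<^sub>R sigma - (e * (rvec k \<bullet> sigma) / (norm (rvec k))\<^sup>2) *\<^sub>R L (rvec k)"
    by (simp add: Pperp_sigma_def linear_diff[OF L(1)] linear_scale[OF L(1)] s scaleR_diff_right)
  then have P: "Pperp_sigma k' = e *\<^sub>R L (Pperp_sigma k)"
    by (simp add: ee) (simp add: Pperp_sigma_def k n ks)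
  have "\<bar>e\<bar> = 1" using e by (simp add: abs_square_eq_1)
  then have "norm (Pperp_sigma k') = norm (Pperp_sigma k)" by (simp add: P n)
  then show ?thesis by (simp add: vdir_def P linear_scale[OF L(1)])
qed

lemma vdir_perm_vec: "p permutes UNIV \<Longrightarrow> vdir (perm_vec p k) = perm_vec p (vdir k)"
  using vdir_isometry[of "perm_vec p" 1 "perm_vec p k" k]
  by (simp add: linear_perm_vec perm_vec_inner rvec_perm_vec perm_vec_sigma)

lemma linear_mirror: "linear mirror"
  by (intro linearI) (simp_all add: mirror_def vec3_eq_iff inner3 sigma_def field_simps)

lemma mirror_inner: "mirror x \<bullet> mirror y = x \<bullet> y"
  by (simp add: mirror_def inner3 sigma_def field_simps)

lemma mirror_mirror: "mirror (mirror x) = x"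
  by (simp add: mirror_def vec3_eq_iff inner3 sigma_def field_simps)

lemma mirror_sigma: "mirror sigma = (- 1) *\<^sub>R sigma"
  by (simp add: mirror_def vec3_eq_iff inner3 sigma_def)

text \<open>The mirror as a map of integer vectors. The division by 3 is exact on the frequency set,
  where \<open>csum\<close> is a multiple of 3.\<close>

definition mir :: "int^3 \<Rightarrow> int^3" where
  "mir k = (\<chi> i. k $ i - 2 * (csum k div 3))"

lemma mir_Mshell: "k \<in> Mshell n \<Longrightarrow> mir k = - flip_shell n k"
  by (simp add: mir_def flip_shell_def csum_Mshell vec_eq_iff)

lemma csum_shellpm: "k \<in> shellpm n \<Longrightarrow> 3 dvd csum k"
  using csum_Mshell[of k n] csum_Mshell[of "- k" n] by (auto simp: mem_shellpm csum_minus)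
    (metis dvd_minus_iff dvd_triv_left)

lemma csum_mir: "3 dvd csum k \<Longrightarrow> csum (mir k) = - csum k"
  by (auto simp: mir_def csum_def elim!: dvdE)

lemma mir_mir: "3 dvd csum k \<Longrightarrow> mir (mir k) = k"
proof -
  assume k: "3 dvd csum k"
  then obtain m where m: "csum k = 3 * m" by (auto elim: dvdE)
  have "csum (mir k) = 3 * (- m)" using csum_mir[OF k] m by simp
  then have "csum (mir k) div 3 = - m" by simp
  then show ?thesis using m unfolding mir_def[of "mir k"] by (simp add: mir_def vec_eq_iff)
qed

lemma mir_minus: "3 dvd csum k \<Longrightarrow> mir (- k) = - mir k"
  by (auto simp: mir_def csum_minus vec_eq_iff elim!: dvdE)

lemma mir_shellpm: "k \<in> shellpm n \<Longrightarrow> mir k \<in> shellpm n"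
proof -
  assume k: "k \<in> shellpm n"
  then consider "k \<in> Mshell n" | "- k \<in> Mshell n" by (auto simp: mem_shellpm)
  then show ?thesis
  proof cases
    case 1
    then show ?thesis using flip_shell_Mshell by (simp add: mem_shellpm mir_Mshell)
  next
    case 2
    have "mir k = flip_shell n (- k)" using mir_minus[of k] csum_shellpm[OF k] mir_Mshell[OF 2] by simp
    then show ?thesis using flip_shell_Mshell[OF 2] by (simp add: mem_shellpm)
  qed
qed

lemma rvec_mir:
  assumes "3 dvd csum k"
  shows "rvec (mir k) = mirror (rvec k)"
proof -
  obtain m where m: "csum k = 3 * m" using assms by (auto elim: dvdE)
  have "sigma \<bullet> rvec k = of_int (csum k)" by (simp add: inner3 sigma_def rvec_def csum_def)
  then show ?thesis by (simp add: m mirror_def mir_def rvec_def vec3_eq_iff sigma_def)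
qed

lemma vdir_mir: "3 dvd csum k \<Longrightarrow> vdir (mir k) = - mirror (vdir k)"
  using vdir_isometry[of mirror "- 1" "mir k" k] linear_mirror mirror_inner mirror_sigma rvec_mir[of k] by simp

section \<open>Symmetries of a field as symmetries of its coefficients\<close>

lemma ser_compose:
  assumes bij: "\<And>n. bij_betw \<phi> (shellpm n) (shellpm n)"
    and e: "\<And>k x. k \<in> Mset \<Longrightarrow> echar (\<phi> k) (T x) = echar k x"
  shows "ser c (T x) = ser (\<lambda>k. if k \<in> Mset then c (\<phi> k) else 0) x"
proof -
  have "(\<Sum>k\<in>shellpm n. c k * echar k (T x)) = (\<Sum>k\<in>shellpm n. (if k \<in> Mset then c (\<phi> k) else 0) * echar k x)" for n
  proof -
    have "(\<Sum>k\<in>shellpm n. c k * echar k (T x)) = (\<Sum>k\<in>shellpm n. c (\<phi> k) * echar (\<phi> k) (T x))"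
      by (rule sum.reindex_bij_betw[OF bij, symmetric])
    also have "\<dots> = (\<Sum>k\<in>shellpm n. (if k \<in> Mset then c (\<phi> k) else 0) * echar k x)"
      using e by (intro sum.cong refl) (auto simp: Mset_shellpm)
    finally show ?thesis .
  qed
  then show ?thesis by (simp add: ser_def)
qed

lemma decaying_compose:
  assumes c: "decaying c" and bij: "\<And>n. bij_betw \<phi> (shellpm n) (shellpm n)"
  shows "decaying (\<lambda>k. if k \<in> Mset then c (\<phi> k) else 0)"
proof -
  obtain B where B: "\<forall>n. \<forall>k\<in>shellpm n. norm (c k) * sqrt 3 ^ n \<le> B" using c by (auto simp: decaying_def)
  have *: "norm (if k \<in> Mset then c (\<phi> k) else 0) * sqrt 3 ^ n \<le> B" if "k \<in> shellpm n" for n k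
    using B bij_betwE[OF bij] that Mset_shellpm by auto
  show ?thesis unfolding decaying_def
    by (intro conjI allI impI exI[of _ B] ballI *) simp_all
qed

text \<open>Common to all three symmetries. Substituting T reindexes the series by \<phi>, so
  comparing coefficients gives c(\<phi> k) v^(\<phi> k) = c(k) L v^k. The right side is e c(k)
  v^(\<phi> k), and the inner product with this unit vector yields the sign.\<close>

lemma coef_symmetry:
  assumes u: "u \<in> HdotM s_crit" and sym: "AE x in lebesgue. u (T x) = L (u x)"
    and S: "linear S" "\<And>x. S (T x) = x" and L: "linear L"
    and bij: "\<And>n. bij_betw \<phi> (shellpm n) (shellpm n)"
    and ech: "\<And>k x. k \<in> Mset \<Longrightarrow> echar (\<phi> k) (T x) = echar k x"
    and v: "\<And>k. k \<in> Mset \<Longrightarrow> vdir (\<phi> k) = e *\<^sub>R L (vdir k)" and e: "e\<^sup>2 = (1::real)"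
    and k: "k \<in> Mset"
  shows "coef u (\<phi> k) = e * coef u k"
proof -
  have ee: "e * e = 1" using e by (simp add: power2_eq_square)
  \<comment> \<open>Outside the frequency set \<phi> is unconstrained and may lead into it, so the
    reindexed family has to be cut off there.\<close>
  define c' where "c' i k = (if k \<in> Mset then ccoef u i (\<phi> k) else 0)" for i k
  have dec: "decaying (c' i)" for i
    unfolding c'_def by (rule decaying_compose[OF decaying_ccoef[OF u] bij])
  have Lx: "L y $ i = (\<Sum>j\<in>UNIV. L (axis j 1) $ i * y $ j)" for y i
  proof -
    have "y = (\<Sum>j\<in>UNIV. y $ j *\<^sub>R axis j 1)" by (simp add: vec_eq_iff axis_def if_distrib cong: if_cong)
    then have "L y = L (\<Sum>j\<in>UNIV. y $ j *\<^sub>R axis j 1)" by simp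
    then show ?thesis by (simp add: linear_sum[OF L] linear_scale[OF L] mult.commute)
  qed
  have AE': "AE x in lebesgue. \<forall>i. ser (c' i) x = (\<Sum>j\<in>UNIV. of_real (L (axis j 1) $ i) * ser (ccoef u j) x)"
    using sym AE_ser[OF u] AE_linear_inverse[OF AE_ser[OF u] S]
  proof eventually_elim
    case (elim x)
    show ?case
    proof
      fix i
      have "ser (c' i) x = ser (ccoef u i) (T x)"
        unfolding c'_def by (rule ser_compose[OF bij ech, symmetric])
      also have "\<dots> = complex_of_real (L (u x) $ i)" using elim by metis
      also have "\<dots> = (\<Sum>j\<in>UNIV. of_real (L (axis j 1) $ i) * complex_of_real (u x $ j))"
        by (subst Lx) simp
      finally show "ser (c' i) x = (\<Sum>j\<in>UNIV. of_real (L (axis j 1) $ i) * ser (ccoef u j) x)"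
        using elim by simp
    qed
  qed
  have eq: "ccoef u i (\<phi> k) = (\<Sum>j\<in>UNIV. of_real (L (axis j 1) $ i) * ccoef u j k)" for i
  proof -
    have I: "integrable unit_cube (\<lambda>x. ser (ccoef u j) x * echar (- k) x)" for j
      by (intro integrable_bounded_continuous continuous_intros continuous_on_ser decaying_ccoef u)
    have "ccoef u i (\<phi> k) = (LINT x|unit_cube. ser (c' i) x * echar (- k) x)"
      using integral_ser_echar[OF dec, of i k] k by (simp add: c'_def)
    also have "\<dots> = (LINT x|unit_cube. (\<Sum>j\<in>UNIV. of_real (L (axis j 1) $ i) * (ser (ccoef u j) x * echar (- k) x)))"
    proof (rule integral_cong_AE)
      show "AE x in unit_cube. ser (c' i) x * echar (- k) x =
          (\<Sum>j\<in>UNIV. of_real (L (axis j 1) $ i) * (ser (ccoef u j) x * echar (- k) x))"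
        using AE' by (simp add: AE_restrict_space_iff)
          (auto elim!: eventually_mono simp: sum_distrib_right mult.assoc)
    qed (intro continuous_measurable_unit_cube continuous_intros continuous_on_ser dec decaying_ccoef u)+
    also have "\<dots> = (\<Sum>j\<in>UNIV. of_real (L (axis j 1) $ i) * ccoef u j k)"
      using I by (simp add: integral_ser_echar[OF decaying_ccoef[OF u]])
    finally show ?thesis .
  qed
  have phiM: "\<phi> k \<in> Mset" using k bij_betwE[OF bij] Mset_shellpm by blast
  have "coef u (\<phi> k) * vdir (\<phi> k) $ i = coef u k * e * vdir (\<phi> k) $ i" for i
  proof -
    have "coef u (\<phi> k) * vdir (\<phi> k) $ i = coef u k * of_real (\<Sum>j\<in>UNIV. L (axis j 1) $ i * vdir k $ j)"
      using eq[of i] by (simp add: ccoef_def sum_distrib_left mult_ac)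
    also have "(\<Sum>j\<in>UNIV. L (axis j 1) $ i * vdir k $ j) = L (vdir k) $ i" by (rule Lx[symmetric])
    also have "\<dots> = e * vdir (\<phi> k) $ i" using ee by (simp add: v[OF k] flip: mult.assoc)
    finally show ?thesis by simp
  qed
  then have "(\<Sum>i\<in>UNIV. coef u (\<phi> k) * vdir (\<phi> k) $ i * vdir (\<phi> k) $ i) =
      (\<Sum>i\<in>UNIV. coef u k * e * vdir (\<phi> k) $ i * vdir (\<phi> k) $ i)" by (simp only:)
  then have "coef u (\<phi> k) * of_real (vdir (\<phi> k) \<bullet> vdir (\<phi> k)) = coef u k * e * of_real (vdir (\<phi> k) \<bullet> vdir (\<phi> k))"
    by (simp only: mult.assoc sum_distrib_left[symmetric] cvec_dot)
  then show ?thesis using vdir_sq_Mset[OF phiM] by (simp add: mult.commute)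
qed

lemma echar_linear:
  assumes "rvec k' \<bullet> T x = rvec k \<bullet> x"
  shows "echar k' (T x) = echar k x"
  using assms by (simp add: echar_def)

lemma perm_vec_shellpm:
  assumes p: "p permutes UNIV"
  shows "bij_betw (perm_vec p) (shellpm n) (shellpm n)"
proof (rule bij_betw_byWitness[where f' = "perm_vec (inv p)"])
  have m: "perm_vec q k \<in> shellpm n" if "q permutes UNIV" "k \<in> shellpm n" for q k
  proof -
    have "- perm_vec q k = perm_vec q (- k)" by (simp add: perm_vec_def vec_eq_iff)
    then show ?thesis using that perm_vec_Mshell by (auto simp: mem_shellpm)
  qed
  show "perm_vec p ` shellpm n \<subseteq> shellpm n" "perm_vec (inv p) ` shellpm n \<subseteq> shellpm n"
    using m p permutes_inv[OF p] by auto
  show "\<forall>a\<in>shellpm n. perm_vec (inv p) (perm_vec p a) = a"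
    using perm_vec_inv[OF p] by auto
  show "\<forall>a\<in>shellpm n. perm_vec p (perm_vec (inv p) a) = a"
    using perm_vec_inv[OF permutes_inv[OF p]] permutes_inv_inv[OF p] by auto
qed

lemma coef_odd:
  assumes "u \<in> HdotM s_crit" "odd_field u" "k \<in> Mset"
  shows "coef u (- k) = - coef u k"
proof -
  have "coef u (- k) = of_real (- 1) * coef u k"
  proof (rule coef_symmetry[where T = uminus and S = uminus and L = uminus, OF assms(1)])
    show "AE x in lebesgue. u (- x) = - u x" using assms(2) by (simp add: odd_field_def)
    show "bij_betw uminus (shellpm n) (shellpm n)" for n
      by (rule bij_betw_byWitness[where f' = uminus]) (auto simp: mem_shellpm)
  qed (auto simp: assms(3) vdir_minus rvec_minus linear_uminus intro: echar_linear)
  then show ?thesis by simp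
qed

lemma coef_perm:
  assumes "u \<in> HdotM s_crit" "perm_symmetric u" "k \<in> Mset" and p: "p permutes UNIV"
  shows "coef u (perm_vec p k) = coef u k"
proof -
  have "coef u (perm_vec p k) = of_real 1 * coef u k"
  proof (rule coef_symmetry[where T = "perm_vec p" and S = "perm_vec (inv p)" and L = "perm_vec p", OF assms(1)])
    show "AE x in lebesgue. u (perm_vec p x) = perm_vec p (u x)" using assms(2) p by (simp add: perm_symmetric_def)
  qed (auto simp: assms(3) linear_perm_vec perm_vec_inv[OF p] vdir_perm_vec[OF p] rvec_perm_vec perm_vec_inner[OF p]
      intro: echar_linear perm_vec_shellpm[OF p])
  then show ?thesis by simp
qed

lemma coef_mir:
  assumes "u \<in> HdotM s_crit" "mirror_symmetric u" "k \<in> Mset"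
  shows "coef u (mir k) = - coef u k"
proof -
  have c3: "3 dvd csum k" if "k \<in> Mset" for k using that csum_shellpm by (auto simp: Mset_shellpm)
  have "coef u (mir k) = of_real (- 1) * coef u k"
  proof (rule coef_symmetry[where T = mirror and S = mirror and L = mirror, OF assms(1)])
    have "AE x in lebesgue. u x = mirror (u (mirror x))" using assms(2) by (simp add: mirror_symmetric_def)
    then show "AE x in lebesgue. u (mirror x) = mirror (u x)"
      by eventually_elim (metis mirror_mirror)
    show "bij_betw mir (shellpm n) (shellpm n)" for n
      using mir_mir csum_shellpm mir_shellpm by (intro bij_betw_byWitness[where f' = mir]) blast+
    show "echar (mir k) (mirror x) = echar k x" if "k \<in> Mset" for k x
      using rvec_mir[OF c3[OF that]] by (intro echar_linear) (simp add: mirror_inner)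
  qed (auto simp: assms(3) linear_mirror mirror_mirror vdir_mir c3)
  then show ?thesis by simp
qed

lemma Mshell_nonempty: "\<exists>k. k \<in> Mshell n"
  using card_Mshell[of n] by (metis card.empty ex_in_conv zero_neq_numeral)

text \<open>Oddness together with reality makes each coefficient the negative of its conjugate,
  hence imaginary. The signs from oddness and the mirror cancel in \<open>flip_shell\<close>, so the
  coefficients are invariant under it as well as under permutations, and
  \<open>Mshell_invariant\<close> applies.\<close>

theorem symmetric_coef:
  assumes u: "u \<in> HdotM s_crit" and "odd_field u" "perm_symmetric u" "mirror_symmetric u"
  shows "\<exists>\<psi> :: nat \<Rightarrow> real. \<forall>n. \<forall>k\<in>Mshell n. coef u k = \<i> * \<psi> n"
proof -
  have M: "k \<in> Mset" if "k \<in> Mshell n" for k n using that by (auto simp: Mset_iff)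
  define \<psi> where "\<psi> n = Im (coef u (SOME k. k \<in> Mshell n))" for n
  have inv: "coef u k = coef u k'" if k: "k \<in> Mshell n" "k' \<in> Mshell n" for n k k'
  proof (rule Mshell_invariant[OF k])
    show "coef u (perm_vec p k) = coef u k" if "p permutes UNIV" "k \<in> Mshell n" for p k
      using coef_perm assms that M by blast
    show "coef u (flip_shell n k) = coef u k" if k: "k \<in> Mshell n" for k
      using coef_odd[OF u assms(2), of "flip_shell n k"] coef_mir[OF u assms(4) M[OF k]] mir_Mshell[OF k]
        M[OF flip_shell_Mshell[OF k]] by simp
  qed
  have "coef u k = \<i> * \<psi> n" if k: "k \<in> Mshell n" for n k
  proof -
    have "coef u k = coef u (SOME k. k \<in> Mshell n)" using inv[OF k] someI_ex[OF Mshell_nonempty] by blast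
    moreover have "cnj (coef u k) = - coef u k" using coef_odd[OF u assms(2) M[OF k]] coef_minus by metis
    then have "Re (coef u k) = 0" by (metis Re_divide_numeral cnj.simps(1) complex_cnj neg_equal_zero uminus_complex.simps(1))
    ultimately show ?thesis by (simp add: complex_eq_iff \<psi>_def)
  qed
  then show ?thesis by blast
qed

section \<open>The sine expansion and its symmetries\<close>

lemma shell_field_bound: "norm (shell_field n x) \<le> 6"
proof -
  have "norm (shell_field n x) \<le> (\<Sum>k\<in>Mshell n. 1)"
    unfolding shell_field_def
  proof (rule sum_norm_le)
    fix k assume "k \<in> Mshell n"
    then have "norm (vdir k) = 1" using vdir_unit[of k n] by (simp add: norm_eq_sqrt_inner)
    then show "norm (sin (2 * pi * (rvec k \<bullet> x)) *\<^sub>R vdir k) \<le> 1" by simp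
  qed
  then show ?thesis by (simp add: card_Mshell)
qed

lemma summable_shell_fields:
  assumes "\<And>n. \<bar>a n\<bar> * sqrt 3 ^ n \<le> B"
  shows "summable (\<lambda>n. a n *\<^sub>R shell_field n x)"
proof (rule summable_comparison_test'[OF summable_inv_sqrt3[of "6 * B"]])
  fix n
  have le: "\<bar>a n\<bar> \<le> B * (1 / sqrt 3) ^ n" using assms[of n] by (simp add: field_simps)
  have "\<bar>a n\<bar> * norm (shell_field n x) \<le> (B * (1 / sqrt 3) ^ n) * 6"
    by (rule mult_mono[OF le shell_field_bound order_trans[OF abs_ge_zero le] norm_ge_zero])
  then show "norm (a n *\<^sub>R shell_field n x) \<le> 6 * B * (1 / sqrt 3) ^ n" by (simp add: mult_ac)
qed

lemma echar_sin: "echar k x - echar (- k) x = 2 * \<i> * of_real (sin (2 * pi * (rvec k \<bullet> x)))"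
proof -
  have "echar k x = cis (2 * pi * (rvec k \<bullet> x))" by (simp add: echar_def cis_conv_exp mult_ac)
  moreover have "echar (- k) x = cis (- (2 * pi * (rvec k \<bullet> x)))" by (simp add: echar_def cis_conv_exp mult_ac rvec_minus)
  ultimately show ?thesis by (simp add: complex_eq_iff)
qed

lemma psi_bound:
  assumes u: "u \<in> HdotM s_crit" and \<psi>: "\<And>n k. k \<in> Mshell n \<Longrightarrow> coef u k = \<i> * complex_of_real (\<psi> n)"
  shows "\<bar>\<psi> n\<bar> * sqrt 3 ^ n \<le> Hdot_norm s_crit u"
proof -
  obtain k where k: "k \<in> Mshell n" using Mshell_nonempty by blast
  then show ?thesis using coef_bound[OF u, of k n] by (simp add: \<psi>[OF k] mem_shellpm norm_mult)
qed

text \<open>Pairing k with -k gives \<i> \<psi> (e_k - e_(-k)) = -2 \<psi> sin (2 pi k . x), the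
  origin of the factor -2.\<close>

theorem shell_expansion_coef:
  assumes u: "u \<in> HdotM s_crit" and \<psi>: "\<And>n k. k \<in> Mshell n \<Longrightarrow> coef u k = \<i> * complex_of_real (\<psi> n)"
  shows "shell_expansion \<psi> u"
  unfolding shell_expansion_def using AE_ser[OF u]
proof eventually_elim
  case (elim x)
  have s: "summable (\<lambda>n. \<psi> n *\<^sub>R shell_field n x)" by (rule summable_shell_fields[OF psi_bound[OF u \<psi>]])
  have "u x $ i = (- 2 *\<^sub>R (\<Sum>n. \<psi> n *\<^sub>R shell_field n x)) $ i" for i
  proof -
    have "(\<Sum>k\<in>shellpm n. ccoef u i k * echar k x) = of_real (- 2 * (\<psi> n *\<^sub>R shell_field n x) $ i)" for n
    proof -
      have "(\<Sum>k\<in>shellpm n. ccoef u i k * echar k x) =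
        (\<Sum>k\<in>Mshell n. ccoef u i k * echar k x) + (\<Sum>k\<in>uminus ` Mshell n. ccoef u i k * echar k x)"
        unfolding shellpm_def by (rule sum.union_disjoint) (auto dest: Mshell_disjoint(2))
      also have "(\<Sum>k\<in>uminus ` Mshell n. ccoef u i k * echar k x) = (\<Sum>k\<in>Mshell n. ccoef u i (- k) * echar (- k) x)"
        by (subst sum.reindex) (auto simp: inj_on_def)
      also have "(\<Sum>k\<in>Mshell n. ccoef u i k * echar k x) + \<dots> =
        (\<Sum>k\<in>Mshell n. of_real (- 2 * \<psi> n * (sin (2 * pi * (rvec k \<bullet> x)) * vdir k $ i)))"
        unfolding sum.distrib[symmetric]
      proof (rule sum.cong[OF refl])
        fix k assume k: "k \<in> Mshell n"
        have "ccoef u i k * echar k x + ccoef u i (- k) * echar (- k) x =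
          \<i> * of_real (\<psi> n * vdir k $ i) * (echar k x - echar (- k) x)"
          by (simp add: ccoef_def coef_minus \<psi>[OF k] vdir_minus algebra_simps)
        then show "ccoef u i k * echar k x + ccoef u i (- k) * echar (- k) x =
          of_real (- 2 * \<psi> n * (sin (2 * pi * (rvec k \<bullet> x)) * vdir k $ i))"
          unfolding echar_sin by (simp add: complex_eq_iff)
      qed
      also have "\<dots> = of_real (- 2 * (\<psi> n *\<^sub>R shell_field n x) $ i)"
        by (simp add: shell_field_def sum_distrib_left mult.assoc)
      finally show ?thesis .
    qed
    then have "complex_of_real (u x $ i) = (\<Sum>n. of_real (- 2 * (\<psi> n *\<^sub>R shell_field n x) $ i))"
      using elim by (simp add: ser_def)
    also have "\<dots> = of_real (\<Sum>n. - 2 * (\<psi> n *\<^sub>R shell_field n x) $ i)"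
      using summable_mult[OF bounded_linear.summable[OF bounded_linear_vec_nth s], of "- 2" i]
      by (intro suminf_of_real[symmetric])
    also have "(\<Sum>n. - 2 * (\<psi> n *\<^sub>R shell_field n x) $ i) = - 2 * (\<Sum>n. (\<psi> n *\<^sub>R shell_field n x) $ i)"
      by (intro suminf_mult bounded_linear.summable[OF bounded_linear_vec_nth s])
    also have "(\<Sum>n. (\<psi> n *\<^sub>R shell_field n x) $ i) = (\<Sum>n. \<psi> n *\<^sub>R shell_field n x) $ i"
      by (rule bounded_linear.suminf[OF bounded_linear_vec_nth s, symmetric])
    finally show ?thesis by (simp only: of_real_eq_iff vector_scaleR_component) simp
  qed
  then show ?case using s by (simp add: vec_eq_iff)
qed

text \<open>The way back from the expansion to the symmetries: each shell field has them, and L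
  passes through the convergent series.\<close>

lemma shell_expansion_symmetry:
  assumes ex: "shell_expansion a u" and S: "linear S" "\<And>x. S (T x) = x" and L: "linear L"
    and f: "\<And>n x. shell_field n (T x) = L (shell_field n x)"
  shows "AE x in lebesgue. u (T x) = L (u x)"
proof -
  have bl: "bounded_linear L" using L by (simp add: linear_conv_bounded_linear)
  show ?thesis
    using ex[unfolded shell_expansion_def] AE_linear_inverse[OF ex[unfolded shell_expansion_def] S]
  proof eventually_elim
    case (elim x)
    have "u (T x) = - 2 *\<^sub>R (\<Sum>n. L (a n *\<^sub>R shell_field n x))"
      using elim by (simp add: f linear_scale[OF L])
    also have "(\<Sum>n. L (a n *\<^sub>R shell_field n x)) = L (\<Sum>n. a n *\<^sub>R shell_field n x)"
      using elim by (intro bounded_linear.suminf[OF bl, symmetric]) auto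
    finally show ?case using elim by (simp add: linear_scale[OF L] linear_neg[OF L])
  qed
qed

lemma shell_field_minus: "shell_field n (- x) = - shell_field n x"
  by (simp add: shell_field_def sum_negf)

lemma shell_field_perm:
  assumes p: "p permutes UNIV"
  shows "shell_field n (perm_vec p x) = perm_vec p (shell_field n x)"
proof -
  have bij: "bij_betw (perm_vec p) (Mshell n) (Mshell n)"
    using perm_vec_Mshell[OF p] perm_vec_Mshell[OF permutes_inv[OF p]] perm_vec_inv[OF p]
      perm_vec_inv[OF permutes_inv[OF p]] permutes_inv_inv[OF p]
    by (intro bij_betw_byWitness[where f' = "perm_vec (inv p)"]) auto
  have "shell_field n (perm_vec p x) =
    (\<Sum>k\<in>Mshell n. sin (2 * pi * (rvec (perm_vec p k) \<bullet> perm_vec p x)) *\<^sub>R vdir (perm_vec p k))"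
    unfolding shell_field_def by (rule sum.reindex_bij_betw[OF bij, symmetric])
  also have "\<dots> = (\<Sum>k\<in>Mshell n. perm_vec p (sin (2 * pi * (rvec k \<bullet> x)) *\<^sub>R vdir k))"
    by (simp add: rvec_perm_vec perm_vec_inner[OF p] vdir_perm_vec[OF p] linear_scale[OF linear_perm_vec])
  also have "\<dots> = perm_vec p (shell_field n x)"
    by (simp add: shell_field_def linear_sum[OF linear_perm_vec])
  finally show ?thesis .
qed

lemma flip_flip: "flip_shell n (flip_shell n k) = k"
  by (simp add: flip_shell_def vec_eq_iff)

text \<open>The sum is reindexed by \<open>flip_shell\<close>, which preserves the positive shell.
  It reverses the sign both inside the sine and in front of the mirrored direction, and the two
  signs cancel.\<close>

lemma shell_field_mirror: "shell_field n (mirror x) = mirror (shell_field n x)"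
proof -
  have bij: "bij_betw (flip_shell n) (Mshell n) (Mshell n)"
    using flip_shell_Mshell flip_flip by (intro bij_betw_byWitness[where f' = "flip_shell n"]) auto
  have "shell_field n (mirror x) =
    (\<Sum>k\<in>Mshell n. sin (2 * pi * (rvec (flip_shell n k) \<bullet> mirror x)) *\<^sub>R vdir (flip_shell n k))"
    unfolding shell_field_def by (rule sum.reindex_bij_betw[OF bij, symmetric])
  also have "\<dots> = (\<Sum>k\<in>Mshell n. mirror (sin (2 * pi * (rvec k \<bullet> x)) *\<^sub>R vdir k))"
  proof (rule sum.cong[OF refl])
    fix k assume k: "k \<in> Mshell n"
    have c3: "3 dvd csum k" using csum_shellpm[of k n] k by (simp add: mem_shellpm)
    have f: "flip_shell n k = - mir k" by (simp add: mir_Mshell[OF k])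
    show "sin (2 * pi * (rvec (flip_shell n k) \<bullet> mirror x)) *\<^sub>R vdir (flip_shell n k) =
      mirror (sin (2 * pi * (rvec k \<bullet> x)) *\<^sub>R vdir k)"
      by (simp add: f rvec_minus vdir_minus rvec_mir[OF c3] vdir_mir[OF c3] mirror_inner linear_scale[OF linear_mirror])
  qed
  also have "\<dots> = mirror (shell_field n x)"
    by (simp add: shell_field_def linear_sum[OF linear_mirror])
  finally show ?thesis .
qed

theorem shell_expansion_symmetric:
  assumes ex: "shell_expansion a u"
  shows "odd_field u" "perm_symmetric u" "mirror_symmetric u"
proof -
  show "odd_field u" unfolding odd_field_def
    by (rule shell_expansion_symmetry[OF ex, where S = uminus]) (auto simp: linear_uminus shell_field_minus)
  show "perm_symmetric u" unfolding perm_symmetric_def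
  proof (intro allI impI)
    fix p :: "3 \<Rightarrow> 3" assume p: "p permutes UNIV"
    show "AE x in lebesgue. u (perm_vec p x) = perm_vec p (u x)"
      by (rule shell_expansion_symmetry[OF ex, where S = "perm_vec (inv p)"])
        (auto simp: linear_perm_vec shell_field_perm[OF p] perm_vec_inv[OF p])
  qed
  have "AE x in lebesgue. u (mirror x) = mirror (u x)"
    by (rule shell_expansion_symmetry[OF ex, where S = mirror])
      (auto simp: linear_mirror shell_field_mirror mirror_mirror)
  then show "mirror_symmetric u" unfolding mirror_symmetric_def
    by eventually_elim (metis mirror_mirror)
qed

section \<open>The Lyapunov functional\<close>

lemma summable_mult_squares:
  fixes x y :: "nat \<Rightarrow> real"
  assumes "summable (\<lambda>n. (x n)\<^sup>2)" "summable (\<lambda>n. (y n)\<^sup>2)"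
  shows "summable (\<lambda>n. x n * y n)"
proof (rule summable_comparison_test'[OF summable_add[OF assms]])
  fix n
  have "2 * \<bar>x n\<bar> * \<bar>y n\<bar> \<le> (x n)\<^sup>2 + (y n)\<^sup>2" using sum_squares_bound[of "\<bar>x n\<bar>" "\<bar>y n\<bar>"] by simp
  moreover have "0 \<le> \<bar>x n\<bar> * \<bar>y n\<bar>" by simp
  ultimately show "norm (x n * y n) \<le> (x n)\<^sup>2 + (y n)\<^sup>2" by (simp only: real_norm_def abs_mult)
qed

lemma suminf_Cauchy_Schwarz:
  fixes x y :: "nat \<Rightarrow> real"
  assumes "summable (\<lambda>n. (x n)\<^sup>2)" "summable (\<lambda>n. (y n)\<^sup>2)"
  shows "(\<Sum>n. x n * y n)\<^sup>2 \<le> (\<Sum>n. (x n)\<^sup>2) * (\<Sum>n. (y n)\<^sup>2)"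
proof (rule LIMSEQ_le)
  show "(\<lambda>N. (\<Sum>n<N. x n * y n)\<^sup>2) \<longlonglongrightarrow> (\<Sum>n. x n * y n)\<^sup>2"
    by (intro tendsto_power summable_LIMSEQ summable_mult_squares assms)
  show "(\<lambda>N. (\<Sum>n<N. (x n)\<^sup>2) * (\<Sum>n<N. (y n)\<^sup>2)) \<longlonglongrightarrow> (\<Sum>n. (x n)\<^sup>2) * (\<Sum>n. (y n)\<^sup>2)"
    by (intro tendsto_mult summable_LIMSEQ assms)
qed (auto intro: Cauchy_Schwarz_ineq_sum)

text \<open>Convexity of exp between 0 and ln a.\<close>

lemma powr_le_affine:
  fixes a \<theta> :: real
  assumes "a > 0" "0 \<le> \<theta>" "\<theta> \<le> 1"
  shows "a powr \<theta> \<le> 1 + \<theta> * (a - 1)"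
proof -
  have "exp ((1 - \<theta>) *\<^sub>R 0 + \<theta> *\<^sub>R ln a) \<le> (1 - \<theta>) * exp 0 + \<theta> * exp (ln a)"
    by (rule convex_onD[OF exp_convex]) (use assms in auto)
  then show ?thesis using assms by (simp add: powr_def algebra_simps)
qed

text \<open>From 3^5 = 243 < 256 = 2^8. It bounds 2 \<alpha> by 8/5 of
  \<open>alpha_t \<alpha>\<close>.\<close>

lemma ln3_ln2: "5 * ln 3 \<le> 8 * ln (2::real)"
proof -
  have "ln (3^5 :: real) \<le> ln (2^8)" by (subst ln_le_cancel_iff) auto
  then show ?thesis by (simp only: ln_realpow zero_less_numeral)
qed

lemma sqrt3_gt1: "sqrt 3 > (1::real)"
  by simp

lemma sqrt3_powr: "sqrt 3 powr a = 3 powr (a / 2)"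
  by (simp add: powr_half_sqrt[symmetric] powr_powr)

text \<open>The weight of the dissipation, \<open>\<mu>\<^sub>n powr (-2\<alpha>) > 1\<close>, is absorbed by the growth of \<open>\<beta>\<close>
  together with the half of \<open>\<beta>\<^sub>0 \<psi>\<^sub>0 \<psi>\<^sub>1\<close> that the splitting of the products leaves over at \<open>n = 0\<close>.\<close>

lemma shell_weights:
  fixes \<alpha> s :: real and n :: nat
  assumes "0 < \<alpha>" "alpha_t \<alpha> < s" "s < 1/3"
  defines "G \<equiv> sqrt 3 powr (1 - s) - sqrt 3 powr ((1 + s) / 2)"
  shows "beta 0 * G * (mu n powr (- 2 * \<alpha>))\<^sup>2 \<le>
    beta n * sqrt 3 powr (1 - s) - (beta n + (if n = 0 then 0 else beta (n - 1))) / 2 * sqrt 3 powr ((1 + s) / 2)"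
proof -
  \<comment> \<open>After division by R only x, p, z and \<alpha> remain: q is the quotient of the
    two powers of sqrt 3, so G = z R, and p = 3 s lies between 0 and 1.\<close>
  define x :: real where "x = (3/4)^n"
  define p where "p = 3 * s"
  define q where "q = sqrt 3 powr ((1 - 3 * s) / 2)"
  define z where "z = q - 1"
  define R where "R = sqrt 3 powr ((1 + s) / 2)"
  define m2 where "m2 = (mu n powr (- 2 * \<alpha>))\<^sup>2"
  define b' where "b' = (if n = 0 then 0 else beta (n - 1))"
  have at: "0 < alpha_t \<alpha>" using assms(1) by (simp add: alpha_t_def)
  have p: "0 < p" "p < 1" using assms at by (auto simp: p_def)
  have R: "R > 0" by (simp add: R_def)
  have qR: "sqrt 3 powr (1 - s) = q * R"
  proof -
    have "1 - s = (1 - 3 * s) / 2 + (1 + s) / 2" by (simp add: field_simps)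
    then show ?thesis unfolding q_def R_def by (metis powr_add)
  qed
  have x: "0 < x" "x \<le> 1" by (auto simp: x_def power_le_one)
  have z0: "0 < z"
    using sqrt3_gt1 p powr_less_mono[of 0 "(1 - 3 * s) / 2" "sqrt 3"] by (simp add: z_def q_def p_def)
  \<comment> \<open>z + 1 = 3 powr ((1 - p) / 4), and 3 powr (1/4) is at most 33/25 because
    (33/25)^4 exceeds 3; the power 1 - p then lies below its chord.\<close>
  have z1: "z \<le> 32/100 * (1 - p)"
  proof -
    have "(3::real) \<le> (33/25) powr 4" by (simp add: power_divide)
    then have "(3::real) powr (1/4) \<le> ((33/25) powr 4) powr (1/4)" by (intro powr_mono2) auto
    also have "\<dots> = 33/25" by (simp only: powr_powr) simp
    finally have "(3::real) powr (1/4) \<le> 33/25" .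
    then have "(3 powr (1/4)) powr (1 - p) \<le> (33/25 :: real) powr (1 - p)" using p by (intro powr_mono2) auto
    also have "\<dots> \<le> 1 + (1 - p) * (33/25 - 1)" by (rule powr_le_affine) (use p in auto)
    finally have "(3::real) powr ((1 - p) / 4) \<le> 1 + (1 - p) * (33/25 - 1)" by (simp add: powr_powr)
    then show ?thesis by (simp add: z_def q_def sqrt3_powr p_def field_simps)
  qed
  \<comment> \<open>m2 = (1 + 2/3 x) powr (2 \<alpha>) with 2 \<alpha> \<le> 8/15 p; the constant
    8/15 * 2/3 = 16/45 is rounded up to 36/100.\<close>
  have m2: "m2 \<le> 1 + 36/100 * (p * x)"
  proof -
    let ?y = "1 + 2/3 * x"
    have y: "?y > 0" using x by simp
    have "m2 = ?y powr (2 * \<alpha>)"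
      using y by (simp add: m2_def mu_def x_def[symmetric] powr_def ln_div ln_sqrt power2_eq_square exp_add[symmetric])
    also have "\<dots> \<le> 1 + (2 * \<alpha>) * (?y - 1)"
    proof (rule powr_le_affine[OF y])
      have "2 * \<alpha> = ln 3 / ln 2 * alpha_t \<alpha>" by (simp add: alpha_t_def)
      also have "\<dots> \<le> (8/5) * (1/3)"
        using ln3_ln2 assms at by (intro mult_mono) (auto simp: field_simps)
      finally show "2 * \<alpha> \<le> 1" by simp
    qed (use assms in simp)
    also have "(2 * \<alpha>) * (?y - 1) \<le> (8/5 * (p / 3)) * (?y - 1)"
    proof (rule mult_right_mono)
      have "2 * \<alpha> = ln 3 / ln 2 * alpha_t \<alpha>" by (simp add: alpha_t_def)
      also have "\<dots> \<le> (8/5) * s"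
        using ln3_ln2 assms at by (intro mult_mono) (auto simp: field_simps)
      finally show "2 * \<alpha> \<le> 8/5 * (p / 3)" by (simp add: p_def)
    qed (use x in simp)
    also have "1 + (8/5 * (p / 3)) * (?y - 1) \<le> 1 + 36/100 * (p * x)" using p x by simp
    finally show ?thesis by simp
  qed
  have bpos: "beta k > 0" for k by (simp add: beta_def add_pos_nonneg)
  have bsq: "(beta n)\<^sup>2 = 1 / (1 + x / 2)"
  proof -
    have "beta n = 1 / sqrt (1 + x / 2)" by (simp add: beta_def x_def)
    then show ?thesis using x by (simp only: power_divide) simp
  qed
  have "beta 0 * z * m2 \<le> beta n * z + (beta n - b') / 2"
  proof (cases "n = 0")
    case True
    then have [simp]: "x = 1" by (simp add: x_def)
    \<comment> \<open>For n = 0 the missing beta_(-1) leaves the surplus beta_0 / 2, far more than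
      the excess z (m2 - 1) of the dissipation.\<close>
    have "z * (m2 - 1) \<le> 32/100 * (36/100)"
    proof -
      have "z * (m2 - 1) \<le> z * (36/100 * p)" using m2 z0 by (intro mult_left_mono) auto
      also have "\<dots> \<le> 32/100 * (36/100)" using z0 z1 p by (intro mult_mono) auto
      finally show ?thesis .
    qed
    then have "z * m2 \<le> z + 1/2" by (simp add: algebra_simps)
    then have "beta 0 * (z * m2) \<le> beta 0 * (z + 1/2)" using bpos[of 0] by (intro mult_left_mono) auto
    then show ?thesis using True by (simp add: b'_def algebra_simps)
  next
    case False
    then obtain k where k: "n = Suc k" by (cases n) auto
    have x34: "x \<le> 3/4"
    proof -
      have "x = (3/4) * (3/4)^k" by (simp add: x_def k)
      also have "\<dots> \<le> 3/4 * 1" by (intro mult_left_mono power_le_one) auto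
      finally show ?thesis by simp
    qed
    have xk: "(3/4::real)^k = 4/3 * x" by (simp add: x_def k)
    have bksq: "(beta k)\<^sup>2 = 1 / (1 + 2/3 * x)"
    proof -
      have "beta k = 1 / sqrt (1 + 2/3 * x)" unfolding beta_def xk by simp
      then show ?thesis using x by (simp only: power_divide) simp
    qed
    \<comment> \<open>The tangent at x = 1 to the ratio beta_0 / beta_n, the square root of 2/3 (1 +
      x/2). Squared, the two sides differ by (1 - x)^2 / 36.\<close>
    have b0: "beta 0 \<le> (1 - (1 - x) / 6) * beta n"
    proof (rule power2_le_imp_le)
      have "(beta 0)\<^sup>2 = 2/3" by (simp add: beta_def power_divide)
      moreover have "(2/3) * (1 + x / 2) \<le> (1 - (1 - x) / 6)\<^sup>2"
        using zero_le_power2[of "1 - x"] by (simp add: power2_eq_square field_simps)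
      moreover have "((1 - (1 - x) / 6) * beta n)\<^sup>2 = (1 - (1 - x) / 6)\<^sup>2 / (1 + x / 2)"
        by (simp only: power_mult_distrib bsq) simp
      ultimately show "(beta 0)\<^sup>2 \<le> ((1 - (1 - x) / 6) * beta n)\<^sup>2"
        using x by (simp only:) (subst pos_le_divide_eq, auto)
    qed (use x bpos[of n] in auto)
    have fr: "1 / d \<le> e / d'" if "0 < d" "0 < d'" "d' \<le> e * d" for d d' e :: real
      using that by (simp add: field_simps)
    \<comment> \<open>To first order the ratio is 1 - x/12; the smaller slope 1/18 leaves room for
      the higher terms up to x = 3/4. It gives (beta_n - beta_(n-1)) / 2 \<ge> beta_n x /
      36.\<close>
    have bk: "beta k \<le> (1 - x / 18) * beta n"
    proof (rule power2_le_imp_le)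
      have "x * x \<le> x * (3/4)" using x x34 by (intro mult_left_mono) auto
      moreover have "0 \<le> x * x * x" using x by simp
      moreover have "(1 - x / 18)\<^sup>2 * (1 + 2/3 * x) - (1 + x / 2) = x / 18 - 23/324 * (x * x) + x * x * x / 486"
        by (simp add: power2_eq_square field_simps)
      ultimately have "1 + x / 2 \<le> (1 - x / 18)\<^sup>2 * (1 + 2/3 * x)"
        using x(1) by linarith
      moreover have "((1 - x / 18) * beta n)\<^sup>2 = (1 - x / 18)\<^sup>2 / (1 + x / 2)"
        by (simp only: power_mult_distrib bsq) simp
      ultimately show "(beta k)\<^sup>2 \<le> ((1 - x / 18) * beta n)\<^sup>2"
        unfolding bksq using x fr[of "1 + 2/3 * x" "1 + x / 2" "(1 - x / 18)\<^sup>2"] by simp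
    qed (use x bpos[of n] in auto)
    have key: "z * ((1 - (1 - x) / 6) * m2 - 1) \<le> x / 36"
    proof -
      have "(1 - (1 - x) / 6) * m2 - 1 \<le> (1 - (1 - x) / 6) * (1 + 36/100 * (p * x)) - 1"
        using m2 x by (intro diff_right_mono mult_left_mono) auto
      also have "\<dots> \<le> x * (36/100 * p - 1/18)"
      proof -
        define v where "v = 36/100 * (p * x)"
        define y where "y = (1 - x) / 6"
        have "0 \<le> y * v" unfolding v_def y_def using x p by (intro mult_nonneg_nonneg) auto
        \<comment> \<open>Equivalent to x \<le> 3/4, true from n = 1 on.\<close>
        moreover have "x / 18 \<le> y" using x34 by (simp add: y_def)
        moreover have "(1 - y) * (1 + v) - 1 = v - y - y * v" by (simp add: algebra_simps)
        moreover have "x * (36/100 * p - 1/18) = v - x / 18" by (simp add: v_def algebra_simps)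
        ultimately have "(1 - y) * (1 + v) - 1 \<le> x * (36/100 * p - 1/18)" by linarith
        then show ?thesis by (simp only: v_def y_def)
      qed
      finally have "z * ((1 - (1 - x) / 6) * m2 - 1) \<le> z * (x * (36/100 * p - 1/18))"
        using z0 by (intro mult_left_mono) auto
      also have "\<dots> \<le> x / 36"
      proof (cases "36/100 * p - 1/18 \<le> 0")
        case True
        then have "z * (x * (36/100 * p - 1/18)) \<le> 0" using z0 x by (intro mult_nonneg_nonpos mult_nonneg_nonpos) auto
        then show ?thesis by (rule order_trans) (use x in simp)
      next
        case False
        then have "z * (x * (36/100 * p - 1/18)) \<le> (32/100 * (1 - p)) * (x * (36/100 * p - 1/18))"
          using z1 x by (intro mult_right_mono) auto
        also have "\<dots> = x * ((32/100 * (1 - p)) * (36/100 * p - 1/18))" by simp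
        also have "\<dots> \<le> x * (1/36)"
        proof (rule mult_left_mono)
          \<comment> \<open>Here w stands for p * p. The quadratic in p has its maximum near 57/100,
            so p * p is replaced by its tangent there and a linear inequality remains.\<close>
          have aux: "32/100 * (36/100 * p - 1/18 - 36/100 * w + p / 18) \<le> 1/36"
            if "w \<ge> 114/100 * p - 3249/10000" for w using that p by (simp add: field_simps)
          have "0 \<le> (p - 57/100)\<^sup>2" by simp
          also have "(p - 57/100)\<^sup>2 = p * p - 114/100 * p + 3249/10000"
            by (simp add: power2_eq_square field_simps)
          finally have "p * p \<ge> 114/100 * p - 3249/10000" by simp
          from aux[OF this] show "(32/100 * (1 - p)) * (36/100 * p - 1/18) \<le> 1/36"
            by (simp add: field_simps)
        qed (use x in simp)
        finally show ?thesis by simp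
      qed
      finally show ?thesis .
    qed
    have "beta 0 * z * m2 \<le> (1 - (1 - x) / 6) * beta n * z * m2"
      using b0 z0 by (intro mult_right_mono) (auto simp: m2_def)
    also have "\<dots> = beta n * z + beta n * (z * ((1 - (1 - x) / 6) * m2 - 1))" by (simp add: algebra_simps)
    also have "\<dots> \<le> beta n * z + beta n * (x / 36)" using key bpos[of n] by (intro add_left_mono mult_left_mono) auto
    also have "\<dots> \<le> beta n * z + (beta n - b') / 2" using bk by (simp add: b'_def k algebra_simps)
    finally show ?thesis .
  qed
  then have "R * (beta 0 * z * m2) \<le> R * (beta n * z + (beta n - b') / 2)" using R by (intro mult_left_mono) auto
  then show ?thesis unfolding G_def qR R_def[symmetric] m2_def[symmetric] b'_def[symmetric]
    by (simp add: z_def algebra_simps add_divide_distrib diff_divide_distrib)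
qed


section \<open>The derivative of the Lyapunov functional\<close>

lemma beta_bounds: "0 < beta n" "beta n \<le> 1"
proof -
  have "1 \<le> sqrt (1 + 1/2 * (3/4)^n)" by simp
  then show "0 < beta n" "beta n \<le> 1" by (auto simp: beta_def divide_le_eq_1 intro: add_pos_nonneg)
qed

lemma mu_powr_bounds:
  assumes "\<alpha> > 0"
  shows "1 \<le> mu n powr (- 2 * \<alpha>)" "mu n powr (- 2 * \<alpha>) \<le> (5/3) powr \<alpha>"
proof -
  let ?y = "1 + 2/3 * (3/4::real)^n"
  have y: "?y > 0" "1 \<le> ?y" "?y \<le> 5/3" using power_le_one[of "3/4::real" n] by (auto simp: add_pos_nonneg)
  have eq: "mu n powr (- 2 * \<alpha>) = ?y powr \<alpha>"
    using y(1) by (simp add: mu_def powr_def ln_div ln_sqrt)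
  show "1 \<le> mu n powr (- 2 * \<alpha>)" unfolding eq using y(2) assms by (intro ge_one_powr_ge_zero) auto
  show "mu n powr (- 2 * \<alpha>) \<le> (5/3) powr \<alpha>" unfolding eq using y assms by (intro powr_mono2) auto
qed

lemma summable_sqrt3_powr:
  assumes "e > 0"
  shows "summable (\<lambda>n. (sqrt 3 powr (- e)) ^ n)" and "(\<Sum>n. (sqrt 3 powr (- e)) ^ n) = 1 / (1 - sqrt 3 powr (- e))"
    and "sqrt 3 powr (- e) < 1"
proof -
  show l: "sqrt 3 powr (- e) < 1" using powr_less_mono[of "- e" 0 "sqrt 3"] assms by simp
  then show "summable (\<lambda>n. (sqrt 3 powr (- e)) ^ n)" by (intro summable_geometric) simp
  show "(\<Sum>n. (sqrt 3 powr (- e)) ^ n) = 1 / (1 - sqrt 3 powr (- e))" using l by (intro suminf_geometric) simp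
qed

lemma sqrt3_powr_nat: "sqrt 3 powr (e * real n) = (sqrt 3 powr e) ^ n"
  by (simp add: powr_powr[symmetric] powr_realpow)

lemma sqrt3_powr_sq: "(sqrt 3 powr (e / 2 * real n))\<^sup>2 = (sqrt 3 powr e) ^ n"
proof -
  have "e / 2 * real n + e / 2 * real n = e * real n" by simp
  then show ?thesis unfolding power2_eq_square powr_add[symmetric] by (simp only: sqrt3_powr_nat)
qed

text \<open>In the rescaled amplitudes b the quadratic part is bounded below termwise by
  \<open>shell_weights\<close>, after 2 b_n b_(n+1) \<le> b_n^2 + b_(n+1)^2. The result is a
  multiple of Q, the sum of (m_n b_n)^2. Cauchy-Schwarz against geometric series bounds both the
  viscous term and H^2 (1 - g) in terms of Q; putting m_n into Q lets the viscous bound avoid any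
  factor from mu.\<close>

theorem lyap_rhs:
  fixes a :: "nat \<Rightarrow> real"
  assumes \<alpha>: "0 < \<alpha>" and \<nu>: "0 < \<nu>" and s: "alpha_t \<alpha> < s" "s < 1/3"
    and a: "\<And>n. \<bar>a n\<bar> * sqrt 3 ^ n \<le> B"
    and H: "lyap s a > C_const \<alpha> s * \<nu>"
  shows "(\<Sum>n. sqrt 3 powr (- s * real n) * shell_rhs \<nu> \<alpha> a n) > kappa s * (lyap s a)\<^sup>2"
proof -
  define al where "al = alpha_t \<alpha>"
  have al: "0 < al" "al < s" using \<alpha> s by (auto simp: al_def alpha_t_def)
  \<comment> \<open>b_n^2 carries the full weight (sqrt 3) powr ((1 - s) n) of the quadratic terms;
    X and Y are what this leaves of the weights in H and in the dissipation.\<close>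
  define b where "b n = sqrt 3 powr ((1 - s) / 2 * real n) * a n" for n
  define X where "X n = sqrt 3 powr (- (1 + s) / 2 * real n)" for n
  define \<rho> where "\<rho> = 1 + s - 4 * al"
  define Y where "Y n = sqrt 3 powr (- \<rho> / 2 * real n)" for n
  define m where "m n = mu n powr (- 2 * \<alpha>)" for n
  define R where "R = sqrt 3 powr ((1 + s) / 2)"
  define S where "S = sqrt 3 powr (1 - s)"
  define G where "G = S - R"
  define c where "c = (12 * pi\<^sup>2) powr \<alpha>"
  define H where "H = lyap s a"
  define g where "g = sqrt 3 powr (- (1 + s))"
  define h where "h = sqrt 3 powr (- \<rho>)"
  have \<rho>: "\<rho> > 0" using al s by (simp add: \<rho>_def)
  have s0: "s > 0" using al by simp
  have cpos: "c > 0" by (simp add: c_def)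
  have sG: "G > 0" unfolding G_def S_def R_def using s by (simp add: powr_less_mono)
  have Rpos: "R > 0" "S > 0" by (simp_all add: R_def S_def)
  have X2: "(X n)\<^sup>2 = g ^ n" for n
    unfolding X_def g_def by (rule sqrt3_powr_sq)
  have Y2: "(Y n)\<^sup>2 = h ^ n" for n
    unfolding Y_def h_def by (rule sqrt3_powr_sq)
  have g: "summable (\<lambda>n. g ^ n)" "(\<Sum>n. g ^ n) = 1 / (1 - g)" "g < 1"
    using summable_sqrt3_powr[of "1 + s"] s0 by (simp_all add: g_def)
  have h: "summable (\<lambda>n. h ^ n)" "(\<Sum>n. h ^ n) = 1 / (1 - h)" "h < 1"
    using summable_sqrt3_powr[OF \<rho>] by (simp_all add: h_def)
  have b2: "(b n)\<^sup>2 \<le> B\<^sup>2 * g ^ n" for n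
  proof -
    have "\<bar>b n\<bar> = X n * (\<bar>a n\<bar> * sqrt 3 ^ n)"
    proof -
      have "(1 - s) / 2 * real n = - (1 + s) / 2 * real n + real n" by (simp add: field_simps)
      then have "sqrt 3 powr ((1 - s) / 2 * real n) = X n * sqrt 3 ^ n"
        unfolding X_def by (simp only: powr_add) (simp add: powr_realpow)
      moreover have "X n > 0" by (simp add: X_def)
      ultimately show ?thesis by (simp add: b_def abs_mult)
    qed
    also have "\<dots> \<le> X n * B" using a by (intro mult_left_mono) (auto simp: X_def)
    finally have "\<bar>b n\<bar>\<^sup>2 \<le> (X n * B)\<^sup>2" by (intro power_mono) auto
    then show ?thesis by (simp add: power_mult_distrib X2 mult.commute)
  qed
  have sb: "summable (\<lambda>n. (b n)\<^sup>2)"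
    by (rule summable_comparison_test'[OF summable_mult[OF g(1), of "B\<^sup>2"]]) (use b2 in auto)
  have m1: "1 \<le> m n" for n unfolding m_def by (rule mu_powr_bounds[OF \<alpha>])
  have mM: "m n \<le> (5/3) powr \<alpha>" for n unfolding m_def by (rule mu_powr_bounds[OF \<alpha>])
  have smb: "summable (\<lambda>n. (m n * b n)\<^sup>2)"
  proof (rule summable_comparison_test'[OF summable_mult[OF sb, of "((5/3) powr \<alpha>)\<^sup>2"]])
    fix n
    have "(m n)\<^sup>2 \<le> ((5/3) powr \<alpha>)\<^sup>2" using mM m1[of n] by (intro power_mono) auto
    then show "norm ((m n * b n)\<^sup>2) \<le> ((5/3) powr \<alpha>)\<^sup>2 * (b n)\<^sup>2"
      by (simp add: power_mult_distrib mult_right_mono)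
  qed
  define Q where "Q = (\<Sum>n. (m n * b n)\<^sup>2)"
  have sX: "summable (\<lambda>n. (X n)\<^sup>2)" and sY: "summable (\<lambda>n. (Y n)\<^sup>2)" using g(1) h(1) by (simp_all add: X2 Y2)
  have "lyap_term s a = (\<lambda>n. X n * b n)"
  proof
    fix n
    have "- s * real n = - (1 + s) / 2 * real n + (1 - s) / 2 * real n" by (simp add: field_simps)
    then have "sqrt 3 powr (- s * real n) = X n * sqrt 3 powr ((1 - s) / 2 * real n)"
      unfolding X_def by (simp only: powr_add)
    then show "lyap_term s a n = X n * b n" by (simp add: lyap_term_def b_def)
  qed
  then have Heq: "H = (\<Sum>n. X n * b n)" by (simp add: H_def lyap_def)
  have bQ: "(\<Sum>n. (b n)\<^sup>2) \<le> Q"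
    unfolding Q_def
  proof (rule suminf_le[OF _ sb smb])
    fix n
    have "1 * (b n)\<^sup>2 \<le> (m n)\<^sup>2 * (b n)\<^sup>2" using m1[of n] by (intro mult_right_mono) (auto simp: one_le_power)
    then show "(b n)\<^sup>2 \<le> (m n * b n)\<^sup>2" by (simp add: power_mult_distrib)
  qed
  have H2: "H\<^sup>2 * (1 - g) \<le> Q"
  proof -
    have "H\<^sup>2 \<le> 1 / (1 - g) * (\<Sum>n. (b n)\<^sup>2)"
      using suminf_Cauchy_Schwarz[OF sX sb] by (simp add: Heq X2 g(2))
    also have "\<dots> \<le> 1 / (1 - g) * Q" using bQ g(3) by (intro mult_left_mono) auto
    finally show ?thesis using g(3) by (simp add: field_simps)
  qed
  have Q0: "0 \<le> Q" unfolding Q_def by (intro suminf_nonneg smb) simp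
  define D where "D n = m n * b n * Y n" for n
  have sD: "summable D" unfolding D_def by (rule summable_mult_squares[OF smb sY])
  have D2: "\<bar>\<Sum>n. D n\<bar> \<le> sqrt Q / sqrt (1 - h)"
  proof -
    have "(\<Sum>n. D n)\<^sup>2 \<le> Q / (1 - h)"
      using suminf_Cauchy_Schwarz[OF smb sY] by (simp add: D_def Q_def Y2 h(2))
    then have "sqrt ((\<Sum>n. D n)\<^sup>2) \<le> sqrt (Q / (1 - h))" by (rule real_sqrt_le_mono)
    then show ?thesis by (simp add: real_sqrt_divide)
  qed
  define U where "U n = beta n * (b n)\<^sup>2" for n
  \<comment> \<open>The primes denote shifts by one with value 0 at n = 0, in accordance with
    \<psi>_(-1) = beta_(-1) = 0.\<close>
  define U' where "U' n = (if n = 0 then 0 else U (n - 1))" for n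
  define V where "V n = beta n * (b n * b (Suc n))" for n
  define W where "W n = beta n * (b (Suc n))\<^sup>2" for n
  define W' where "W' n = (if n = 0 then 0 else beta (n - 1)) * (b n)\<^sup>2" for n
  have sU: "summable U"
    by (rule summable_comparison_test'[OF sb]) (use beta_bounds in \<open>auto simp: U_def less_imp_le intro!: mult_left_le_one_le\<close>)
  have sbS: "summable (\<lambda>n. (b (Suc n))\<^sup>2)" using sb by (subst summable_Suc_iff)
  have sW: "summable W"
    by (rule summable_comparison_test'[OF sbS]) (use beta_bounds in \<open>auto simp: W_def less_imp_le intro!: mult_left_le_one_le\<close>)
  have sV: "summable V"
  proof (rule summable_comparison_test'[OF summable_add[OF sU sW]])
    fix n
    have "2 * \<bar>b n\<bar> * \<bar>b (Suc n)\<bar> \<le> (b n)\<^sup>2 + (b (Suc n))\<^sup>2" using sum_squares_bound[of "\<bar>b n\<bar>" "\<bar>b (Suc n)\<bar>"] by simp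
    moreover have "0 \<le> \<bar>b n\<bar> * \<bar>b (Suc n)\<bar>" by simp
    ultimately have "\<bar>b n\<bar> * \<bar>b (Suc n)\<bar> \<le> (b n)\<^sup>2 + (b (Suc n))\<^sup>2" by linarith
    then have "beta n * (\<bar>b n\<bar> * \<bar>b (Suc n)\<bar>) \<le> beta n * ((b n)\<^sup>2 + (b (Suc n))\<^sup>2)"
      using beta_bounds by (intro mult_left_mono) (auto simp: less_imp_le)
    then show "norm (V n) \<le> U n + W n"
      using beta_bounds(1)[of n] by (simp add: V_def U_def W_def abs_mult algebra_simps)
  qed
  have U': "U' sums (\<Sum>n. U n)"
    using sums_Suc[of U' "\<Sum>n. U n"] summable_sums[OF sU] by (simp add: U'_def)
  have W': "W' sums (\<Sum>n. W n)"
  proof -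
    have "(\<lambda>n. W' (Suc n)) = W" by (simp add: W'_def W_def fun_eq_iff)
    then show ?thesis using sums_Suc[of W' "\<Sum>n. W n"] summable_sums[OF sW] by (simp add: W'_def[of 0])
  qed
  have tm: "sqrt 3 powr (- s * real n) * shell_rhs \<nu> \<alpha> a n =
      - (c * \<nu>) * D n + sqrt 2 * pi * S * U' n - sqrt 2 * pi * R * V n" for n
  proof -
    let ?w = "sqrt 3 powr (- s * real n)"
    have 1: "?w * (c * m n * \<nu> * sqrt 3 powr (2 * al * real n) * a n) = c * \<nu> * D n"
    proof -
      have "?w * sqrt 3 powr (2 * al * real n) = sqrt 3 powr ((1 - s) / 2 * real n) * Y n"
        unfolding Y_def by (simp only: powr_add[symmetric]) (rule arg_cong[where f = "(powr) (sqrt 3)"], simp add: \<rho>_def field_simps)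
      then show ?thesis by (simp add: D_def b_def mult_ac)
    qed
    have 2: "?w * (if n = 0 then 0 else sqrt 2 * pi * beta (n - 1) * sqrt 3 ^ n * (a (n - 1))\<^sup>2) = sqrt 2 * pi * S * U' n"
    proof (cases n)
      case (Suc k)
      have "?w * sqrt 3 ^ n = S * (sqrt 3 powr ((1 - s) / 2 * real k))\<^sup>2"
        unfolding S_def power2_eq_square powr_realpow[symmetric, of "sqrt 3", simplified] powr_add[symmetric]
        by (rule arg_cong[where f = "(powr) (sqrt 3)"]) (simp add: Suc field_simps)
      then show ?thesis by (simp add: Suc U'_def U_def b_def power_mult_distrib mult_ac)
    qed (simp add: U'_def)
    have 3: "?w * (sqrt 2 * pi * beta n * sqrt 3 ^ (n + 1) * a n * a (n + 1)) = sqrt 2 * pi * R * V n"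
    proof -
      have "?w * sqrt 3 ^ (n + 1) = R * (sqrt 3 powr ((1 - s) / 2 * real n) * sqrt 3 powr ((1 - s) / 2 * real (Suc n)))"
        unfolding R_def powr_realpow[symmetric, of "sqrt 3", simplified] powr_add[symmetric]
        by (rule arg_cong[where f = "(powr) (sqrt 3)"]) (simp add: field_simps)
      then show ?thesis by (simp add: V_def b_def mult_ac)
    qed
    show ?thesis
      unfolding shell_rhs_def right_diff_distrib distrib_left mult_minus_right c_def[symmetric] m_def[symmetric] al_def[symmetric] 1 2 3
      by simp
  qed
  have "(\<lambda>n. - (c * \<nu>) * D n + sqrt 2 * pi * S * U' n - sqrt 2 * pi * R * V n) sums
      (- (c * \<nu>) * (\<Sum>n. D n) + sqrt 2 * pi * S * (\<Sum>n. U n) - sqrt 2 * pi * R * (\<Sum>n. V n))"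
    by (intro sums_diff sums_add sums_mult U' summable_sums sD sV)
  then have sum: "(\<Sum>n. sqrt 3 powr (- s * real n) * shell_rhs \<nu> \<alpha> a n) =
      - (c * \<nu>) * (\<Sum>n. D n) + sqrt 2 * pi * (S * (\<Sum>n. U n) - R * (\<Sum>n. V n))"
    unfolding tm using sums_unique by (fastforce simp: algebra_simps)
  have V: "(\<Sum>n. V n) \<le> (\<Sum>n. U n) / 2 + (\<Sum>n. W n) / 2"
  proof -
    have "(\<Sum>n. V n) \<le> (\<Sum>n. U n / 2 + W n / 2)"
    proof (rule suminf_le[OF _ sV])
      show "V n \<le> U n / 2 + W n / 2" for n
      proof -
        have "beta n * (2 * b n * b (Suc n)) \<le> beta n * ((b n)\<^sup>2 + (b (Suc n))\<^sup>2)"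
          using beta_bounds[of n] by (intro mult_left_mono sum_squares_bound) auto
        then show ?thesis by (simp add: V_def U_def W_def algebra_simps)
      qed
    qed (intro summable_add summable_divide sU sW)
    also have "\<dots> = (\<Sum>n. U n) / 2 + (\<Sum>n. W n) / 2"
      by (simp add: suminf_add[symmetric] suminf_divide sU sW summable_divide)
    finally show ?thesis .
  qed
  have main: "S * (\<Sum>n. U n) - R * (\<Sum>n. V n) \<ge> beta 0 * G * Q"
  proof -
    have A: "(\<lambda>n. S * U n - R * (U n / 2 + W' n / 2)) sums (S * (\<Sum>n. U n) - R * ((\<Sum>n. U n) / 2 + (\<Sum>n. W n) / 2))"
      by (intro sums_diff sums_add sums_mult sums_divide W' summable_sums sU)
    have Bs: "(\<lambda>n. beta 0 * G * (m n * b n)\<^sup>2) sums (beta 0 * G * Q)"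
      unfolding Q_def by (intro sums_mult summable_sums smb)
    have "beta 0 * G * Q \<le> S * (\<Sum>n. U n) - R * ((\<Sum>n. U n) / 2 + (\<Sum>n. W n) / 2)"
    proof (rule sums_le[OF _ Bs A])
      fix n
      let ?b' = "if n = 0 then 0 else beta (n - 1)"
      have "beta 0 * G * (m n)\<^sup>2 \<le> beta n * S - (beta n + ?b') / 2 * R"
        unfolding G_def S_def R_def m_def by (rule shell_weights[OF \<alpha> s])
      then have "beta 0 * G * (m n)\<^sup>2 * (b n)\<^sup>2 \<le> (beta n * S - (beta n + ?b') / 2 * R) * (b n)\<^sup>2"
        by (intro mult_right_mono) auto
      also have "\<dots> = S * U n - R * (U n / 2 + W' n / 2)"
        unfolding U_def W'_def by (simp add: field_simps)
      finally show "beta 0 * G * (m n * b n)\<^sup>2 \<le> S * U n - R * (U n / 2 + W' n / 2)"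
        by (simp add: power_mult_distrib mult.assoc)
    qed
    moreover have "R * (\<Sum>n. V n) \<le> R * ((\<Sum>n. U n) / 2 + (\<Sum>n. W n) / 2)"
      using V Rpos by (intro mult_left_mono) auto
    ultimately show ?thesis by linarith
  qed
  \<comment> \<open>beta_0 is the square root of 2/3, so the lower bound becomes 2 (pi / sqrt 3) G
    Q. One copy exceeds the viscous term by the threshold on H, the other is at least kappa
    H^2.\<close>
  have b0: "sqrt 2 * beta 0 = 2 / sqrt 3"
  proof -
    have "beta 0 = 1 / sqrt (3 / 2)" by (simp add: beta_def)
    then have "sqrt 2 * beta 0 = sqrt 2 * sqrt 2 / sqrt 3" by (simp add: real_sqrt_divide)
    then show ?thesis by simp
  qed
  have "sqrt 2 * pi * (beta 0 * G * Q) \<le> sqrt 2 * pi * (S * (\<Sum>n. U n) - R * (\<Sum>n. V n))"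
    using main by (intro mult_left_mono) auto
  moreover have "sqrt 2 * pi * (beta 0 * G * Q) = 2 * (pi / sqrt 3 * G * Q)"
  proof -
    have "sqrt 2 * pi * (beta 0 * G * Q) = (sqrt 2 * beta 0) * (pi * G * Q)" by (simp only: mult_ac)
    then show ?thesis unfolding b0 by simp
  qed
  moreover have "c * \<nu> * (\<Sum>n. D n) \<le> c * \<nu> * (sqrt Q / sqrt (1 - h))"
    using D2 cpos \<nu> by (intro mult_left_mono) auto
  ultimately have lower: "2 * (pi / sqrt 3 * G * Q) - c * \<nu> * (sqrt Q / sqrt (1 - h)) \<le>
      (\<Sum>n. sqrt 3 powr (- s * real n) * shell_rhs \<nu> \<alpha> a n)"
    unfolding sum by simp
  have C: "C_const \<alpha> s = sqrt 3 * c / (pi * sqrt (1 - h) * G * sqrt (1 - g))"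
    by (simp add: C_const_def c_def h_def g_def G_def S_def R_def \<rho>_def al_def)
  have k: "kappa s = pi / sqrt 3 * G * (1 - g)"
    by (simp add: kappa_def g_def G_def S_def R_def)
  have Hpos: "H > sqrt 3 * c / (pi * sqrt (1 - h) * G * sqrt (1 - g)) * \<nu>" using assms(6) C by (simp add: H_def)
  have pos: "0 < pi" "0 < sqrt (1 - h)" "0 < sqrt (1 - g)" "0 < sqrt (3::real)" using g(3) h(3) by auto
  have sQ: "sqrt 3 * c * \<nu> / (pi * sqrt (1 - h) * G) < sqrt Q"
  proof -
    have "sqrt 3 * c * \<nu> / (pi * sqrt (1 - h) * G) =
       (sqrt 3 * c / (pi * sqrt (1 - h) * G * sqrt (1 - g)) * \<nu>) * sqrt (1 - g)"
      using pos by simp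
    also have "\<dots> < H * sqrt (1 - g)" using Hpos pos by (intro mult_strict_right_mono) auto
    also have "\<dots> \<le> sqrt (H\<^sup>2 * (1 - g))" by (simp add: real_sqrt_mult mult_right_mono g(3) less_imp_le)
    also have "\<dots> \<le> sqrt Q" using H2 by (rule real_sqrt_le_mono)
    finally show ?thesis .
  qed
  have "0 \<le> sqrt 3 * c * \<nu> / (pi * sqrt (1 - h) * G)" using pos sG cpos \<nu> by auto
  then have Qpos: "0 < sqrt Q" using sQ by linarith
  have "c * \<nu> / sqrt (1 - h) < pi / sqrt 3 * G * sqrt Q"
    using sQ pos sG by (simp add: field_simps)
  then have "c * \<nu> / sqrt (1 - h) * sqrt Q < pi / sqrt 3 * G * sqrt Q * sqrt Q"
    using Qpos by (intro mult_strict_right_mono)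
  then have d: "c * \<nu> * (sqrt Q / sqrt (1 - h)) < pi / sqrt 3 * G * Q"
    using Q0 by (simp add: mult.assoc)
  have "kappa s * H\<^sup>2 = pi / sqrt 3 * G * (H\<^sup>2 * (1 - g))" by (simp add: k)
  also have "\<dots> \<le> pi / sqrt 3 * G * Q" using H2 pos sG by (intro mult_left_mono) auto
  finally have "kappa s * H\<^sup>2 \<le> pi / sqrt 3 * G * Q" .
  moreover have "x < w" if "x \<le> y" "2 * y - z \<le> w" "z < y" for x y z w :: real
    using that by linarith
  ultimately show ?thesis using lower d unfolding H_def by blast
qed


lemma lyap_term_bound:
  assumes a: "\<bar>a n\<bar> * sqrt 3 ^ n \<le> B"
  shows "\<bar>lyap_term s a n\<bar> \<le> B * (sqrt 3 powr (- (1 + s))) ^ n"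
proof -
  have "sqrt 3 powr (- s * real n) = (sqrt 3 powr (- (1 + s))) ^ n * sqrt 3 ^ n"
    unfolding sqrt3_powr_nat[symmetric] powr_realpow[symmetric, of "sqrt 3", simplified] powr_add[symmetric]
    by (rule arg_cong[where f = "(powr) (sqrt 3)"]) (simp add: algebra_simps)
  then have "\<bar>lyap_term s a n\<bar> = (sqrt 3 powr (- (1 + s))) ^ n * (\<bar>a n\<bar> * sqrt 3 ^ n)"
    unfolding lyap_term_def abs_mult by (simp add: abs_mult)
  also have "\<dots> \<le> (sqrt 3 powr (- (1 + s))) ^ n * B" using a by (intro mult_left_mono) auto
  finally show ?thesis by (simp add: mult.commute)
qed

text \<open>A geometric majorant uniform in time, for differentiating the functional term by term.
  The weighted nonlinear terms stay bounded in the critical weight, so only the dissipation worsens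
  the ratio, by the exponent 2 \<open>alpha_t \<alpha>\<close>.\<close>

lemma lyap_rhs_bound:
  assumes \<alpha>: "0 < \<alpha>" and \<nu>: "0 < \<nu>" and a: "\<And>n. \<bar>a n\<bar> * sqrt 3 ^ n \<le> B"
  shows "\<bar>sqrt 3 powr (- s * real n) * shell_rhs \<nu> \<alpha> a n\<bar> \<le>
    ((12 * pi\<^sup>2) powr \<alpha> * (5/3) powr \<alpha> * \<nu> * B + 4 * (sqrt 2 * pi * B\<^sup>2)) * (sqrt 3 powr (- (1 + s - 2 * alpha_t \<alpha>))) ^ n"
proof -
  define P where "P = sqrt 3 powr (2 * alpha_t \<alpha> * real n)"
  define c where "c = (12 * pi\<^sup>2) powr \<alpha>"
  define M where "M = (5/3::real) powr \<alpha>"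
  let ?r = "sqrt 3 ^ n :: real"
  have at: "0 < alpha_t \<alpha>" using \<alpha> by (simp add: alpha_t_def)
  have P: "1 \<le> P" unfolding P_def using at by (intro ge_one_powr_ge_zero) auto
  have cM: "c > 0" "M > 0" by (simp_all add: c_def M_def)
  have B: "0 \<le> B" using a[of 0] by (smt (verit) abs_ge_zero mult_nonneg_nonneg real_sqrt_ge_zero zero_le_power)
  have 1: "\<bar>c * mu n powr (- 2 * \<alpha>) * \<nu> * P * a n\<bar> * ?r \<le> c * M * \<nu> * B * P"
  proof -
    have "\<bar>c * mu n powr (- 2 * \<alpha>) * \<nu> * P * a n\<bar> * ?r = (c * mu n powr (- 2 * \<alpha>) * \<nu> * P) * (\<bar>a n\<bar> * ?r)"
      using cM \<nu> P by (simp add: abs_mult)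
    also have "\<dots> \<le> (c * M * \<nu> * P) * B"
      using cM \<nu> P B mu_powr_bounds(2)[OF \<alpha>, of n] a[of n] unfolding M_def
      by (intro mult_mono mult_right_mono mult_left_mono mult_nonneg_nonneg) auto
    finally show ?thesis by (simp add: mult_ac)
  qed
  \<comment> \<open>Both amplitudes belong to shell n - 1; raising their weights to those of shell n
    costs sqrt 3 twice.\<close>
  have 2: "\<bar>if n = 0 then 0 else sqrt 2 * pi * beta (n - 1) * ?r * (a (n - 1))\<^sup>2\<bar> * ?r \<le> 3 * (sqrt 2 * pi * B\<^sup>2)"
  proof (cases n)
    case (Suc k)
    have "(\<bar>a k\<bar> * sqrt 3 ^ k)\<^sup>2 \<le> B\<^sup>2" using a by (intro power_mono) auto
    then have *: "(a k)\<^sup>2 * (sqrt 3 ^ k * sqrt 3 ^ k) \<le> B\<^sup>2" by (simp add: power_mult_distrib power2_eq_square[of "sqrt 3 ^ k"])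
    have "\<bar>if n = 0 then 0 else sqrt 2 * pi * beta (n - 1) * ?r * (a (n - 1))\<^sup>2\<bar> * ?r
      = 3 * (sqrt 2 * pi) * (beta k * ((a k)\<^sup>2 * (sqrt 3 ^ k * sqrt 3 ^ k)))"
      using beta_bounds(1)[of k] by (simp add: Suc abs_mult)
    also have "\<dots> \<le> 3 * (sqrt 2 * pi) * (1 * B\<^sup>2)"
      using * beta_bounds[of k] by (intro mult_left_mono mult_mono) auto
    finally show ?thesis by simp
  qed simp
  have 3: "\<bar>sqrt 2 * pi * beta n * sqrt 3 ^ (n + 1) * a n * a (n + 1)\<bar> * ?r \<le> sqrt 2 * pi * B\<^sup>2"
  proof -
    have "\<bar>sqrt 2 * pi * beta n * sqrt 3 ^ (n + 1) * a n * a (n + 1)\<bar> * ?r =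
      (sqrt 2 * pi) * (beta n * ((\<bar>a n\<bar> * ?r) * (\<bar>a (n + 1)\<bar> * sqrt 3 ^ (n + 1))))"
      using beta_bounds(1)[of n] by (simp add: abs_mult)
    also have "\<dots> \<le> (sqrt 2 * pi) * (1 * (B * B))"
      using beta_bounds[of n] a[of n] a[of "n + 1"] B by (intro mult_left_mono mult_mono) auto
    finally show ?thesis by (simp add: power2_eq_square)
  qed
  have "\<bar>shell_rhs \<nu> \<alpha> a n\<bar> * ?r \<le> c * M * \<nu> * B * P + 3 * (sqrt 2 * pi * B\<^sup>2) + sqrt 2 * pi * B\<^sup>2"
  proof -
    have "\<bar>shell_rhs \<nu> \<alpha> a n\<bar> \<le> \<bar>c * mu n powr (- 2 * \<alpha>) * \<nu> * P * a n\<bar> +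
      \<bar>if n = 0 then 0 else sqrt 2 * pi * beta (n - 1) * ?r * (a (n - 1))\<^sup>2\<bar> +
      \<bar>sqrt 2 * pi * beta n * sqrt 3 ^ (n + 1) * a n * a (n + 1)\<bar>"
      unfolding shell_rhs_def c_def[symmetric] P_def[symmetric] by linarith
    then have "\<bar>shell_rhs \<nu> \<alpha> a n\<bar> * ?r \<le> (\<bar>c * mu n powr (- 2 * \<alpha>) * \<nu> * P * a n\<bar> +
      \<bar>if n = 0 then 0 else sqrt 2 * pi * beta (n - 1) * ?r * (a (n - 1))\<^sup>2\<bar> +
      \<bar>sqrt 2 * pi * beta n * sqrt 3 ^ (n + 1) * a n * a (n + 1)\<bar>) * ?r"
      by (rule mult_right_mono) simp
    then show ?thesis using 1 2 3 unfolding distrib_right by linarith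
  qed
  also have "\<dots> \<le> (c * M * \<nu> * B + 4 * (sqrt 2 * pi * B\<^sup>2)) * P"
  proof -
    have "4 * (sqrt 2 * pi * B\<^sup>2) * 1 \<le> 4 * (sqrt 2 * pi * B\<^sup>2) * P" using P by (intro mult_left_mono) auto
    then show ?thesis by (simp add: distrib_right)
  qed
  finally have K: "\<bar>shell_rhs \<nu> \<alpha> a n\<bar> * ?r \<le> (c * M * \<nu> * B + 4 * (sqrt 2 * pi * B\<^sup>2)) * P" .
  have w: "sqrt 3 powr (- s * real n) = (sqrt 3 powr (- (1 + s))) ^ n * ?r"
    unfolding sqrt3_powr_nat[symmetric] powr_realpow[symmetric, of "sqrt 3", simplified] powr_add[symmetric]
    by (rule arg_cong[where f = "(powr) (sqrt 3)"]) (simp add: algebra_simps)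
  have PP: "(sqrt 3 powr (- (1 + s))) ^ n * P = (sqrt 3 powr (- (1 + s - 2 * alpha_t \<alpha>))) ^ n"
    unfolding P_def sqrt3_powr_nat[symmetric] powr_add[symmetric]
    by (rule arg_cong[where f = "(powr) (sqrt 3)"]) (simp add: algebra_simps)
  have "\<bar>sqrt 3 powr (- s * real n) * shell_rhs \<nu> \<alpha> a n\<bar> = (sqrt 3 powr (- (1 + s))) ^ n * (\<bar>shell_rhs \<nu> \<alpha> a n\<bar> * ?r)"
    unfolding w abs_mult by (simp add: abs_mult)
  also have "\<dots> \<le> (sqrt 3 powr (- (1 + s))) ^ n * ((c * M * \<nu> * B + 4 * (sqrt 2 * pi * B\<^sup>2)) * P)"
    by (rule mult_left_mono[OF K]) simp
  also have "\<dots> = (c * M * \<nu> * B + 4 * (sqrt 2 * pi * B\<^sup>2)) * (sqrt 3 powr (- (1 + s - 2 * alpha_t \<alpha>))) ^ n"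
    unfolding PP[symmetric] by (simp only: mult_ac)
  finally show ?thesis by (simp add: c_def M_def)
qed

text \<open>At the first time z with H z \<le> c the function H would have increased all the way
  from H 0 > c, which is absurd. So the differential inequality holds throughout, and 1 / H +
  \<kappa> t is strictly decreasing. Only continuity is asked for at the end points, since the
  derivative is known only at positive times.\<close>

lemma riccati_lower_bound:
  fixes H R :: "real \<Rightarrow> real"
  assumes t1: "0 < t1" and cont: "continuous_on {0..t1} H"
    and der: "\<And>t. 0 < t \<Longrightarrow> t < t1 \<Longrightarrow> (H has_real_derivative R t) (at t)"
    and R: "\<And>t. 0 < t \<Longrightarrow> t < t1 \<Longrightarrow> H t > c \<Longrightarrow> R t > \<kappa> * (H t)\<^sup>2"
    and c: "0 \<le> c" "c < H 0" and \<kappa>: "0 < \<kappa>"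
  shows "\<kappa> * H 0 * t1 < 1" and "H t1 > H 0 / (1 - \<kappa> * H 0 * t1)"
proof -
  have above: "H t > c" if t: "t \<in> {0..t1}" for t
  proof (rule ccontr)
    let ?Z = "{0..t1} \<inter> H -` {..c}"
    assume "\<not> H t > c"
    then have "?Z \<noteq> {}" using t by auto
    moreover have "compact ?Z"
    proof -
      have "closed ?Z" using cont by (intro continuous_closed_preimage) auto
      then show ?thesis by (simp add: compact_eq_bounded_closed bounded_Int)
    qed
    ultimately obtain z where z: "z \<in> ?Z" "\<And>y. y \<in> ?Z \<Longrightarrow> z \<le> y" using compact_attains_inf by metis
    have z0: "0 < z" using z(1) c by (cases "z = 0") auto
    have "H 0 < H z"
    proof (rule DERIV_pos_imp_increasing_open[OF z0])
      fix x assume x: "0 < x" "x < z"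
      then have "H x > c" using z by (metis IntI atLeastAtMost_iff atMost_iff dual_order.strict_trans1 dual_order.trans
            less_le_not_le not_less vimage_eq Int_iff less_imp_le)
      then have "R x > \<kappa> * (H x)\<^sup>2" using R x z(1) by simp
      moreover have "\<kappa> * (H x)\<^sup>2 \<ge> 0" using \<kappa> by simp
      ultimately show "\<exists>y. DERIV H x :> y \<and> y > 0" using der[of x] x z(1) by (intro exI[of _ "R x"]) auto
    qed (use z(1) in \<open>auto intro: continuous_on_subset[OF cont]\<close>)
    then show False using z(1) c by simp
  qed
  define F where "F t = 1 / H t + \<kappa> * t" for t
  have "F 0 > F t1"
  proof (rule DERIV_neg_imp_decreasing_open[OF t1])
    fix x assume x: "0 < x" "x < t1"
    have h: "H x > 0" "H x > c" using above[of x] x c by auto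
    have "(F has_real_derivative (- R x / (H x)\<^sup>2 + \<kappa>)) (at x)"
      unfolding F_def using h by (auto intro!: derivative_eq_intros der x simp: power2_eq_square)
    moreover have "- R x / (H x)\<^sup>2 + \<kappa> < 0" using R[OF x h(2)] h by (simp add: field_simps)
    ultimately show "\<exists>y. DERIV F x :> y \<and> y < 0" by blast
  next
    show "continuous_on {0..t1} F"
      unfolding F_def using above c by (intro continuous_intros cont) force
  qed
  then have F: "1 / H t1 + \<kappa> * t1 < 1 / H 0" by (simp add: F_def)
  have pos: "H 0 > 0" "H t1 > 0" using above[of 0] above[of t1] c t1 by auto
  have lt: "H 0 / H t1 < 1 - \<kappa> * H 0 * t1"
  proof -
    have "H 0 * (1 / H t1 + \<kappa> * t1) < H 0 * (1 / H 0)" using F pos by (intro mult_strict_left_mono)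
    then show ?thesis using pos by (simp add: algebra_simps)
  qed
  moreover have "H 0 / H t1 > 0" using pos by simp
  ultimately have d: "0 < 1 - \<kappa> * H 0 * t1" by linarith
  then show "\<kappa> * H 0 * t1 < 1" by simp
  show "H t1 > H 0 / (1 - \<kappa> * H 0 * t1)" using lt d pos by (simp add: field_simps)
qed

text \<open>\<open>riccati_lower_bound\<close> gives \<kappa> H(0) t < 1 for every positive t < T;
  were T larger than 1 / (\<kappa> H(0)), this very time would violate it.\<close>

theorem shell_blowup:
  fixes \<psi> :: "nat \<Rightarrow> real \<Rightarrow> real" and T :: ereal
  assumes \<alpha>: "0 < \<alpha>" and \<nu>: "0 < \<nu>" and s: "alpha_t \<alpha> < s" "s < 1/3"
    and ode: "\<And>t n. 0 < t \<Longrightarrow> ereal t < T \<Longrightarrow> (\<psi> n has_real_derivative shell_rhs \<nu> \<alpha> (\<lambda>m. \<psi> m t) n) (at t)"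
    and cont: "\<And>t n. 0 \<le> t \<Longrightarrow> ereal t < T \<Longrightarrow> continuous_on {0..t} (\<psi> n)"
    and bound: "\<And>t. 0 \<le> t \<Longrightarrow> ereal t < T \<Longrightarrow> \<exists>B. \<forall>n. \<forall>\<tau>\<in>{0..t}. \<bar>\<psi> n \<tau>\<bar> * sqrt 3 ^ n \<le> B"
    and H0: "lyap s (\<lambda>n. \<psi> n 0) > C_const \<alpha> s * \<nu>"
  shows "T \<le> ereal (1 / (kappa s * lyap s (\<lambda>n. \<psi> n 0)))"
    and "\<And>t. 0 \<le> t \<Longrightarrow> ereal t < T \<Longrightarrow> summable (lyap_term s (\<lambda>n. \<psi> n t))"
    and "\<And>t. 0 < t \<Longrightarrow> ereal t < T \<Longrightarrow> lyap s (\<lambda>n. \<psi> n t) >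
        lyap s (\<lambda>n. \<psi> n 0) / (1 - kappa s * lyap s (\<lambda>n. \<psi> n 0) * t)"
proof -
  have at: "0 < alpha_t \<alpha>" using \<alpha> by (simp add: alpha_t_def)
  have s0: "0 < 1 + s" "0 < 1 + s - 2 * alpha_t \<alpha>" "0 < 1 + s - 4 * alpha_t \<alpha>" using at s by auto
  note geo = summable_sqrt3_powr(1)[OF s0(1)]
  define H where "H t = lyap s (\<lambda>n. \<psi> n t)" for t
  define R where "R t = (\<Sum>n. sqrt 3 powr (- s * real n) * shell_rhs \<nu> \<alpha> (\<lambda>m. \<psi> m t) n)" for t
  show summ: "summable (lyap_term s (\<lambda>n. \<psi> n t))" if t: "0 \<le> t" "ereal t < T" for t
  proof -
    obtain B where B: "\<And>n \<tau>. \<tau> \<in> {0..t} \<Longrightarrow> \<bar>\<psi> n \<tau>\<bar> * sqrt 3 ^ n \<le> B" using bound[OF t] by blast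
    show ?thesis
      by (rule summable_comparison_test'[OF summable_mult[OF geo, of B]])
        (use lyap_term_bound[of "\<lambda>n. \<psi> n t" _ B s] B t in auto)
  qed
  have contH: "continuous_on {0..t} H" if t: "0 \<le> t" "ereal t < T" for t
  proof -
    obtain B where B: "\<And>n \<tau>. \<tau> \<in> {0..t} \<Longrightarrow> \<bar>\<psi> n \<tau>\<bar> * sqrt 3 ^ n \<le> B" using bound[OF t] by blast
    have "uniform_limit {0..t} (\<lambda>N \<tau>. \<Sum>n<N. lyap_term s (\<lambda>n. \<psi> n \<tau>) n) (\<lambda>\<tau>. \<Sum>n. lyap_term s (\<lambda>n. \<psi> n \<tau>) n) sequentially"
    proof (rule Weierstrass_m_test)
      show "norm (lyap_term s (\<lambda>n. \<psi> n \<tau>) n) \<le> B * (sqrt 3 powr (- (1 + s))) ^ n" if "\<tau> \<in> {0..t}" for n \<tau>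
        using lyap_term_bound[of "\<lambda>n. \<psi> n \<tau>" n B s] B[OF that] by simp
    qed (rule summable_mult[OF geo])
    then have "continuous_on {0..t} (\<lambda>\<tau>. \<Sum>n. lyap_term s (\<lambda>n. \<psi> n \<tau>) n)"
      by (rule uniform_limit_theorem[rotated])
        (auto intro!: always_eventually continuous_intros cont[OF t] simp: lyap_term_def)
    then show ?thesis by (simp add: H_def lyap_def)
  qed
  have der: "(H has_real_derivative R t) (at t)" if t: "0 < t" "ereal t < T" for t
  proof -
    \<comment> \<open>Termwise differentiation at t needs majorants on an open interval around t, so
      the bound is taken up to a later time.\<close>
    obtain t1 where t1: "ereal t < ereal t1" "ereal t1 < T" using ereal_dense2[OF t(2)] by blast
    have t01: "0 \<le> t1" using t t1(1) by simp
    obtain B where B: "\<And>n \<tau>. \<tau> \<in> {0..t1} \<Longrightarrow> \<bar>\<psi> n \<tau>\<bar> * sqrt 3 ^ n \<le> B" using bound[OF t01 t1(2)] by blast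
    have "((\<lambda>\<tau>. \<Sum>n. lyap_term s (\<lambda>n. \<psi> n \<tau>) n) has_field_derivative
        (\<Sum>n. sqrt 3 powr (- s * real n) * shell_rhs \<nu> \<alpha> (\<lambda>m. \<psi> m t) n)) (at t)"
    proof (rule has_field_derivative_series'(2)[where S = "{0<..<t1}" and x0 = t])
      show "((\<lambda>\<tau>. lyap_term s (\<lambda>n. \<psi> n \<tau>) n) has_field_derivative
          sqrt 3 powr (- s * real n) * shell_rhs \<nu> \<alpha> (\<lambda>m. \<psi> m x) n) (at x within {0<..<t1})"
        if x: "x \<in> {0<..<t1}" for n x
      proof -
        have "ereal x < T" using x t1(2) by (meson ereal_less(2) greaterThanLessThan_iff less_ereal.simps(1) less_trans)
        then show ?thesis
          unfolding lyap_term_def using x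
          by (intro DERIV_cmult has_field_derivative_at_within[OF ode]) auto
      qed
      show "uniformly_convergent_on {0<..<t1} (\<lambda>N \<tau>. \<Sum>n<N. sqrt 3 powr (- s * real n) * shell_rhs \<nu> \<alpha> (\<lambda>m. \<psi> m \<tau>) n)"
      proof (rule Weierstrass_m_test')
        show "norm (sqrt 3 powr (- s * real n) * shell_rhs \<nu> \<alpha> (\<lambda>m. \<psi> m \<tau>) n) \<le>
          ((12 * pi\<^sup>2) powr \<alpha> * (5/3) powr \<alpha> * \<nu> * B + 4 * (sqrt 2 * pi * B\<^sup>2)) * (sqrt 3 powr (- (1 + s - 2 * alpha_t \<alpha>))) ^ n"
          if "\<tau> \<in> {0<..<t1}" for n \<tau>
          unfolding real_norm_def using B that by (intro lyap_rhs_bound \<alpha> \<nu>) auto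
      qed (rule summable_mult[OF summable_sqrt3_powr(1)[OF s0(2)]])
      show "summable (\<lambda>n. lyap_term s (\<lambda>n. \<psi> n t) n)" using summ[of t] t by simp
    qed (use t t1(1) in auto)
    then show ?thesis unfolding H_def R_def lyap_def .
  qed
  have RH: "R t > kappa s * (H t)\<^sup>2" if t: "0 < t" "ereal t < T" "H t > C_const \<alpha> s * \<nu>" for t
  proof -
    obtain B where B: "\<And>n \<tau>. \<tau> \<in> {0..t} \<Longrightarrow> \<bar>\<psi> n \<tau>\<bar> * sqrt 3 ^ n \<le> B" using bound[of t] t by force
    show ?thesis
      unfolding R_def H_def using B t by (intro lyap_rhs[OF \<alpha> \<nu> s, of _ B]) (auto simp: H_def)
  qed
  have G: "sqrt 3 powr (1 - s) - sqrt 3 powr ((1 + s) / 2) > 0" using s by (simp add: powr_less_mono)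
  have kap: "kappa s > 0" unfolding kappa_def using G summable_sqrt3_powr(3)[OF s0(1)] by (intro mult_pos_pos) auto
  have C0: "0 \<le> C_const \<alpha> s * \<nu>"
    unfolding C_const_def using G summable_sqrt3_powr(3)[OF s0(1)] summable_sqrt3_powr(3)[OF s0(3)] \<nu>
    by (intro mult_nonneg_nonneg divide_nonneg_nonneg) auto
  have H0': "C_const \<alpha> s * \<nu> < H 0" using H0 by (simp add: H_def)
  have key: "kappa s * H 0 * t < 1" "H t > H 0 / (1 - kappa s * H 0 * t)" if t: "0 < t" "ereal t < T" for t
  proof -
    have lt: "ereal x < T" if "x < t" for x using that t(2) by (meson less_ereal.simps(1) less_trans)
    note r = riccati_lower_bound[OF t(1) contH[OF less_imp_le[OF t(1)] t(2)] der[OF _ lt] RH[OF _ lt] C0 H0' kap]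
    show "kappa s * H 0 * t < 1" "H t > H 0 / (1 - kappa s * H 0 * t)" using r by blast+
  qed
  then show "lyap s (\<lambda>n. \<psi> n t) > lyap s (\<lambda>n. \<psi> n 0) / (1 - kappa s * lyap s (\<lambda>n. \<psi> n 0) * t)"
    if "0 < t" "ereal t < T" for t using that by (simp add: H_def)
  have "H 0 > 0" using C0 H0' by linarith
  show "T \<le> ereal (1 / (kappa s * lyap s (\<lambda>n. \<psi> n 0)))"
  proof (rule ccontr)
    assume "\<not> T \<le> ereal (1 / (kappa s * lyap s (\<lambda>n. \<psi> n 0)))"
    then have "ereal (1 / (kappa s * H 0)) < T" by (simp add: H_def)
    moreover have "0 < 1 / (kappa s * H 0)" using kap \<open>H 0 > 0\<close> by simp
    ultimately have "kappa s * H 0 * (1 / (kappa s * H 0)) < 1" by (intro key)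
    then show False using kap \<open>H 0 > 0\<close> by simp
  qed
qed

section \<open>The coefficient system and its uniqueness\<close>

text \<open>The minus signs cancel in the quadratic terms, and conjugation reverses the sign of the
  prefactor \<i>. For a real field the map corresponds to u(x) -> - u(- x).\<close>

lemma shell_nonlin_conj: "shell_nonlin (\<lambda>k. - cnj (c k)) n k = - cnj (shell_nonlin c n k)"
  by (cases n) (simp_all add: shell_nonlin_def case_prod_unfold)

text \<open>The estimate holds for every pair of summands, so the triads at two different
  frequencies can be matched arbitrarily.\<close>

lemma sum_card2_diff:
  fixes f :: "'a \<Rightarrow> complex"
  assumes "card A = 2" "card A' = 2" "\<And>x y. x \<in> A \<Longrightarrow> y \<in> A' \<Longrightarrow> norm (f x - g y) \<le> e"
  shows "norm (sum f A - sum g A') \<le> 2 * e"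
proof -
  obtain x1 x2 where A: "A = {x1, x2}" "x1 \<noteq> x2" using assms(1) by (meson card_2_iff)
  obtain y1 y2 where A': "A' = {y1, y2}" "y1 \<noteq> y2" using assms(2) by (meson card_2_iff)
  have "sum f A - sum g A' = (f x1 - g y1) + (f x2 - g y2)" using A A' by simp
  also have "norm \<dots> \<le> norm (f x1 - g y1) + norm (f x2 - g y2)" by (rule norm_triangle_ineq)
  also have "\<dots> \<le> e + e" using assms(3) A A' by (intro add_mono) auto
  finally show ?thesis by simp
qed

lemma norm_mult_diff:
  fixes a b a' b' :: complex
  assumes "norm (a - a') \<le> M" "norm (b - b') \<le> M'" "norm a' \<le> C" "norm b \<le> C'"
  shows "norm (a * b - a' * b') \<le> M * C' + C * M'"
proof -
  have "a * b - a' * b' = (a - a') * b + a' * (b - b')" by (simp add: algebra_simps)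
  also have "norm \<dots> \<le> norm (a - a') * norm b + norm a' * norm (b - b')"
    by (rule order_trans[OF norm_triangle_ineq]) (simp add: norm_mult)
  also have "\<dots> \<le> M * C' + C * M'"
    using assms norm_ge_zero[of "a - a'"] norm_ge_zero[of a'] by (intro add_mono mult_mono) (auto intro: order_trans[OF norm_ge_zero])
  finally show ?thesis .
qed

lemma Kn_bounds: "0 \<le> Kn n" "Kn n \<le> sqrt 3 ^ n"
proof -
  have b: "0 \<le> beta n" "beta n \<le> 1" using beta_bounds[of n] by auto
  then show "0 \<le> Kn n" by (simp add: Kn_def)
  have "sqrt 6 \<le> 4" by (rule real_le_lsqrt) auto
  then have "sqrt 6 / 4 * sqrt 3 ^ n * beta n \<le> 1 * sqrt 3 ^ n * 1"
    using b by (intro mult_mono) auto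
  then show "Kn n \<le> sqrt 3 ^ n" by (simp add: Kn_def)
qed

text \<open>All frequencies of a shell see the same number of triads with the same coefficients, so the
  nonlinear terms of two solutions at two different frequencies of a shell can be compared.\<close>

lemma shell_nonlin_diff:
  assumes c: "\<And>j a. a \<in> Mshell j \<Longrightarrow> norm (c a) * sqrt 3 ^ j \<le> B"
    and d: "\<And>j a. a \<in> Mshell j \<Longrightarrow> norm (d a) * sqrt 3 ^ j \<le> B"
    and cd: "\<And>j a a'. a \<in> Mshell j \<Longrightarrow> a' \<in> Mshell j \<Longrightarrow> norm (c a - d a') * sqrt 3 ^ j \<le> M"
    and k: "k \<in> Mshell n" "k' \<in> Mshell n"
  shows "norm (shell_nonlin c n k - shell_nonlin d n k') * sqrt 3 ^ n \<le> 24 * pi * B * M"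
proof -
  define r where "r j = 1 / sqrt 3 ^ j" for j
  have rpos: "r j > 0" for j by (simp add: r_def)
  have c': "norm (c a) \<le> B * r j" if "a \<in> Mshell j" for a j using c[OF that] by (simp add: r_def field_simps)
  have d': "norm (d a) \<le> B * r j" if "a \<in> Mshell j" for a j using d[OF that] by (simp add: r_def field_simps)
  have cd': "norm (c a - d a') \<le> M * r j" if "a \<in> Mshell j" "a' \<in> Mshell j" for a a' j
    using cd[OF that] by (simp add: r_def field_simps)
  have B0: "0 \<le> B" using c[OF k(1)] by (rule order_trans[rotated]) simp
  have M0: "0 \<le> M" using cd[OF k] by (rule order_trans[rotated]) simp
  define U where "U c n k = (case n of 0 \<Rightarrow> 0 | Suc m \<Rightarrow> of_real (Kn m) * (\<Sum>(a, b)\<in>sum_pairs m k. c a * c b))"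
    for c :: "int^3 \<Rightarrow> complex" and n k
  define D where "D c n k = (\<Sum>(a, b)\<in>diff_pairs n k. c a * cnj (c b))"
    for c :: "int^3 \<Rightarrow> complex" and n k
  \<comment> \<open>8 is two pairs times two products, times sqrt 3 rounded up to 2 for the passage
    from shell m to shell n. The other sum contributes 4, and 2 pi (8 + 4) = 24 pi.\<close>
  have U: "norm (U c n k - U d n k') \<le> 8 * B * M * r n"
  proof (cases n)
    case 0
    then show ?thesis using B0 M0 rpos[of 0] by (simp add: U_def)
  next
    case (Suc m)
    have "norm ((\<Sum>(a, b)\<in>sum_pairs m k. c a * c b)
       - (\<Sum>(a, b)\<in>sum_pairs m k'. d a * d b)) \<le> 2 * ((M * r m) * (B * r m) + (B * r m) * (M * r m))"
    proof (rule sum_card2_diff)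
      fix x y
      assume "x \<in> sum_pairs m k" "y \<in> sum_pairs m k'"
      then obtain a b a' b' where xy: "x = (a, b)" "y = (a', b')" "a \<in> Mshell m" "b \<in> Mshell m" "a' \<in> Mshell m" "b' \<in> Mshell m"
        by auto
      show "norm ((case x of (a, b) \<Rightarrow> c a * c b) - (case y of (a, b) \<Rightarrow> d a * d b)) \<le> (M * r m) * (B * r m) + (B * r m) * (M * r m)"
        unfolding xy(1,2) prod.case by (intro norm_mult_diff c' d' cd' xy)
    qed (use k Suc card_shell_sums in auto)
    then have "Kn m * norm ((\<Sum>(a, b)\<in>sum_pairs m k. c a * c b)
       - (\<Sum>(a, b)\<in>sum_pairs m k'. d a * d b)) \<le> sqrt 3 ^ m * (2 * ((M * r m) * (B * r m) + (B * r m) * (M * r m)))"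
      using Kn_bounds[of m] by (intro mult_mono) auto
    also have "\<dots> = 4 * B * M * r m" by (simp add: r_def)
    also have "\<dots> \<le> 4 * B * M * (2 * r n)"
    proof (rule mult_left_mono)
      have "sqrt 3 \<le> 2" by (rule real_le_lsqrt) auto
      then show "r m \<le> 2 * r n" by (simp add: r_def Suc field_simps)
    qed (use B0 M0 in simp)
    finally show ?thesis
      using Kn_bounds(1)[of m] by (simp add: U_def Suc norm_mult flip: right_diff_distrib)
  qed
  have D: "norm (of_real (Kn n) * D c n k - of_real (Kn n) * D d n k') \<le> 4 * B * M * r n"
  proof -
    have "norm (D c n k - D d n k') \<le> 2 * ((M * r (Suc n)) * (B * r n) + (B * r (Suc n)) * (M * r n))"
      unfolding D_def
    proof (rule sum_card2_diff)
      fix x y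
      assume "x \<in> diff_pairs n k" "y \<in> diff_pairs n k'"
      then obtain a b a' b' where xy: "x = (a, b)" "y = (a', b')" "a \<in> Mshell (Suc n)" "b \<in> Mshell n" "a' \<in> Mshell (Suc n)" "b' \<in> Mshell n"
        by auto
      have "norm (cnj (c b) - cnj (d b')) = norm (c b - d b')" by (metis complex_cnj_diff complex_mod_cnj)
      then show "norm ((case x of (a, b) \<Rightarrow> c a * cnj (c b)) - (case y of (a, b) \<Rightarrow> d a * cnj (d b))) \<le> (M * r (Suc n)) * (B * r n) + (B * r (Suc n)) * (M * r n)"
        unfolding xy(1,2) prod.case using cd'[OF xy(4,6)] c'[OF xy(4)] by (intro norm_mult_diff d' cd' xy) auto
    qed (use k card_shell_diffs in auto)
    then have "Kn n * norm (D c n k - D d n k') \<le> sqrt 3 ^ n * (2 * ((M * r (Suc n)) * (B * r n) + (B * r (Suc n)) * (M * r n)))"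
      using Kn_bounds[of n] by (intro mult_mono) auto
    also have "\<dots> = 4 * B * M * r (Suc n)" by (simp add: r_def)
    also have "\<dots> \<le> 4 * B * M * r n"
      using B0 M0 by (intro mult_left_mono) (auto simp: r_def field_simps)
    finally show ?thesis using Kn_bounds(1)[of n] by (simp add: norm_mult flip: right_diff_distrib)
  qed
  have "shell_nonlin c n k - shell_nonlin d n k' = 2 * of_real pi * \<i> *
    ((U c n k - U d n k') + (of_real (Kn n) * D c n k - of_real (Kn n) * D d n k'))"
    by (simp add: shell_nonlin_def U_def D_def algebra_simps)
  then have "norm (shell_nonlin c n k - shell_nonlin d n k') =
    2 * pi * norm ((U c n k - U d n k') + (of_real (Kn n) * D c n k - of_real (Kn n) * D d n k'))"
    by (simp add: norm_mult)
  also have "\<dots> \<le> 2 * pi * (8 * B * M * r n + 4 * B * M * r n)"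
    using norm_triangle_ineq[THEN order_trans, OF add_mono[OF U D]] by (intro mult_left_mono) auto
  finally have "norm (shell_nonlin c n k - shell_nonlin d n k') \<le> 24 * pi * B * M * r n" by (simp add: algebra_simps)
  then show ?thesis by (simp add: r_def field_simps)
qed

text \<open>The Duhamel formula on the positive shells, with a damping rate that depends only on the
  shell and a bound in the critical weight. It speaks of arbitrary coefficient families, so it also
  applies to the negated conjugate of a solution.\<close>

definition shell_mild :: "real \<Rightarrow> (nat \<Rightarrow> real) \<Rightarrow> real \<Rightarrow> (int^3 \<Rightarrow> complex) \<Rightarrow> (real \<Rightarrow> int^3 \<Rightarrow> complex) \<Rightarrow> bool" where
  "shell_mild B l t1 c0 c \<longleftrightarrow>
    (\<forall>t\<in>{0..t1}. \<forall>n. \<forall>k\<in>Mshell n. norm (c t k) * sqrt 3 ^ n \<le> B) \<and>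
    (\<forall>n. \<forall>k\<in>Mshell n. continuous_on {0..t1} (\<lambda>t. c t k)) \<and>
    (\<forall>t\<in>{0..t1}. \<forall>n. \<forall>k\<in>Mshell n. c t k = exp (- t * l n) *\<^sub>R c0 k
        - integral {0..t} (\<lambda>\<tau>. exp (- (t - \<tau>) * l n) *\<^sub>R shell_nonlin (c \<tau>) n k))"

lemma shell_mildD:
  assumes "shell_mild B l t1 c0 c" "k \<in> Mshell n"
  shows "t \<in> {0..t1} \<Longrightarrow> norm (c t k) * sqrt 3 ^ n \<le> B"
    and "continuous_on {0..t1} (\<lambda>t. c t k)"
    and "t \<in> {0..t1} \<Longrightarrow> c t k = exp (- t * l n) *\<^sub>R c0 k
        - integral {0..t} (\<lambda>\<tau>. exp (- (t - \<tau>) * l n) *\<^sub>R shell_nonlin (c \<tau>) n k)"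
  using assms unfolding shell_mild_def by blast+

lemma continuous_on_shell_nonlin:
  assumes "\<And>n k. k \<in> Mshell n \<Longrightarrow> continuous_on S (\<lambda>t. c t k)"
  shows "continuous_on S (\<lambda>t. shell_nonlin (c t) n k)"
  unfolding shell_nonlin_def case_prod_unfold
  by (cases n) (auto intro!: continuous_intros assms)

lemma shell_mild_conj:
  assumes "shell_mild B l t1 c0 c"
  shows "shell_mild B l t1 (\<lambda>k. - cnj (c0 k)) (\<lambda>t k. - cnj (c t k))"
  unfolding shell_mild_def
proof (intro conjI ballI allI)
  fix n k assume k: "k \<in> Mshell n"
  show "continuous_on {0..t1} (\<lambda>t. - cnj (c t k))"
    by (intro continuous_intros shell_mildD(2)[OF assms k])
  fix t assume t: "t \<in> {0..t1}"
  show "norm (- cnj (c t k)) * sqrt 3 ^ n \<le> B" using shell_mildD(1)[OF assms k t] by simp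
  have "c t k = exp (- t * l n) *\<^sub>R c0 k
        - integral {0..t} (\<lambda>\<tau>. exp (- (t - \<tau>) * l n) *\<^sub>R shell_nonlin (c \<tau>) n k)"
    by (rule shell_mildD(3)[OF assms k t])
  then have "cnj (c t k) = cnj (exp (- t * l n) *\<^sub>R c0 k
        - integral {0..t} (\<lambda>\<tau>. exp (- (t - \<tau>) * l n) *\<^sub>R shell_nonlin (c \<tau>) n k))" by (rule arg_cong)
  then have "cnj (c t k) = exp (- t * l n) *\<^sub>R cnj (c0 k)
        - integral {0..t} (\<lambda>\<tau>. exp (- (t - \<tau>) * l n) *\<^sub>R cnj (shell_nonlin (c \<tau>) n k))"
    by (simp only: complex_cnj_diff complex_cnj_scaleR Henstock_Kurzweil_Integration.integral_cnj)
  then show "- cnj (c t k) = exp (- t * l n) *\<^sub>R - cnj (c0 k)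
        - integral {0..t} (\<lambda>\<tau>. exp (- (t - \<tau>) * l n) *\<^sub>R shell_nonlin (\<lambda>k. - cnj (c \<tau> k)) n k)"
    by (simp add: shell_nonlin_conj)
qed

lemma has_integral_power_fact:
  assumes "0 \<le> t"
  shows "((\<lambda>\<tau>. C * (L * \<tau>) ^ j / fact j * L) has_integral (C * (L * t) ^ Suc j / fact (Suc j))) {0..t::real}"
proof -
  have "((\<lambda>\<tau>. C * (L * \<tau>) ^ j / fact j * L) has_integral (C * (L * t) ^ Suc j / fact (Suc j) - C * (L * 0) ^ Suc j / fact (Suc j))) {0..t}"
  proof (rule fundamental_theorem_of_calculus[OF assms])
    fix x
    have "((\<lambda>\<tau>. L * \<tau>) has_real_derivative L) (at x within {0..t})"
      by (auto intro!: derivative_eq_intros)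
    from DERIV_cdivide[OF DERIV_cmult[OF DERIV_power_Suc[OF this, of j], of C], of "fact (Suc j)"]
    have "((\<lambda>\<tau>. C * (L * \<tau>) ^ Suc j / fact (Suc j)) has_real_derivative C * (real (Suc j) * (L * x) ^ j * L) / fact (Suc j)) (at x within {0..t})"
      by (simp only: of_nat_Suc mult_ac)
    moreover have "C * (real (Suc j) * (L * x) ^ j * L) / fact (Suc j) = C * (L * x) ^ j / fact j * L"
      unfolding fact_Suc of_nat_mult by (simp add: field_simps del: of_nat_Suc)
    ultimately show "((\<lambda>\<tau>. C * (L * \<tau>) ^ Suc j / fact (Suc j)) has_vector_derivative C * (L * x) ^ j / fact j * L) (at x within {0..t})"
      by (simp only: has_real_derivative_iff_has_vector_derivative)
  qed
  then show ?thesis by simp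
qed

text \<open>Picard iteration: the difference is bounded by \<open>2 B (L t)\<^sup>j / j!\<close> for every \<open>j\<close>.\<close>

theorem shell_mild_unique:
  assumes c: "shell_mild B l t1 c0 c" and d: "shell_mild B l t1 d0 d"
    and l: "\<And>n. 0 \<le> l n"
    and init: "\<And>n k k'. k \<in> Mshell n \<Longrightarrow> k' \<in> Mshell n \<Longrightarrow> c0 k = d0 k'"
    and t: "t \<in> {0..t1}" and k: "k \<in> Mshell n" "k' \<in> Mshell n"
  shows "c t k = d t k'"
proof -
  define L where "L = 24 * pi * B"
  have cB: "norm (c t k) * sqrt 3 ^ n \<le> B" "norm (d t k) * sqrt 3 ^ n \<le> B" if "t \<in> {0..t1}" "k \<in> Mshell n" for t n k
    using shell_mildD(1)[OF c that(2,1)] shell_mildD(1)[OF d that(2,1)] by auto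
  have B0: "0 \<le> B" using cB(1)[OF t k(1)] by (rule order_trans[rotated]) simp
  have L0: "0 \<le> L" using B0 by (simp add: L_def)
  have nc: "continuous_on {0..t} (\<lambda>\<tau>. shell_nonlin (c \<tau>) n k)" "continuous_on {0..t} (\<lambda>\<tau>. shell_nonlin (d \<tau>) n k)"
    if "t \<in> {0..t1}" for t n k
    using that
    by (intro continuous_on_shell_nonlin continuous_on_subset[OF shell_mildD(2)[OF c]] continuous_on_subset[OF shell_mildD(2)[OF d]], auto)+
  \<comment> \<open>The induction treats all pairs of frequencies of one shell at once, because
    \<open>shell_nonlin_diff\<close> consumes the bound for all such pairs in the neighbouring
    shells.\<close>
  have bound: "norm (c t k - d t k') * sqrt 3 ^ n \<le> 2 * B * (L * t) ^ j / fact j"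
    if "t \<in> {0..t1}" "k \<in> Mshell n" "k' \<in> Mshell n" for j t n k k'
    using that
  proof (induction j arbitrary: t n k k')
    case 0
    have "norm (c t k - d t k') * sqrt 3 ^ n \<le> (norm (c t k) + norm (d t k')) * sqrt 3 ^ n"
      by (intro mult_right_mono norm_triangle_ineq4) simp
    also have "\<dots> \<le> 2 * B" using cB(1)[OF 0(1,2)] cB(2)[OF 0(1,3)] by (simp add: distrib_right)
    finally show ?case by simp
  next
    case (Suc j)
    let ?e = "\<lambda>\<tau>. exp (- (t - \<tau>) * l n)"
    let ?N = "\<lambda>\<tau>. shell_nonlin (c \<tau>) n k - shell_nonlin (d \<tau>) n k'"
    have t0: "0 \<le> t" using Suc.prems by simp
    have ci: "(\<lambda>\<tau>. ?e \<tau> *\<^sub>R shell_nonlin (c \<tau>) n k) integrable_on {0..t}"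
      "(\<lambda>\<tau>. ?e \<tau> *\<^sub>R shell_nonlin (d \<tau>) n k') integrable_on {0..t}"
      using nc[OF Suc.prems(1)] by (auto intro!: integrable_continuous_interval continuous_intros)
    have "c t k - d t k' = - integral {0..t} (\<lambda>\<tau>. ?e \<tau> *\<^sub>R ?N \<tau>)"
    proof -
      have "c t k = exp (- t * l n) *\<^sub>R c0 k - integral {0..t} (\<lambda>\<tau>. ?e \<tau> *\<^sub>R shell_nonlin (c \<tau>) n k)"
        "d t k' = exp (- t * l n) *\<^sub>R d0 k' - integral {0..t} (\<lambda>\<tau>. ?e \<tau> *\<^sub>R shell_nonlin (d \<tau>) n k')"
        by (rule shell_mildD(3)[OF c Suc.prems(2,1)] shell_mildD(3)[OF d Suc.prems(3,1)])+
      then show ?thesis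
        using init[OF Suc.prems(2,3)] Henstock_Kurzweil_Integration.integral_diff[OF ci]
        by (simp add: scaleR_diff_right)
    qed
    then have "norm (c t k - d t k') = norm (integral {0..t} (\<lambda>\<tau>. ?e \<tau> *\<^sub>R ?N \<tau>))" by simp
    also have "\<dots> \<le> integral {0..t} (\<lambda>\<tau>. (2 * B * (L * \<tau>) ^ j / fact j * L) / sqrt 3 ^ n)"
    proof (rule integral_norm_bound_integral)
      show "(\<lambda>\<tau>. ?e \<tau> *\<^sub>R ?N \<tau>) integrable_on {0..t}"
        using Henstock_Kurzweil_Integration.integrable_diff[OF ci] by (simp add: scaleR_diff_right)
      show "(\<lambda>\<tau>. (2 * B * (L * \<tau>) ^ j / fact j * L) / sqrt 3 ^ n) integrable_on {0..t}"
        by (intro integrable_continuous_interval continuous_intros) auto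
      fix \<tau> assume \<tau>: "\<tau> \<in> {0..t}"
      then have \<tau>1: "\<tau> \<in> {0..t1}" using Suc.prems by auto
      have "norm (?N \<tau>) * sqrt 3 ^ n \<le> 24 * pi * B * (2 * B * (L * \<tau>) ^ j / fact j)"
        by (rule shell_nonlin_diff[OF _ _ _ Suc.prems(2,3)]) (use cB[OF \<tau>1] Suc.IH[OF \<tau>1] in auto)
      then have "norm (?N \<tau>) \<le> (2 * B * (L * \<tau>) ^ j / fact j * L) / sqrt 3 ^ n"
        by (simp add: L_def field_simps)
      moreover have "norm (?e \<tau> *\<^sub>R ?N \<tau>) \<le> 1 * norm (?N \<tau>)"
      proof -
        have "(\<tau> - t) * l n \<le> 0" using \<tau> l[of n] by (intro mult_nonpos_nonneg) auto
        then show ?thesis unfolding norm_scaleR by (intro mult_right_mono) auto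
      qed
      ultimately show "norm (?e \<tau> *\<^sub>R ?N \<tau>) \<le> (2 * B * (L * \<tau>) ^ j / fact j * L) / sqrt 3 ^ n" by linarith
    qed
    also have "\<dots> = (2 * B * (L * t) ^ Suc j / fact (Suc j)) / sqrt 3 ^ n"
      by (intro integral_unique has_integral_divide has_integral_power_fact t0)
    finally show ?case by (subst (asm) pos_le_divide_eq) simp_all
  qed
  have "(\<lambda>j. 2 * B * (L * t) ^ j / fact j) \<longlonglongrightarrow> 2 * B * 0"
  proof -
    have "(\<lambda>j. (L * t) ^ j / fact j) \<longlonglongrightarrow> 0"
      using summable_LIMSEQ_zero[OF summable_exp[of "L * t"]] by (simp add: field_simps)
    from tendsto_mult_left[OF this, of "2 * B"] show ?thesis by simp
  qed
  then have "norm (c t k - d t k') * sqrt 3 ^ n \<le> 2 * B * 0"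
    using bound[OF t k] by (intro LIMSEQ_le_const) auto
  then have "norm (c t k - d t k') * sqrt 3 ^ n \<le> 0" by simp
  then have "norm (c t k - d t k') \<le> 0"
    by (intro mult_right_le_imp_le[of _ "sqrt 3 ^ n" 0]) simp_all
  then show ?thesis by simp
qed


section \<open>From mild solutions to the coefficient system\<close>

definition shell_rate :: "real \<Rightarrow> nat \<Rightarrow> real" where
  "shell_rate \<alpha> n = (12 * pi\<^sup>2) powr \<alpha> * mu n powr (- 2 * \<alpha>) * sqrt 3 powr (2 * alpha_t \<alpha> * real n)"

lemma coef_diff:
  assumes "u \<in> HdotM s" "w \<in> HdotM s"
  shows "coef (\<lambda>x. u x - w x) k = coef u k - coef w k"
proof -
  have "torus_L2 u" "torus_L2 w" using assms by (auto simp: HdotM_def Hdot_def)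
  from fhat_diff[OF this] show ?thesis by (simp add: coef_def right_diff_distrib sum_subtractf)
qed

lemma coef_cong_AE:
  assumes "torus_L2 u" "torus_L2 w" "AE x in lebesgue. u x = w x"
  shows "fhat u k = fhat w k"
proof -
  have "AE x in unit_cube. u x = w x"
    using assms(3) by (simp add: AE_restrict_space_iff) (auto elim: eventually_mono)
  then have "(LINT x|unit_cube. complex_of_real (u x $ i) * echar (- k) x) = (LINT x|unit_cube. complex_of_real (w x $ i) * echar (- k) x)" for i
    using integrable_fcoeff[OF torus_L2_integrable[OF assms(1), of i], of "- k"]
      integrable_fcoeff[OF torus_L2_integrable[OF assms(2), of i], of "- k"]
    by (intro integral_cong_AE) (auto elim: eventually_mono)
  then show ?thesis by (simp add: fhat_def fcoeff_echar)
qed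

context
  fixes \<nu> \<alpha> :: real and u0 :: "real^3 \<Rightarrow> real^3" and u :: "real \<Rightarrow> real^3 \<Rightarrow> real^3" and T :: ereal
  assumes \<nu>: "0 < \<nu>" and u0: "u0 \<in> HdotM s_crit" and mild: "mild_solution \<nu> \<alpha> s_crit u0 u T"
begin

lemma mild_HdotM: "0 \<le> t \<Longrightarrow> ereal t < T \<Longrightarrow> u t \<in> HdotM s_crit"
  using mild by (simp add: mild_solution_def)

lemma mild_tendsto:
  "0 \<le> t0 \<Longrightarrow> ereal t0 < T \<Longrightarrow>
    ((\<lambda>t. Hdot_norm s_crit (\<lambda>x. u t x - u t0 x)) \<longlongrightarrow> 0) (at t0 within {t. 0 \<le> t \<and> ereal t < T})"
  using mild by (simp add: mild_solution_def)

lemma mild_coef_diff: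
  assumes "0 \<le> t" "ereal t < T" "0 \<le> t0" "ereal t0 < T" "k \<in> shellpm n"
  shows "norm (coef (u t) k - coef (u t0) k) * sqrt 3 ^ n \<le> Hdot_norm s_crit (\<lambda>x. u t x - u t0 x)"
  using coef_bound[OF HdotM_diff[OF mild_HdotM[OF assms(1,2)] mild_HdotM[OF assms(3,4)]] assms(5)]
  by (simp add: coef_diff[OF mild_HdotM[OF assms(1,2)] mild_HdotM[OF assms(3,4)]])

lemma mild_coef_continuous:
  assumes k: "k \<in> shellpm n"
  shows "continuous_on {t. 0 \<le> t \<and> ereal t < T} (\<lambda>t. coef (u t) k)"
  unfolding continuous_on_def
proof
  fix t0 assume t0: "t0 \<in> {t. 0 \<le> t \<and> ereal t < T}"
  let ?F = "at t0 within {t. 0 \<le> t \<and> ereal t < T}"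
  have "((\<lambda>t. coef (u t) k - coef (u t0) k) \<longlongrightarrow> 0) ?F"
  proof (rule Lim_null_comparison)
    show "((\<lambda>t. Hdot_norm s_crit (\<lambda>x. u t x - u t0 x)) \<longlongrightarrow> 0) ?F" using t0 by (intro mild_tendsto) auto
    show "\<forall>\<^sub>F t in ?F. norm (coef (u t) k - coef (u t0) k) \<le> Hdot_norm s_crit (\<lambda>x. u t x - u t0 x)"
      unfolding eventually_at_filter
    proof (rule always_eventually, intro allI impI)
      fix t assume t: "t \<in> {t. 0 \<le> t \<and> ereal t < T}"
      have "norm (coef (u t) k - coef (u t0) k) * 1 \<le> norm (coef (u t) k - coef (u t0) k) * sqrt 3 ^ n"
        by (intro mult_left_mono one_le_power) auto
      also have "\<dots> \<le> Hdot_norm s_crit (\<lambda>x. u t x - u t0 x)" using t t0 by (intro mild_coef_diff k) auto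
      finally show "norm (coef (u t) k - coef (u t0) k) \<le> Hdot_norm s_crit (\<lambda>x. u t x - u t0 x)" by simp
    qed
  qed
  then show "((\<lambda>t. coef (u t) k) \<longlongrightarrow> coef (u t0) k) ?F" by (rule LIM_zero_cancel)
qed

text \<open>Continuity in the critical norm gives a bound near each time, uniform in n and k.
  Bisection of the compact interval glues these local bounds together.\<close>

lemma mild_coef_bounded:
  assumes t1: "0 \<le> t1" "ereal t1 < T"
  shows "\<exists>B. \<forall>t\<in>{0..t1}. \<forall>n. \<forall>k\<in>shellpm n. norm (coef (u t) k) * sqrt 3 ^ n \<le> B"
proof -
  define P where "P a b \<longleftrightarrow> (\<exists>B. \<forall>t\<in>{a..b} \<inter> {0..t1}. \<forall>n. \<forall>k\<in>shellpm n. norm (coef (u t) k) * sqrt 3 ^ n \<le> B)" for a b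
  have lt: "ereal t < T" if "t \<le> t1" for t using that t1(2) by (meson ereal_less_eq(3) le_less_trans)
  from t1(1) have "P 0 t1"
  proof (induction rule: Bolzano)
    case (trans a b c)
    obtain B where B: "\<forall>t\<in>{a..b} \<inter> {0..t1}. \<forall>n. \<forall>k\<in>shellpm n. norm (coef (u t) k) * sqrt 3 ^ n \<le> B"
      using trans(1) unfolding P_def by blast
    obtain C where C: "\<forall>t\<in>{b..c} \<inter> {0..t1}. \<forall>n. \<forall>k\<in>shellpm n. norm (coef (u t) k) * sqrt 3 ^ n \<le> C"
      using trans(2) unfolding P_def by blast
    have "norm (coef (u t) k) * sqrt 3 ^ n \<le> max B C" if "t \<in> {a..c} \<inter> {0..t1}" "k \<in> shellpm n" for t n k
    proof (cases "t \<le> b")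
      case True
      then have "norm (coef (u t) k) * sqrt 3 ^ n \<le> B" using B that by auto
      then show ?thesis by simp
    next
      case False
      then have "norm (coef (u t) k) * sqrt 3 ^ n \<le> C" using C that by auto
      then show ?thesis by simp
    qed
    then show ?case unfolding P_def by blast
  next
    case (local x)
    have xT: "0 \<le> x" "ereal x < T" using local lt by auto
    have "\<forall>\<^sub>F t in at x within {t. 0 \<le> t \<and> ereal t < T}. Hdot_norm s_crit (\<lambda>y. u t y - u x y) < 1"
      using mild_tendsto[OF xT] by (rule order_tendstoD) simp
    then obtain d where d: "d > 0" "\<And>t. 0 \<le> t \<Longrightarrow> ereal t < T \<Longrightarrow> t \<noteq> x \<Longrightarrow> dist t x < d \<Longrightarrow> Hdot_norm s_crit (\<lambda>y. u t y - u x y) < 1"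
      unfolding eventually_at by blast
    have "P a b" if ab: "a \<le> x" "x \<le> b" "b - a < d" for a b
      unfolding P_def
    proof (intro exI[of _ "1 + Hdot_norm s_crit (u x)"] ballI allI)
      fix t n k assume t: "t \<in> {a..b} \<inter> {0..t1}" and k: "k \<in> shellpm n"
      have x: "norm (coef (u x) k) * sqrt 3 ^ n \<le> Hdot_norm s_crit (u x)" by (rule coef_bound[OF mild_HdotM[OF xT] k])
      show "norm (coef (u t) k) * sqrt 3 ^ n \<le> 1 + Hdot_norm s_crit (u x)"
      proof (cases "t = x")
        case True
        then show ?thesis using x by simp
      next
        case False
        have tT: "0 \<le> t" "ereal t < T" using t lt by auto
        have "norm (coef (u t) k - coef (u x) k) * sqrt 3 ^ n < 1"
          using mild_coef_diff[OF tT xT k] d(2)[OF tT False] t ab by (simp add: dist_real_def abs_less_iff)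
        moreover have "norm (coef (u t) k) * sqrt 3 ^ n \<le> (norm (coef (u t) k - coef (u x) k) + norm (coef (u x) k)) * sqrt 3 ^ n"
          using norm_triangle_sub[of "coef (u t) k" "coef (u x) k"] by (intro mult_right_mono) (simp_all add: add.commute)
        ultimately show ?thesis using x by (simp add: distrib_right)
      qed
    qed
    then show ?case using d(1) by blast
  qed
  then show ?thesis unfolding P_def by simp
qed

lemma mild_initial: "coef (u 0) k = coef u0 k"
proof -
  have "0 < T" "AE x in lebesgue. u 0 x = u0 x" using mild by (auto simp: mild_solution_def)
  moreover then have "u 0 \<in> HdotM s_crit" by (intro mild_HdotM) (auto simp: zero_ereal_def)
  ultimately have "fhat (u 0) k = fhat u0 k"
    using u0 by (intro coef_cong_AE) (auto simp: HdotM_def Hdot_def)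
  then show ?thesis by (simp add: coef_def)
qed

lemma mild_nonlin_continuous:
  assumes "ereal t < T"
  shows "continuous_on {0..t} (\<lambda>\<tau>. shell_nonlin (coef (u \<tau>)) n k)"
proof (rule continuous_on_shell_nonlin)
  fix m k assume "k \<in> Mshell m"
  then have "k \<in> shellpm m" by (simp add: mem_shellpm)
  moreover have "{0..t} \<subseteq> {t. 0 \<le> t \<and> ereal t < T}"
    using assms by (auto intro: le_less_trans[of "ereal _" "ereal t"])
  ultimately show "continuous_on {0..t} (\<lambda>\<tau>. coef (u \<tau>) k)"
    by (rule continuous_on_subset[OF mild_coef_continuous])
qed

text \<open>The component along v^k of the mild formulation. At t = 0, which that formulation leaves
  out, the identity is the initial condition.\<close>

lemma mild_coef_equation:
  assumes t: "0 \<le> t" "ereal t < T" and k: "k \<in> Mshell n"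
  shows "coef (u t) k = exp (- t * (\<nu> * shell_rate \<alpha> n)) *\<^sub>R coef u0 k
    - integral {0..t} (\<lambda>\<tau>. exp (- (t - \<tau>) * (\<nu> * shell_rate \<alpha> n)) *\<^sub>R shell_nonlin (coef (u \<tau>)) n k)"
proof (cases "t = 0")
  case True
  then show ?thesis by (simp add: mild_initial)
next
  case False
  let ?l = "\<nu> * shell_rate \<alpha> n" and ?v = "cvec (vdir k)"
  let ?f = "\<lambda>\<tau>. exp (- (t - \<tau>) * ?l) *\<^sub>R shell_nonlin (coef (u \<tau>)) n k"
  have kM: "k \<in> Mset" using k by (auto simp: Mset_iff)
  have lap: "lap_symbol \<alpha> k = shell_rate \<alpha> n" by (simp add: lap_symbol_Mshell[OF k] shell_rate_def)
  have bl: "bounded_linear (\<lambda>z. z *s ?v)"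
  proof -
    have "linear (\<lambda>z. z *s ?v)" by (intro linearI) (simp_all add: vec_eq_iff algebra_simps)
    then show ?thesis by (simp add: linear_conv_bounded_linear)
  qed
  have fi: "?f integrable_on {0..t}"
    by (intro integrable_continuous_interval continuous_intros mild_nonlin_continuous t)
  have "fhat (u t) k = heat \<nu> \<alpha> t (fhat u0) k
          - integral {0..t} (\<lambda>\<tau>. heat \<nu> \<alpha> (t - \<tau>) (proj_M (convection (u \<tau>))) k)"
    using mild t False by (simp add: mild_solution_def)
  also have "integral {0..t} (\<lambda>\<tau>. heat \<nu> \<alpha> (t - \<tau>) (proj_M (convection (u \<tau>))) k) = integral {0..t} ((\<lambda>z. z *s ?v) \<circ> ?f)"
  proof (rule Henstock_Kurzweil_Integration.integral_cong)
    fix \<tau> assume \<tau>: "\<tau> \<in> {0..t}"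
    have "ereal \<tau> < T" using \<tau> t(2) by (auto intro: le_less_trans[of "ereal _" "ereal t"])
    then have "u \<tau> \<in> HdotM s_crit" using \<tau> by (intro mild_HdotM) auto
    from convection_coef[OF this k]
    have "proj_M (convection (u \<tau>)) k = shell_nonlin (coef (u \<tau>)) n k *s ?v"
      using kM by (simp add: proj_M_def)
    then show "heat \<nu> \<alpha> (t - \<tau>) (proj_M (convection (u \<tau>))) k = ((\<lambda>z. z *s ?v) \<circ> ?f) \<tau>"
      by (simp add: heat_def lap vec_eq_iff algebra_simps)
  qed
  also have "\<dots> = integral {0..t} ?f *s ?v" by (rule integral_linear[OF fi bl])
  also have "heat \<nu> \<alpha> t (fhat u0) k = (exp (- t * ?l) *\<^sub>R coef u0 k) *s ?v"
    by (simp add: heat_def lap fhat_coef[OF u0] vec_eq_iff algebra_simps)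
  finally have *: "fhat (u t) k = (exp (- t * ?l) *\<^sub>R coef u0 k - integral {0..t} ?f) *s ?v"
    by (simp add: vec_eq_iff algebra_simps)
  define z where "z = exp (- t * ?l) *\<^sub>R coef u0 k - integral {0..t} ?f"
  have z: "fhat (u t) k = z *s ?v" using * by (simp only: z_def)
  have "coef (u t) k = (\<Sum>i\<in>UNIV. complex_of_real (vdir k $ i) * complex_of_real (vdir k $ i)) * z"
    unfolding coef_def[of "u t"] z using kM by (simp add: cvec_def sum_distrib_left mult_ac)
  then have "coef (u t) k = z" unfolding cvec_dot using vdir_sq_Mset[OF kM] by simp
  then show ?thesis by (simp only: z_def)
qed

lemma mild_shell_mild:
  assumes t1: "0 \<le> t1" "ereal t1 < T"
  shows "\<exists>B. shell_mild B (\<lambda>n. \<nu> * shell_rate \<alpha> n) t1 (coef u0) (\<lambda>t. coef (u t))"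
proof -
  obtain B where B: "\<forall>t\<in>{0..t1}. \<forall>n. \<forall>k\<in>shellpm n. norm (coef (u t) k) * sqrt 3 ^ n \<le> B"
    using mild_coef_bounded[OF t1] by blast
  have lt: "ereal t < T" if "t \<le> t1" for t using that t1(2) by (meson ereal_less_eq(3) le_less_trans)
  have sub: "{0..t1} \<subseteq> {t. 0 \<le> t \<and> ereal t < T}" using lt by auto
  show ?thesis
    unfolding shell_mild_def
  proof (intro exI[of _ B] conjI ballI allI)
    fix n k assume k: "k \<in> Mshell n"
    then have "k \<in> shellpm n" by (simp add: mem_shellpm)
    then show "continuous_on {0..t1} (\<lambda>t. coef (u t) k)"
      by (rule continuous_on_subset[OF mild_coef_continuous sub])
    fix t assume t: "t \<in> {0..t1}"
    show "norm (coef (u t) k) * sqrt 3 ^ n \<le> B" using B k t by (simp add: mem_shellpm)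
    show "coef (u t) k = exp (- t * (\<nu> * shell_rate \<alpha> n)) *\<^sub>R coef u0 k
      - integral {0..t} (\<lambda>\<tau>. exp (- (t - \<tau>) * (\<nu> * shell_rate \<alpha> n)) *\<^sub>R shell_nonlin (coef (u \<tau>)) n k)"
      using t lt by (intro mild_coef_equation k) auto
  qed
qed

text \<open>Both \<open>c\<close> and \<open>- cnj c\<close> solve the coefficient system, so uniqueness makes the coefficients
  purely imaginary and constant on each shell.\<close>

lemma mild_symmetric_coef:
  assumes \<psi>0: "\<And>n k. k \<in> Mshell n \<Longrightarrow> coef u0 k = \<i> * complex_of_real (\<psi>0 n)"
    and t: "0 \<le> t" "ereal t < T" and k: "k \<in> Mshell n" "k' \<in> Mshell n"
  shows "coef (u t) k = \<i> * complex_of_real (Im (coef (u t) k'))"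
proof -
  obtain B where m: "shell_mild B (\<lambda>n. \<nu> * shell_rate \<alpha> n) t (coef u0) (\<lambda>t. coef (u t))"
    using mild_shell_mild[OF t] by blast
  have l: "0 \<le> \<nu> * shell_rate \<alpha> n" for n using \<nu> by (simp add: shell_rate_def)
  have "coef (u t) k = - cnj (coef (u t) k')"
    by (rule shell_mild_unique[OF m shell_mild_conj[OF m] l _ _ k]) (use t \<psi>0 in auto)
  moreover have "coef (u t) k = coef (u t) k'"
    by (rule shell_mild_unique[OF m m l _ _ k]) (use t \<psi>0 in auto)
  ultimately show ?thesis by (simp add: complex_eq_iff)
qed

lemma mild_coef_derivative:
  assumes t: "0 < t" "ereal t < T" and k: "k \<in> Mshell n"
  shows "((\<lambda>t. coef (u t) k) has_vector_derivative
    (- (\<nu> * shell_rate \<alpha> n) *\<^sub>R coef (u t) k - shell_nonlin (coef (u t)) n k)) (at t)"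
proof -
  let ?l = "\<nu> * shell_rate \<alpha> n"
  obtain t1 where t1: "ereal t < ereal t1" "ereal t1 < T" using ereal_dense2[OF t(2)] by blast
  have lt: "ereal s < T" if "s \<le> t1" for s using that t1(2) by (meson ereal_less_eq(3) le_less_trans)
  \<comment> \<open>With exp (- s l) taken out of the Duhamel integral the integrand no longer
    depends on the upper limit, so the fundamental theorem of calculus applies.\<close>
  define g where "g \<tau> = exp (\<tau> * ?l) *\<^sub>R shell_nonlin (coef (u \<tau>)) n k" for \<tau>
  define J where "J s = integral {0..s} g" for s
  define E where "E s = exp (- s * ?l) *\<^sub>R (coef u0 k - J s)" for s
  have gc: "continuous_on {0..t1} g"
    unfolding g_def by (intro continuous_intros mild_nonlin_continuous t1)
  have E: "E s = coef (u s) k" if s: "s \<in> {0<..<t1}" for s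
  proof -
    have "exp (- s * ?l) *\<^sub>R J s = integral {0..s} (\<lambda>\<tau>. exp (- s * ?l) *\<^sub>R g \<tau>)"
      unfolding J_def by (rule integral_cmul[symmetric])
    also have "\<dots> = integral {0..s} (\<lambda>\<tau>. exp (- (s - \<tau>) * ?l) *\<^sub>R shell_nonlin (coef (u \<tau>)) n k)"
      by (simp add: g_def algebra_simps flip: exp_add)
    finally show ?thesis
      using mild_coef_equation[OF _ lt k, of s] s by (simp add: E_def scaleR_diff_right)
  qed
  have J: "(J has_vector_derivative g t) (at t)"
  proof -
    have "(J has_vector_derivative g t) (at t within {0..t1})"
      unfolding J_def using t t1 by (intro integral_has_vector_derivative gc) auto
    then show ?thesis using t t1 by (simp add: at_within_Icc_at)
  qed
  have "((\<lambda>s. exp (- s * ?l)) has_field_derivative - ?l * exp (- t * ?l)) (at t)"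
    by (auto intro!: derivative_eq_intros)
  then have "(E has_vector_derivative (exp (- t * ?l) *\<^sub>R (0 - g t) + (- ?l * exp (- t * ?l)) *\<^sub>R (coef u0 k - J t))) (at t)"
    unfolding E_def by (intro has_vector_derivative_scaleR has_vector_derivative_diff has_vector_derivative_const J)
  moreover have "exp (- t * ?l) *\<^sub>R (0 - g t) + (- ?l * exp (- t * ?l)) *\<^sub>R (coef u0 k - J t)
      = - ?l *\<^sub>R coef (u t) k - shell_nonlin (coef (u t)) n k"
  proof -
    have "exp (- t * ?l) *\<^sub>R (0 - g t) = - shell_nonlin (coef (u t)) n k"
      by (simp add: g_def flip: exp_add)
    moreover have "(- ?l * exp (- t * ?l)) *\<^sub>R (coef u0 k - J t) = - ?l *\<^sub>R E t"
      by (simp only: E_def scaleR_scaleR)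
    moreover have "E t = coef (u t) k" using t t1 by (intro E) auto
    ultimately show ?thesis by simp
  qed
  ultimately have "(E has_vector_derivative (- ?l *\<^sub>R coef (u t) k - shell_nonlin (coef (u t)) n k)) (at t)"
    by (simp only:)
  then show ?thesis
    by (rule has_vector_derivative_transform_within_open[of _ _ _ "{0<..<t1}"]) (use t t1 E in auto)
qed

end

section \<open>Shell amplitudes and their system of ODEs\<close>

lemma shell_nonlin_symmetric:
  assumes c: "\<And>n k. k \<in> Mshell n \<Longrightarrow> c k = \<i> * complex_of_real (a n)" and k: "k \<in> Mshell n"
  shows "shell_nonlin c n k = \<i> * complex_of_real (4 * pi * Kn n * a n * a (n + 1)
    - (if n = 0 then 0 else 4 * pi * Kn (n - 1) * (a (n - 1))\<^sup>2))"
proof -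
  \<comment> \<open>Two pairs each contribute (\<i> x)(- \<i> y) = x y; in the sum over the lower
    shell (\<i> x)^2 = - x^2 has the opposite sign.\<close>
  have D: "(\<Sum>(x, y)\<in>diff_pairs n k. c x * cnj (c y)) = complex_of_real (2 * (a (Suc n) * a n))"
  proof -
    have "(\<Sum>(x, y)\<in>diff_pairs n k. c x * cnj (c y)) =
      (\<Sum>z\<in>diff_pairs n k. complex_of_real (a (Suc n) * a n))"
      by (rule sum.cong) (auto simp: c complex_eq_iff)
    then show ?thesis using card_shell_diffs[OF k] by simp
  qed
  have U: "(\<Sum>(x, y)\<in>sum_pairs m k. c x * c y) = complex_of_real (- 2 * (a m)\<^sup>2)"
    if "n = Suc m" for m
  proof -
    have "(\<Sum>(x, y)\<in>sum_pairs m k. c x * c y) =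
      (\<Sum>z\<in>sum_pairs m k. complex_of_real (- (a m)\<^sup>2))"
      by (rule sum.cong) (auto simp: c complex_eq_iff power2_eq_square)
    then show ?thesis using card_shell_sums[of k m] k that by simp
  qed
  show ?thesis
    unfolding shell_nonlin_def D using U by (cases n) (simp_all add: complex_eq_iff algebra_simps)
qed

text \<open>4 pi is the 2 pi of the derivative times the two triads; sqrt 6 = sqrt 2 sqrt 3 raises
  the power of sqrt 3 by one.\<close>

lemma Kn_coefficient: "4 * pi * Kn n = sqrt 2 * pi * beta n * sqrt 3 ^ (n + 1)"
proof -
  have "sqrt 6 = sqrt 2 * sqrt (3::real)" by (simp flip: real_sqrt_mult)
  then show ?thesis by (simp add: Kn_def)
qed


text \<open>The choice of k is immaterial for symmetric data, where the coefficients are constant on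
  each shell (\<open>mild_shell_amp\<close>).\<close>

definition shell_amp :: "(real \<Rightarrow> real^3 \<Rightarrow> real^3) \<Rightarrow> nat \<Rightarrow> real \<Rightarrow> real" where
  "shell_amp u n t = Im (coef (u t) (SOME k. k \<in> Mshell n))"

lemma some_Mshell: "(SOME k. k \<in> Mshell n) \<in> Mshell n"
  by (rule someI_ex[OF Mshell_nonempty])

context
  fixes \<nu> \<alpha> :: real and u0 :: "real^3 \<Rightarrow> real^3" and u :: "real \<Rightarrow> real^3 \<Rightarrow> real^3" and T :: ereal
    and \<psi>0 :: "nat \<Rightarrow> real"
  assumes \<nu>: "0 < \<nu>" and u0: "u0 \<in> HdotM s_crit" and mild: "mild_solution \<nu> \<alpha> s_crit u0 u T"
    and \<psi>0: "\<forall>n. \<forall>k\<in>Mshell n. coef u0 k = \<i> * complex_of_real (\<psi>0 n)"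
begin

lemma mild_shell_amp:
  assumes "0 \<le> t" "ereal t < T" "k \<in> Mshell n"
  shows "coef (u t) k = \<i> * complex_of_real (shell_amp u n t)"
  unfolding shell_amp_def
  by (rule mild_symmetric_coef[OF \<nu> u0 mild _ assms some_Mshell]) (use \<psi>0 in blast)

lemma shell_amp_0: "shell_amp u n 0 = \<psi>0 n"
  by (simp add: shell_amp_def mild_initial[OF \<nu> u0 mild] \<psi>0[rule_format, OF some_Mshell])

lemma mild_shell_expansion:
  assumes "0 \<le> t" "ereal t < T"
  shows "shell_expansion (\<lambda>n. shell_amp u n t) (u t)"
  by (rule shell_expansion_coef[OF mild_HdotM[OF \<nu> u0 mild assms] mild_shell_amp[OF assms]])

lemma shell_amp_ode:
  assumes t: "0 < t" "ereal t < T"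
  shows "(shell_amp u n has_real_derivative shell_rhs \<nu> \<alpha> (\<lambda>m. shell_amp u m t) n) (at t)"
proof -
  let ?k = "SOME k. k \<in> Mshell n"
  have c: "coef (u t) k = \<i> * complex_of_real (shell_amp u m t)" if "k \<in> Mshell m" for k m
    using mild_shell_amp[of t k m] t that by simp
  have N: "shell_nonlin (coef (u t)) n ?k = \<i> * complex_of_real (4 * pi * Kn n * shell_amp u n t * shell_amp u (n + 1) t
    - (if n = 0 then 0 else 4 * pi * Kn (n - 1) * (shell_amp u (n - 1) t)\<^sup>2))"
    by (rule shell_nonlin_symmetric[OF _ some_Mshell]) (rule c)
  have "((\<lambda>t. Im (coef (u t) ?k)) has_vector_derivative
      Im (- (\<nu> * shell_rate \<alpha> n) *\<^sub>R coef (u t) ?k - shell_nonlin (coef (u t)) n ?k)) (at t)"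
    by (rule bounded_linear.has_vector_derivative[OF bounded_linear_Im mild_coef_derivative[OF \<nu> u0 mild t some_Mshell]])
  moreover have "Im (- (\<nu> * shell_rate \<alpha> n) *\<^sub>R coef (u t) ?k - shell_nonlin (coef (u t)) n ?k) =
      shell_rhs \<nu> \<alpha> (\<lambda>m. shell_amp u m t) n"
    unfolding N c[OF some_Mshell]
    by (cases n) (simp_all add: shell_rhs_def shell_rate_def Kn_coefficient)
  ultimately show ?thesis
    by (simp add: has_real_derivative_iff_has_vector_derivative shell_amp_def[abs_def])
qed

lemma shell_amp_continuous:
  assumes "0 \<le> t" "ereal t < T"
  shows "continuous_on {0..t} (shell_amp u n)"
proof -
  have sub: "{0..t} \<subseteq> {t. 0 \<le> t \<and> ereal t < T}"
    using assms by (auto intro: le_less_trans[of "ereal _" "ereal t"])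
  have "(SOME k. k \<in> Mshell n) \<in> shellpm n" by (simp add: mem_shellpm some_Mshell)
  from continuous_on_subset[OF mild_coef_continuous[OF \<nu> u0 mild this] sub]
  show ?thesis unfolding shell_amp_def[abs_def] by (intro continuous_intros)
qed

lemma shell_amp_bounded:
  assumes "0 \<le> t" "ereal t < T"
  shows "\<exists>B. \<forall>n. \<forall>\<tau>\<in>{0..t}. \<bar>shell_amp u n \<tau>\<bar> * sqrt 3 ^ n \<le> B"
proof -
  obtain B where B: "\<forall>t\<in>{0..t}. \<forall>n. \<forall>k\<in>shellpm n. norm (coef (u t) k) * sqrt 3 ^ n \<le> B"
    using mild_coef_bounded[OF \<nu> u0 mild assms] by blast
  have "\<bar>shell_amp u n \<tau>\<bar> * sqrt 3 ^ n \<le> B" if "\<tau> \<in> {0..t}" for n \<tau>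
  proof -
    have "\<bar>shell_amp u n \<tau>\<bar> * sqrt 3 ^ n \<le> norm (coef (u \<tau>) (SOME k. k \<in> Mshell n)) * sqrt 3 ^ n"
      unfolding shell_amp_def by (intro mult_right_mono abs_Im_le_cmod) simp
    also have "\<dots> \<le> B" using B that by (simp add: mem_shellpm some_Mshell)
    finally show ?thesis .
  qed
  then show ?thesis by blast
qed

end

theorem theorem1p12:
  fixes \<nu> \<alpha> :: real and u0 :: "real^3 \<Rightarrow> real^3"
  assumes "\<nu> > 0" and "\<alpha> > 0"
    and "u0 \<in> HdotM s_crit"
    and "odd_field u0" and "perm_symmetric u0" and "mirror_symmetric u0"
  shows "\<exists>\<psi>0. shell_expansion \<psi>0 u0 \<and>
    (\<forall>u Tmax. maximal_solution \<nu> \<alpha> s_crit u0 u Tmax \<longrightarrow>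
      (\<forall>t. 0 \<le> t \<and> ereal t < Tmax \<longrightarrow>
         odd_field (u t) \<and> perm_symmetric (u t) \<and> mirror_symmetric (u t)) \<and>
      (\<exists>\<psi> :: nat \<Rightarrow> real \<Rightarrow> real.
        (\<forall>n. \<psi> n 0 = \<psi>0 n) \<and>
        (\<forall>t. 0 \<le> t \<and> ereal t < Tmax \<longrightarrow> shell_expansion (\<lambda>n. \<psi> n t) (u t)) \<and>
        (\<forall>t n. 0 < t \<and> ereal t < Tmax \<longrightarrow>
           (\<psi> n has_real_derivative shell_rhs \<nu> \<alpha> (\<lambda>m. \<psi> m t) n) (at t)) \<and>
        (\<alpha> < ln 3 / (6 * ln 2) \<longrightarrow>
          (\<forall>s. alpha_t \<alpha> < s \<and> s < 1/3 \<and> lyap s \<psi>0 > C_const \<alpha> s * \<nu> \<longrightarrow>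
             Tmax \<le> ereal (1 / (kappa s * lyap s \<psi>0)) \<and>
             (\<forall>t. 0 \<le> t \<and> ereal t < Tmax \<longrightarrow> summable (lyap_term s (\<lambda>n. \<psi> n t))) \<and>
             (\<forall>t. 0 < t \<and> ereal t < Tmax \<longrightarrow>
                lyap s (\<lambda>n. \<psi> n t) > lyap s \<psi>0 / (1 - kappa s * lyap s \<psi>0 * t))))))"
proof -
  obtain \<psi>0 :: "nat \<Rightarrow> real" where \<psi>0: "\<forall>n. \<forall>k\<in>Mshell n. coef u0 k = \<i> * complex_of_real (\<psi>0 n)"
    using symmetric_coef[OF assms(3-6)] ..
  have mild: "mild_solution \<nu> \<alpha> s_crit u0 u T" if "maximal_solution \<nu> \<alpha> s_crit u0 u T" for u T
    using that by (simp add: maximal_solution_def)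
  note expansion = mild_shell_expansion[OF assms(1,3) mild \<psi>0]
  show ?thesis
  proof (rule exI[of _ \<psi>0], intro conjI allI impI)
    show "shell_expansion \<psi>0 u0" by (rule shell_expansion_coef[OF assms(3)]) (simp add: \<psi>0)
  next
    fix u Tmax t assume max: "maximal_solution \<nu> \<alpha> s_crit u0 u Tmax" and "0 \<le> t \<and> ereal t < Tmax"
    \<comment> \<open>The expansion is established first, and the symmetries at time t follow from
      it.\<close>
    then have ex: "shell_expansion (\<lambda>n. shell_amp u n t) (u t)" by (intro expansion[OF max]) simp_all
    show "odd_field (u t)" "perm_symmetric (u t)" "mirror_symmetric (u t)"
      by (rule shell_expansion_symmetric[OF ex])+
  next
    fix u Tmax assume max: "maximal_solution \<nu> \<alpha> s_crit u0 u Tmax"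
    note amp = assms(1,3) mild[OF max] \<psi>0
    have amp_0: "(\<lambda>n. shell_amp u n 0) = \<psi>0" by (rule ext) (rule shell_amp_0[OF amp])
    show "\<exists>\<psi>. (\<forall>n. \<psi> n 0 = \<psi>0 n) \<and>
        (\<forall>t. 0 \<le> t \<and> ereal t < Tmax \<longrightarrow> shell_expansion (\<lambda>n. \<psi> n t) (u t)) \<and>
        (\<forall>t n. 0 < t \<and> ereal t < Tmax \<longrightarrow>
           (\<psi> n has_real_derivative shell_rhs \<nu> \<alpha> (\<lambda>m. \<psi> m t) n) (at t)) \<and>
        (\<alpha> < ln 3 / (6 * ln 2) \<longrightarrow>
          (\<forall>s. alpha_t \<alpha> < s \<and> s < 1/3 \<and> lyap s \<psi>0 > C_const \<alpha> s * \<nu> \<longrightarrow>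
             Tmax \<le> ereal (1 / (kappa s * lyap s \<psi>0)) \<and>
             (\<forall>t. 0 \<le> t \<and> ereal t < Tmax \<longrightarrow> summable (lyap_term s (\<lambda>n. \<psi> n t))) \<and>
             (\<forall>t. 0 < t \<and> ereal t < Tmax \<longrightarrow>
                lyap s (\<lambda>n. \<psi> n t) > lyap s \<psi>0 / (1 - kappa s * lyap s \<psi>0 * t))))"
    proof (rule exI[of _ "shell_amp u"], intro conjI allI impI)
      show "shell_amp u n 0 = \<psi>0 n" for n by (rule shell_amp_0[OF amp])
      show "shell_expansion (\<lambda>n. shell_amp u n t) (u t)" if "0 \<le> t \<and> ereal t < Tmax" for t
        by (rule expansion[OF max conjunct1[OF that] conjunct2[OF that]])
      show "(shell_amp u n has_real_derivative shell_rhs \<nu> \<alpha> (\<lambda>m. shell_amp u m t) n) (at t)"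
        if "0 < t \<and> ereal t < Tmax" for t n
        by (rule shell_amp_ode[OF amp conjunct1[OF that] conjunct2[OF that]])
      fix s assume s: "alpha_t \<alpha> < s \<and> s < 1/3 \<and> lyap s \<psi>0 > C_const \<alpha> s * \<nu>"
      then have H0: "lyap s (\<lambda>n. shell_amp u n 0) > C_const \<alpha> s * \<nu>" by (simp add: amp_0)
      note blowup = shell_blowup[where T = Tmax, OF assms(2,1) conjunct1[OF s] conjunct1[OF conjunct2[OF s]] shell_amp_ode[OF amp]
          shell_amp_continuous[OF amp] shell_amp_bounded[OF amp] H0, unfolded amp_0]
      show "Tmax \<le> ereal (1 / (kappa s * lyap s \<psi>0))" by (rule blowup(1))
      show "summable (lyap_term s (\<lambda>n. shell_amp u n t))" if "0 \<le> t \<and> ereal t < Tmax" for t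
        by (rule blowup(2)) (use that in auto)
      show "lyap s (\<lambda>n. shell_amp u n t) > lyap s \<psi>0 / (1 - kappa s * lyap s \<psi>0 * t)" if "0 < t \<and> ereal t < Tmax" for t
        by (rule blowup(3)) (use that in auto)
    qed
  qed
qed

end
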